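(* Let $G$ be a $P_5$-free graph. Let $\mathcal{G} = \{K_5, H_0, G_{P_2}, K_{3,3}, K_{3,3}^*, \overline{C_6}, G_1, G_2, G_3, G_4, K_4^-\}$. Then $G$ is contact $B_0$-VPG if and only if $G$ is $\mathcal{G}$-free.
   Context: All graphs are finite and simple. A contact $B_0$-VPG representation of a graph $G$ assigns to each vertex $v$ a path $P_v$ on a rectangular grid such that: each $P_v$ is a horizontal or a vertical path on the grid (no bends) of length at least one (it contains at least one grid-edge); no two paths share a grid-edge; no two paths cross (no grid-point is an interior point of two distinct paths); and distinct vertices $u,v$ are adjacent if and only if $P_u$ and $P_v$ have at least one grid-point in common. A graph is contact $B_0$-VPG if it has such a representation. $P_n$, $C_n$ are the path and cycle on $n$ vertices; $\overline{C_6}$ is the complement of $C_6$. A graph is $\mathcal{H}$-free if no induced subgraph of it is isomorphic to a member of $\mathcal{H}$ (and $H$-free means $\{H\}$-free). $K_4^-$ is $K_4$ minus one edge. $K_{3,3}^*$ is obtained from $K_{3,3}$ by subdividing exactly one edge once. $H_0$ is the graph composed of three copies of $K_4$ sharing one common vertex, with no further edges. $G_{P_2}$ consists of two adjacent vertices $p,q$ together with four pairwise disjoint and pairwise anticomplete triangles, two of them complete to $p$ and anticomplete to $q$, the other two complete to $q$ and anticomplete to $p$, with no further edges. For the next graphs let $C$ be a cycle of length five with vertices, in cyclic order, $a,v,b,c,w$ (edges $av,vb,bc,cw,wa$). - $G_1$ (12 vertices): add to $C$ a vertex $u$ adjacent to $a,b,c$, and two disjoint, mutually anticomplete triangles, each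 complete to $u$ and anticomplete to $C$. - $G_2$ (7 vertices): add to $C$ a vertex $u$ adjacent to $a,b$ and a vertex $z$ adjacent to $a,c$, and the edge $uz$. - $G_3$ (7 vertices): add to $C$ a vertex $u$ adjacent to $a,b,c$ and a vertex $z$ adjacent to $v,b,w$, with $u,z$ non-adjacent. - $G_4$ (10 vertices): add to $C$ a vertex $u$ adjacent to $a,b,c$, a vertex $z$ adjacent to $v,w,u$, and one triangle complete to $u$ and anticomplete to all other vertices. In each case there are no further edges. *)

theory Defs
  imports Main
begin

section \<open>Finite simple graphs\<close>

type_synonym 'a graph = "'a set \<times> 'a set set"

abbreviation verts :: "'a graph \<Rightarrow> 'a set" where
  "verts G \<equiv> fst G"

abbreviation edges :: "'a graph \<Rightarrow> 'a set set" where
  "edges G \<equiv> snd G"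

definition all_edges :: "'a set \<Rightarrow> 'a set set" where
  "all_edges S = {e. e \<subseteq> S \<and> card e = 2}"

definition simple_graph :: "'a graph \<Rightarrow> bool" where
  "simple_graph G \<longleftrightarrow> finite (verts G) \<and> edges G \<subseteq> all_edges (verts G)"

definition adj :: "'a graph \<Rightarrow> 'a \<Rightarrow> 'a \<Rightarrow> bool" where
  "adj G u v \<longleftrightarrow> {u, v} \<in> edges G"

definition induced_subgraph :: "'a graph \<Rightarrow> 'a set \<Rightarrow> 'a graph" where
  "induced_subgraph G S = (S, {e \<in> edges G. e \<subseteq> S})"

definition graph_iso :: "'a graph \<Rightarrow> 'b graph \<Rightarrow> bool" where
  "graph_iso G H \<longleftrightarrow>
     (\<exists>f. bij_betw f (verts G) (verts H) \<and>
          (\<forall>u\<in>verts G. \<forall>v\<in>verts G. adj G u v \<longleftrightarrow> adj H (f u) (f v)))"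

definition graph_free :: "'b graph set \<Rightarrow> 'a graph \<Rightarrow> bool" where
  "graph_free \<H> G \<longleftrightarrow>
     \<not> (\<exists>S H. S \<subseteq> verts G \<and> H \<in> \<H> \<and> graph_iso (induced_subgraph G S) H)"

section \<open>Contact representations by straight grid paths\<close>

text \<open>The grid is the integer lattice; since graphs are finite, only a finite rectangular
  part of it is ever used. \<open>Horizontal y i j\<close> runs from \<open>(i, y)\<close> to \<open>(j, y)\<close>, and
  \<open>Vertical x i j\<close> from \<open>(x, i)\<close> to \<open>(x, j)\<close>.\<close>

datatype grid_path = Horizontal int int int | Vertical int int int

fun path_points :: "grid_path \<Rightarrow> (int \<times> int) set" where
  "path_points (Horizontal y i j) = {(x, y) | x. i \<le> x \<and> x \<le> j}"
| "path_points (Vertical x i j) = {(x, y) | y. i \<le> y \<and> y \<le> j}"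

fun path_ends :: "grid_path \<Rightarrow> (int \<times> int) set" where
  "path_ends (Horizontal y i j) = {(i, y), (j, y)}"
| "path_ends (Vertical x i j) = {(x, i), (x, j)}"

definition path_interior :: "grid_path \<Rightarrow> (int \<times> int) set" where
  "path_interior p = path_points p - path_ends p"

fun path_grid_edges :: "grid_path \<Rightarrow> (int \<times> int) set set" where
  "path_grid_edges (Horizontal y i j) = {{(x, y), (x + 1, y)} | x. i \<le> x \<and> x < j}"
| "path_grid_edges (Vertical x i j) = {{(x, y), (x, y + 1)} | y. i \<le> y \<and> y < j}"

definition contact_B0_VPG_rep :: "'a graph \<Rightarrow> ('a \<Rightarrow> grid_path) \<Rightarrow> bool" where
  "contact_B0_VPG_rep G P \<longleftrightarrow>
     (\<forall>v\<in>verts G. path_grid_edges (P v) \<noteq> {}) \<and>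
     (\<forall>u\<in>verts G. \<forall>v\<in>verts G. u \<noteq> v \<longrightarrow>
        path_grid_edges (P u) \<inter> path_grid_edges (P v) = {} \<and>
        path_interior (P u) \<inter> path_interior (P v) = {} \<and>
        (adj G u v \<longleftrightarrow> path_points (P u) \<inter> path_points (P v) \<noteq> {}))"

definition contact_B0_VPG :: "'a graph \<Rightarrow> bool" where
  "contact_B0_VPG G \<longleftrightarrow> (\<exists>P. contact_B0_VPG_rep G P)"

section \<open>Named graphs\<close>

definition star_edges :: "'a \<Rightarrow> 'a set \<Rightarrow> 'a set set" where
  "star_edges u S = {{u, x} | x. x \<in> S}"

definition graph_complement :: "'a graph \<Rightarrow> 'a graph" where
  "graph_complement G = (verts G, all_edges (verts G) - edges G)"

definition delete_edge :: "'a graph \<Rightarrow> 'a \<Rightarrow> 'a \<Rightarrow> 'a graph" where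
  "delete_edge G u v = (verts G, edges G - {{u, v}})"

text \<open>The new vertex \<open>w\<close> is meant to lie outside \<open>G\<close>, and \<open>{u, v}\<close> to be an edge of \<open>G\<close>.\<close>

definition subdivide_edge :: "'a graph \<Rightarrow> 'a \<Rightarrow> 'a \<Rightarrow> 'a \<Rightarrow> 'a graph" where
  "subdivide_edge G u v w =
     (insert w (verts G), (edges G - {{u, v}}) \<union> {{u, w}, {w, v}})"

definition path_graph :: "nat \<Rightarrow> nat graph" where
  "path_graph n = ({..<n}, {{i, i + 1} | i. i + 1 < n})"

text \<open>A cycle only for \<open>n \<ge> 3\<close>.\<close>

definition cycle_graph :: "nat \<Rightarrow> nat graph" where
  "cycle_graph n = ({..<n}, {{i, (i + 1) mod n} | i. i < n})"

definition complete_graph :: "nat \<Rightarrow> nat graph" where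
  "complete_graph n = ({..<n}, all_edges {..<n})"

definition complete_bipartite_graph :: "nat \<Rightarrow> nat \<Rightarrow> nat graph" where
  "complete_bipartite_graph m n = ({..<m + n}, {{i, j} | i j. i < m \<and> m \<le> j \<and> j < m + n})"

definition K4_minus :: "nat graph" where
  "K4_minus = delete_edge (complete_graph 4) 0 1"

definition K33_star :: "nat graph" where
  "K33_star = subdivide_edge (complete_bipartite_graph 3 3) 0 3 6"

definition H0 :: "nat graph" where
  "H0 = ({..<10}, all_edges {0, 1, 2, 3} \<union> all_edges {0, 4, 5, 6} \<union> all_edges {0, 7, 8, 9})"

text \<open>Here \<open>p = 0\<close> and \<open>q = 1\<close>. A triangle complete to a vertex forms a \<open>K\<^sub>4\<close> with it.\<close>

definition G_P2 :: "nat graph" where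
  "G_P2 = ({..<14}, {{0, 1}} \<union>
     all_edges {0, 2, 3, 4} \<union> all_edges {0, 5, 6, 7} \<union>
     all_edges {1, 8, 9, 10} \<union> all_edges {1, 11, 12, 13})"

text \<open>In the next four graphs the five-cycle \<open>a, v, b, c, w\<close> is \<open>0, 1, 2, 3, 4\<close>, the vertex
  \<open>u\<close> is \<open>5\<close>, and \<open>z\<close> (absent from \<open>G1\<close>) is \<open>6\<close>.\<close>

definition G1 :: "nat graph" where
  "G1 = ({..<12}, edges (cycle_graph 5) \<union> star_edges 5 {0, 2, 3} \<union>
     all_edges {5, 6, 7, 8} \<union> all_edges {5, 9, 10, 11})"

definition G2 :: "nat graph" where
  "G2 = ({..<7}, edges (cycle_graph 5) \<union> star_edges 5 {0, 2} \<union> star_edges 6 {0, 3} \<union>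
     {{5, 6}})"

definition G3 :: "nat graph" where
  "G3 = ({..<7}, edges (cycle_graph 5) \<union> star_edges 5 {0, 2, 3} \<union> star_edges 6 {1, 2, 4})"

definition G4 :: "nat graph" where
  "G4 = ({..<10}, edges (cycle_graph 5) \<union> star_edges 5 {0, 2, 3} \<union> star_edges 6 {1, 4, 5} \<union>
     all_edges {5, 7, 8, 9})"

definition forbidden_graphs :: "nat graph set" where
  "forbidden_graphs =
     {complete_graph 5, H0, G_P2, complete_bipartite_graph 3 3, K33_star,
      graph_complement (cycle_graph 6), G1, G2, G3, G4, K4_minus}"

end

theory Submission
  imports Defs
begin

text \<open>
  If a graph has a contact representation, all members of a clique meet in one point, a \<open>K\<^sub>4\<close> uses up one
  end of each of its members, and the sides of an induced four-cycle are alternately horizontal and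
  vertical. Each forbidden graph is ruled out because these orientations are inconsistent, or because
  some path would need more than two ends, or (for \<open>K\<^sub>3\<^sub>,\<^sub>3\<close> and its subdivision) because a middle row
  would cross a middle column.

  Conversely, by induction it suffices to represent connected graphs. In a diamond-free graph every
  neighbourhood is a disjoint union of cliques, and attaching a clique of at most three vertices to
  a single vertex \<open>v\<close> of a represented graph is always possible after refining the grid, except that three
  vertices need a free end of \<open>v\<close>. So a graph is represented once it is shown to consist of a
  represented core, with enough free ends, and such pendant cliques. The core is found around an
  induced five-cycle if there is one; otherwise around an induced four-cycle whose two opposite
  corners have as many common neighbours as possible; otherwise it is a clique with largest closed
  neighbourhood. Freeness from \<open>P\<^sub>5\<close> prevents anything from being attached further away.
\<close>

section \<open>Arithmetic of grid paths\<close>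

text \<open>The scarce resource is path ends. One or two pendant vertices fit at the middle of a
  grid edge of their anchor, but a pendant triangle completes a K4 and consumes a whole free end.
  \<open>H0\<close> limits the triangles at a vertex to two, exactly the number of its ends, and
  \<open>G_P2\<close> keeps two adjacent vertices from both needing two, so along an edge of the
  core only one path has to offer two ends. \<open>K4_minus\<close> and
  \<open>complete_graph 5\<close> ensure that what hangs at a vertex splits into cliques of at most
  three vertices. For this reason drawings are compared with the numbers of
  \<open>triangles_at\<close>, and the induction that attaches cliques carries a lower bound on the
  free ends that remain, not only a representation. Where the cycle itself occupies ends of the
  anchor, \<open>G1\<close> and \<open>G4\<close> supply the missing bounds. The maximal number of
  common neighbours of two opposite corners matters through \<open>max_pair_third\<close>: a vertex
  adjacent to two of these neighbours must miss a third one, which starts the induced paths that are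
  then excluded.\<close>

fun nondeg :: "grid_path \<Rightarrow> bool" where
  "nondeg (Horizontal y i j) \<longleftrightarrow> i < j"
| "nondeg (Vertical x i j) \<longleftrightarrow> i < j"

text \<open>Both disjointness requirements become one inequality: nondegenerate collinear paths
  break either of them only by overlapping along a grid edge, while perpendicular paths share no
  grid edge and can only have a common interior point.\<close>

fun noncross :: "grid_path \<Rightarrow> grid_path \<Rightarrow> bool" where
  "noncross (Horizontal y i j) (Horizontal y' i' j') \<longleftrightarrow> (y = y' \<longrightarrow> j \<le> i' \<or> j' \<le> i)"
| "noncross (Vertical x i j) (Vertical x' i' j') \<longleftrightarrow> (x = x' \<longrightarrow> j \<le> i' \<or> j' \<le> i)"
| "noncross (Horizontal y i j) (Vertical x k l) \<longleftrightarrow> \<not> (i < x \<and> x < j \<and> k < y \<and> y < l)"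
| "noncross (Vertical x k l) (Horizontal y i j) \<longleftrightarrow> \<not> (i < x \<and> x < j \<and> k < y \<and> y < l)"

fun touch :: "grid_path \<Rightarrow> grid_path \<Rightarrow> bool" where
  "touch (Horizontal y i j) (Horizontal y' i' j') \<longleftrightarrow> y = y' \<and> i \<le> j' \<and> i' \<le> j"
| "touch (Vertical x i j) (Vertical x' i' j') \<longleftrightarrow> x = x' \<and> i \<le> j' \<and> i' \<le> j"
| "touch (Horizontal y i j) (Vertical x k l) \<longleftrightarrow> i \<le> x \<and> x \<le> j \<and> k \<le> y \<and> y \<le> l"
| "touch (Vertical x k l) (Horizontal y i j) \<longleftrightarrow> i \<le> x \<and> x \<le> j \<and> k \<le> y \<and> y \<le> l"

lemma noncross_sym: "noncross p q \<longleftrightarrow> noncross q p"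
  by (cases p; cases q) auto

lemma touch_sym: "touch p q \<longleftrightarrow> touch q p"
  by (cases p; cases q) auto

lemma nondeg_iff: "nondeg p \<longleftrightarrow> path_grid_edges p \<noteq> {}"
  by (cases p) (auto intro: exI)

lemma touch_iff:
  assumes "nondeg p" "nondeg q"
  shows "touch p q \<longleftrightarrow> path_points p \<inter> path_points q \<noteq> {}"
proof (cases p; cases q)
  fix y i j y' i' j'
  assume pq: "p = Horizontal y i j" "q = Horizontal y' i' j'"
  show ?thesis
  proof
    assume "touch p q"
    then have "(max i i', y) \<in> path_points p \<inter> path_points q" using assms pq by auto
    then show "path_points p \<inter> path_points q \<noteq> {}" by blast
  qed (use pq in auto)
next
  fix y i j y' i' j'
  assume pq: "p = Vertical y i j" "q = Vertical y' i' j'"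
  show ?thesis
  proof
    assume "touch p q"
    then have "(y, max i i') \<in> path_points p \<inter> path_points q" using assms pq by auto
    then show "path_points p \<inter> path_points q \<noteq> {}" by blast
  qed (use pq in auto)
qed auto

lemma noncross_iff:
  assumes "nondeg p" "nondeg q"
  shows "noncross p q \<longleftrightarrow>
    path_grid_edges p \<inter> path_grid_edges q = {} \<and> path_interior p \<inter> path_interior q = {}"
proof (cases p; cases q)
  fix y i j y' i' j'
  assume pq: "p = Horizontal y i j" "q = Horizontal y' i' j'"
  show ?thesis
  proof
    assume R: "path_grid_edges p \<inter> path_grid_edges q = {} \<and> path_interior p \<inter> path_interior q = {}"
    show "noncross p q"
    proof (rule ccontr)
      assume "\<not> noncross p q"
      then have "{(max i i', y), (max i i' + 1, y)} \<in> path_grid_edges p \<inter> path_grid_edges q"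
        using assms pq by auto
      then show False using R by blast
    qed
  qed (use pq in \<open>auto simp: path_interior_def doubleton_eq_iff\<close>)
next
  fix y i j y' i' j'
  assume pq: "p = Vertical y i j" "q = Vertical y' i' j'"
  show ?thesis
  proof
    assume R: "path_grid_edges p \<inter> path_grid_edges q = {} \<and> path_interior p \<inter> path_interior q = {}"
    show "noncross p q"
    proof (rule ccontr)
      assume "\<not> noncross p q"
      then have "{(y, max i i'), (y, max i i' + 1)} \<in> path_grid_edges p \<inter> path_grid_edges q"
        using assms pq by auto
      then show False using R by blast
    qed
  qed (use pq in \<open>auto simp: path_interior_def doubleton_eq_iff\<close>)
next
  fix y i j x k l
  assume pq: "p = Horizontal y i j" "q = Vertical x k l"
  show ?thesis
  proof
    assume R: "path_grid_edges p \<inter> path_grid_edges q = {} \<and> path_interior p \<inter> path_interior q = {}"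
    have "(x, y) \<in> path_interior p \<inter> path_interior q" if "\<not> noncross p q"
      using that pq by (auto simp: path_interior_def)
    then show "noncross p q" using R by blast
  qed (use pq in \<open>auto simp: path_interior_def doubleton_eq_iff\<close>)
next
  fix y i j x k l
  assume pq: "p = Vertical x k l" "q = Horizontal y i j"
  show ?thesis
  proof
    assume R: "path_grid_edges p \<inter> path_grid_edges q = {} \<and> path_interior p \<inter> path_interior q = {}"
    have "(x, y) \<in> path_interior p \<inter> path_interior q" if "\<not> noncross p q"
      using that pq by (auto simp: path_interior_def)
    then show "noncross p q" using R by blast
  qed (use pq in \<open>auto simp: path_interior_def doubleton_eq_iff\<close>)
qed

text \<open>The relation \<open>A\<close> and the vertex set are separate parameters, so that a
  drawing can be built on a growing set of vertices while the adjacency of the whole graph stays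
  fixed.\<close>

definition rep :: "('a \<Rightarrow> 'a \<Rightarrow> bool) \<Rightarrow> 'a set \<Rightarrow> ('a \<Rightarrow> grid_path) \<Rightarrow> bool" where
  "rep A V P \<longleftrightarrow> (\<forall>v\<in>V. nondeg (P v)) \<and>
     (\<forall>u\<in>V. \<forall>v\<in>V. u \<noteq> v \<longrightarrow> noncross (P u) (P v) \<and> (A u v \<longleftrightarrow> touch (P u) (P v)))"

lemma contact_rep_iff: "contact_B0_VPG_rep G P \<longleftrightarrow> rep (adj G) (verts G) P"
  unfolding contact_B0_VPG_rep_def rep_def nondeg_iff[symmetric]
  by (rule conj_cong[OF refl], intro ball_cong refl imp_cong) (auto simp: noncross_iff touch_iff)

lemma repD:
  assumes "rep A V P" "u \<in> V"
  shows rep_nondeg: "nondeg (P u)"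
    and rep_noncross: "v \<in> V \<Longrightarrow> u \<noteq> v \<Longrightarrow> noncross (P u) (P v)"
    and rep_touch: "v \<in> V \<Longrightarrow> u \<noteq> v \<Longrightarrow> touch (P u) (P v) \<longleftrightarrow> A u v"
  using assms unfolding rep_def by auto

lemma rep_cong:
  assumes "rep A V P" "\<And>u v. u \<in> V \<Longrightarrow> v \<in> V \<Longrightarrow> u \<noteq> v \<Longrightarrow> A u v \<longleftrightarrow> B u v"
  shows "rep B V P"
  using assms unfolding rep_def by auto

lemma rep_Un:
  assumes "rep A S P" "rep A T P" "\<And>u v. A u v \<longleftrightarrow> A v u"
    and "\<And>u v. u \<in> S \<Longrightarrow> v \<in> T \<Longrightarrow> u \<noteq> v \<Longrightarrow> noncross (P u) (P v) \<and> (A u v \<longleftrightarrow> touch (P u) (P v))"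
  shows "rep A (S \<union> T) P"
  using assms unfolding rep_def by (metis Un_iff noncross_sym touch_sym)

lemma rep_at_most_one:
  assumes "\<And>u. u \<in> S \<Longrightarrow> nondeg (P u)" "\<And>u v. u \<in> S \<Longrightarrow> v \<in> S \<Longrightarrow> u = v"
  shows "rep A S P"
  using assms unfolding rep_def by blast

lemma rep_insert:
  assumes "rep A S P" "nondeg (P u)" "\<And>u v. A u v \<longleftrightarrow> A v u"
    and "\<And>v. v \<in> S \<Longrightarrow> noncross (P u) (P v) \<and> (A u v \<longleftrightarrow> touch (P u) (P v))"
  shows "rep A (insert u S) P"
proof -
  have "rep A {u} P" by (rule rep_at_most_one) (use assms(2) in auto)
  then have "rep A ({u} \<union> S) P" by (rule rep_Un) (use assms in auto)
  then show ?thesis by simp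
qed

lemma rep_subset: "rep A V P \<Longrightarrow> U \<subseteq> V \<Longrightarrow> rep A U P"
  unfolding rep_def by blast

section \<open>Obstructions\<close>

text \<open>The drawing of the ambient graph is composed with the inverse of the
  isomorphism.\<close>

lemma contact_induced_rep:
  assumes "contact_B0_VPG G" "S \<subseteq> verts G" "graph_iso (induced_subgraph G S) H"
  shows "\<exists>P. rep (adj H) (verts H) P"
proof -
  obtain P where P: "rep (adj G) (verts G) P"
    using assms(1) unfolding contact_B0_VPG_def contact_rep_iff by blast
  obtain f where f: "bij_betw f S (verts H)"
    and fa: "\<And>u v. u \<in> S \<Longrightarrow> v \<in> S \<Longrightarrow> adj (induced_subgraph G S) u v \<longleftrightarrow> adj H (f u) (f v)"
    using assms(3) unfolding graph_iso_def by (auto simp: induced_subgraph_def)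
  have fa': "adj G u v \<longleftrightarrow> adj H (f u) (f v)" if "u \<in> S" "v \<in> S" for u v
    using fa[OF that] that by (auto simp: adj_def induced_subgraph_def)
  let ?g = "inv_into S f"
  have g: "?g x \<in> S" "f (?g x) = x" if "x \<in> verts H" for x
    using f that by (auto simp: bij_betw_def inv_into_into f_inv_into_f)
  have "rep (adj H) (verts H) (P \<circ> ?g)"
    unfolding rep_def
  proof (intro conjI ballI impI)
    fix v assume "v \<in> verts H"
    then show "nondeg ((P \<circ> ?g) v)" using g assms(2) rep_nondeg[OF P] by auto
  next
    fix u v assume uv: "u \<in> verts H" "v \<in> verts H" "u \<noteq> v"
    have ne: "?g u \<noteq> ?g v" using g uv by metis
    show "noncross ((P \<circ> ?g) u) ((P \<circ> ?g) v)"
      using rep_noncross[OF P, of "?g u" "?g v"] g uv ne assms(2) by auto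
    show "adj H u v \<longleftrightarrow> touch ((P \<circ> ?g) u) ((P \<circ> ?g) v)"
      using rep_touch[OF P, of "?g u" "?g v"] g uv ne assms(2) fa'[of "?g u" "?g v"] by auto
  qed
  then show ?thesis by blast
qed

section \<open>Directions and common points of paths that touch pairwise\<close>

fun horizontal :: "grid_path \<Rightarrow> bool" where
  "horizontal (Horizontal y i j) \<longleftrightarrow> True"
| "horizontal (Vertical x i j) \<longleftrightarrow> False"

lemma parallel_touch_collinear:
  assumes "nondeg p" "nondeg q" "noncross p q" "touch p q" "horizontal p = horizontal q"
  shows "\<exists>y i j k. p = Horizontal y i j \<and> q = Horizontal y j k \<or> q = Horizontal y i j \<and> p = Horizontal y j k
    \<or> p = Vertical y i j \<and> q = Vertical y j k \<or> q = Vertical y i j \<and> p = Vertical y j k"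
  using assms by (cases p; cases q; auto; blast)

text \<open>Collinear \<open>p\<close> and \<open>q\<close> abut at one point. Since
  \<open>r\<close> touches \<open>q\<close> but not \<open>p\<close>, it lies strictly beyond the
  perpendicular line through that point, on the side of \<open>q\<close>; likewise \<open>s\<close>
  lies strictly on the side of \<open>p\<close>. So \<open>r\<close> and \<open>s\<close> cannot
  meet.\<close>

lemma C4_turn:
  assumes "nondeg p" "nondeg q" "noncross p q" "touch p q"
    and "touch q r" "touch r s" "touch s p" "\<not> touch p r" "\<not> touch q s"
  shows "horizontal p \<noteq> horizontal q"
proof
  assume "horizontal p = horizontal q"
  then obtain y i j k where
    "p = Horizontal y i j \<and> q = Horizontal y j k \<or> q = Horizontal y i j \<and> p = Horizontal y j k
    \<or> p = Vertical y i j \<and> q = Vertical y j k \<or> q = Vertical y i j \<and> p = Vertical y j k"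
    using parallel_touch_collinear[OF assms(1-4)] by blast
  then show False
    using assms(1,2,5-) by (elim disjE; cases r; cases s; simp; linarith)
qed

lemma C4_alternates:
  assumes "nondeg p" "nondeg q" "nondeg r" "nondeg s"
    and "noncross p q" "noncross q r" "noncross r s" "noncross s p"
    and "touch p q" "touch q r" "touch r s" "touch s p" "\<not> touch p r" "\<not> touch q s"
  shows "horizontal p = horizontal r \<and> horizontal q = horizontal s \<and> horizontal p \<noteq> horizontal q"
proof -
  have "horizontal p \<noteq> horizontal q" "horizontal q \<noteq> horizontal r"
    "horizontal r \<noteq> horizontal s" "horizontal s \<noteq> horizontal p"
    using C4_turn[of p q r s] C4_turn[of q r s p] C4_turn[of r s p q] C4_turn[of s p q r] assms
    by (simp_all add: touch_sym[of r p] touch_sym[of s q])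
  then show ?thesis by blast
qed

text \<open>Three paths of one direction that touch pairwise would lie on one line, where a
  noncrossing interval cannot touch two others that already abut.\<close>

lemma parallel_triangle:
  assumes "nondeg p" "nondeg q" "nondeg r" "noncross p q" "noncross q r" "noncross p r"
    and "touch p q" "touch q r" "touch p r" "horizontal p = horizontal q"
  shows "horizontal r \<noteq> horizontal q"
  using assms by (cases p; cases q; cases r) auto

lemma common_point_unique:
  assumes "nondeg p" "nondeg q" "noncross p q"
    and "e \<in> path_points p" "e \<in> path_points q" "e' \<in> path_points p" "e' \<in> path_points q"
  shows "e = e'"
  using assms by (cases p; cases q) auto

lemma parallel_common_end:
  assumes "nondeg p" "nondeg q" "noncross p q" "horizontal p = horizontal q"
    and "e \<in> path_points p" "e \<in> path_points q"
  shows "e \<in> path_ends p"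
  using assms by (cases p; cases q) auto

text \<open>Two of the three are parallel, hence abut at a point; the third is perpendicular and
  meets their line in a single point, which must be that one.\<close>

lemma triangle_common_point:
  assumes "nondeg p" "nondeg q" "nondeg r" "noncross p q" "noncross q r" "noncross p r"
    and "touch p q" "touch q r" "touch p r"
  shows "\<exists>e. e \<in> path_points p \<and> e \<in> path_points q \<and> e \<in> path_points r"
  using assms by (cases p; cases q; cases r) auto

text \<open>Among \<open>q\<close>, \<open>r\<close>, \<open>s\<close> both directions occur, so one
  of them is parallel to \<open>p\<close>, and the point common to all four is then an end of
  \<open>p\<close>. This point exists because the two triangles on \<open>p\<close>,
  \<open>q\<close> meet in the only point that \<open>p\<close> and \<open>q\<close> share.\<close>

lemma K4_common_end:
  assumes "nondeg p" "nondeg q" "nondeg r" "nondeg s"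
    and "noncross p q" "noncross q r" "noncross r s" "noncross p s" "noncross p r" "noncross q s"
    and "touch p q" "touch q r" "touch r s" "touch p s" "touch p r" "touch q s"
  shows "\<exists>e \<in> path_ends p. e \<in> path_points q \<and> e \<in> path_points r \<and> e \<in> path_points s"
proof -
  obtain e where e: "e \<in> path_points p" "e \<in> path_points q" "e \<in> path_points r"
    using triangle_common_point[of p q r] assms by blast
  obtain e' where e': "e' \<in> path_points p" "e' \<in> path_points q" "e' \<in> path_points s"
    using triangle_common_point[of p q s] assms by blast
  have s: "e \<in> path_points s"
    using common_point_unique[of p q e e'] e e' assms by blast
  have "horizontal p = horizontal q \<or> horizontal p = horizontal r \<or> horizontal p = horizontal s"
    using parallel_triangle[of q r s] assms by argo
  then have "e \<in> path_ends p"
    using parallel_common_end[of p _ e] e s assms by metis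
  then show ?thesis using e s by blast
qed

lemma rep_C4:
  assumes "rep A V P" "a \<in> V" "b \<in> V" "c \<in> V" "d \<in> V" "distinct [a, b, c, d]"
    and "A a b" "A b c" "A c d" "A d a" "\<not> A a c" "\<not> A b d"
  shows "horizontal (P a) = horizontal (P c) \<and> horizontal (P b) = horizontal (P d) \<and>
    horizontal (P a) \<noteq> horizontal (P b)"
  by (rule C4_alternates) (use assms in \<open>auto simp: repD\<close>)

lemma rep_triangle:
  assumes "rep A V P" "a \<in> V" "b \<in> V" "c \<in> V" "distinct [a, b, c]" "A a b" "A b c" "A a c"
  shows "horizontal (P a) = horizontal (P b) \<Longrightarrow> horizontal (P c) \<noteq> horizontal (P b)"
    and "\<exists>e. e \<in> path_points (P a) \<and> e \<in> path_points (P b) \<and> e \<in> path_points (P c)"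
  by (rule parallel_triangle[of "P a"] triangle_common_point; use assms in \<open>auto simp: repD\<close>)+

lemma rep_common_point:
  assumes "rep A V P" "a \<in> V" "b \<in> V" "a \<noteq> b" "e \<in> path_points (P a)" "e \<in> path_points (P b)"
  shows "A a b"
  using assms by (metis IntI empty_iff rep_nondeg rep_touch touch_iff)

lemma rep_points_neq:
  assumes "rep A V P" "e \<in> path_points (P a)" "e' \<in> path_points (P b)"
    and "\<not> A a b" "a \<in> V" "b \<in> V" "a \<noteq> b"
  shows "e \<noteq> e'"
  using rep_common_point[OF assms(1)] assms(2-) by blast

lemma rep_common_point_unique:
  assumes "rep A V P" "a \<in> V" "b \<in> V" "a \<noteq> b"
    and "e \<in> path_points (P a)" "e \<in> path_points (P b)" "e' \<in> path_points (P a)" "e' \<in> path_points (P b)"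
  shows "e = e'"
  by (rule common_point_unique[of "P a" "P b"]) (use assms in \<open>auto simp: repD\<close>)

lemma rep_edge:
  assumes "rep A V P" "a \<in> V" "b \<in> V" "a \<noteq> b" "A a b"
  shows "\<exists>e. e \<in> path_points (P a) \<and> e \<in> path_points (P b) \<and> (e \<in> path_ends (P a) \<or> e \<in> path_ends (P b))"
proof -
  have "nondeg (P a)" "nondeg (P b)" "noncross (P a) (P b)" "touch (P a) (P b)"
    using assms by (auto simp: repD)
  then obtain e where e: "e \<in> path_points (P a)" "e \<in> path_points (P b)"
    using touch_iff by blast
  then have "e \<in> path_ends (P a) \<or> e \<in> path_ends (P b)"
    using \<open>noncross (P a) (P b)\<close> \<open>nondeg (P a)\<close> \<open>nondeg (P b)\<close> noncross_iff
    unfolding path_interior_def by blast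
  then show ?thesis using e by blast
qed

lemma rep_K4:
  assumes "rep A V P" "a \<in> V" "b \<in> V" "c \<in> V" "d \<in> V" "distinct [a, b, c, d]"
    and "A a b" "A a c" "A a d" "A b c" "A b d" "A c d"
  shows "\<exists>e \<in> path_ends (P a). e \<in> path_points (P b) \<and> e \<in> path_points (P c) \<and> e \<in> path_points (P d)"
  by (rule K4_common_end) (use assms in \<open>auto simp: repD\<close>)

lemma path_ends_pigeonhole:
  "e1 \<in> path_ends p \<Longrightarrow> e2 \<in> path_ends p \<Longrightarrow> e3 \<in> path_ends p \<Longrightarrow> e1 = e2 \<or> e1 = e3 \<or> e2 = e3"
  by (cases p) auto

section \<open>Adjacency in the named graphs\<close>

lemmas adj_table = adj_def all_edges_def star_edges_def doubleton_eq_iff card_insert_if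

lemma edges_cycle_graph: "edges (cycle_graph n) = (\<lambda>i. {i, (i + 1) mod n}) ` {..<n}"
  by (auto simp: cycle_graph_def)

lemma C5_edges: "edges (cycle_graph 5) = {{0, 1}, {1, 2}, {2, 3}, {3, 4}, {4, 0}}"
proof -
  have "{..<5::nat} = {0, 1, 2, 3, 4}" by auto
  then show ?thesis by (simp add: edges_cycle_graph del: One_nat_def)
qed

lemma C6_edges: "edges (cycle_graph 6) = {{0, 1}, {1, 2}, {2, 3}, {3, 4}, {4, 5}, {5, 0}}"
proof -
  have "{..<6::nat} = {0, 1, 2, 3, 4, 5}" by auto
  then show ?thesis by (simp add: edges_cycle_graph del: One_nat_def)
qed

lemma verts_cycle_graph: "verts (cycle_graph n) = {..<n}"
  by (simp add: cycle_graph_def)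

lemma adj_path_graph: "adj (path_graph n) i j \<longleftrightarrow> j = i + 1 \<and> j < n \<or> i = j + 1 \<and> i < n"
  by (auto simp: path_graph_def adj_table)

lemma adj_complete_graph: "adj (complete_graph n) i j \<longleftrightarrow> i \<noteq> j \<and> i < n \<and> j < n"
  by (auto simp: complete_graph_def adj_table)

lemma adj_K4_minus: "adj K4_minus i j \<longleftrightarrow> i \<noteq> j \<and> i < 4 \<and> j < 4 \<and> {i, j} \<noteq> {0, 1}"
  by (auto simp: K4_minus_def delete_edge_def complete_graph_def adj_table)

lemma adj_complete_bipartite:
  "adj (complete_bipartite_graph m n) i j \<longleftrightarrow> i < m \<and> m \<le> j \<and> j < m + n \<or> j < m \<and> m \<le> i \<and> i < m + n"
  by (auto simp: complete_bipartite_graph_def adj_table)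

lemma adj_K33_star:
  "adj K33_star i j \<longleftrightarrow> (i < 3 \<and> 3 \<le> j \<and> j < 6 \<or> j < 3 \<and> 3 \<le> i \<and> i < 6) \<and> {i, j} \<noteq> {0, 3}
     \<or> i = 6 \<and> j = 0 \<or> i = 6 \<and> j = 3 \<or> i = 0 \<and> j = 6 \<or> i = 3 \<and> j = 6"
  by (auto simp: K33_star_def subdivide_edge_def complete_bipartite_graph_def adj_table)

lemma star_edges_simps: "star_edges u (insert x S) = insert {u, x} (star_edges u S)" "star_edges u {} = {}"
  by (auto simp: star_edges_def)

lemma mem_all_edges: "{i, j} \<in> all_edges S \<longleftrightarrow> i \<noteq> j \<and> {i, j} \<subseteq> S"
  by (auto simp: all_edges_def card_insert_if)

lemma adj_co_C6: "adj (graph_complement (cycle_graph 6)) i j \<longleftrightarrow>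
    i \<noteq> j \<and> i < 6 \<and> j < 6 \<and> {i, j} \<notin> {{0, 1}, {1, 2}, {2, 3}, {3, 4}, {4, 5}, {5, 0}}"
  unfolding graph_complement_def adj_def fst_conv snd_conv C6_edges verts_cycle_graph Diff_iff mem_all_edges
  by (simp only: insert_subset empty_subsetI lessThan_iff insert_iff empty_iff) argo

lemma adj_G1: "adj G1 i j \<longleftrightarrow> {i, j} \<in> {{0, 1}, {1, 2}, {2, 3}, {3, 4}, {4, 0}, {5, 0}, {5, 2}, {5, 3}} \<or>
    i \<noteq> j \<and> ({i, j} \<subseteq> {5, 6, 7, 8} \<or> {i, j} \<subseteq> {5, 9, 10, 11})"
  unfolding G1_def adj_def fst_conv snd_conv C5_edges
  by (simp only: star_edges_simps mem_all_edges Un_iff insert_iff empty_iff) argo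

lemma adj_G2: "adj G2 i j \<longleftrightarrow> {i, j} \<in> {{0, 1}, {1, 2}, {2, 3}, {3, 4}, {4, 0}, {5, 0}, {5, 2}, {6, 0}, {6, 3}, {5, 6}}"
  unfolding G2_def adj_def fst_conv snd_conv C5_edges
  by (simp only: star_edges_simps mem_all_edges Un_iff insert_iff empty_iff) argo

lemma adj_G3: "adj G3 i j \<longleftrightarrow>
    {i, j} \<in> {{0, 1}, {1, 2}, {2, 3}, {3, 4}, {4, 0}, {5, 0}, {5, 2}, {5, 3}, {6, 1}, {6, 2}, {6, 4}}"
  unfolding G3_def adj_def fst_conv snd_conv C5_edges
  by (simp only: star_edges_simps mem_all_edges Un_iff insert_iff empty_iff) argo

lemma adj_G4: "adj G4 i j \<longleftrightarrow>
    {i, j} \<in> {{0, 1}, {1, 2}, {2, 3}, {3, 4}, {4, 0}, {5, 0}, {5, 2}, {5, 3}, {6, 1}, {6, 4}, {6, 5}} \<or>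
    i \<noteq> j \<and> {i, j} \<subseteq> {5, 7, 8, 9}"
  unfolding G4_def adj_def fst_conv snd_conv C5_edges
  by (simp only: star_edges_simps mem_all_edges Un_iff insert_iff empty_iff) argo

lemma adj_H0: "adj H0 i j \<longleftrightarrow>
    i \<noteq> j \<and> ({i, j} \<subseteq> {0, 1, 2, 3} \<or> {i, j} \<subseteq> {0, 4, 5, 6} \<or> {i, j} \<subseteq> {0, 7, 8, 9})"
  unfolding H0_def adj_def fst_conv snd_conv
  by (simp only: star_edges_simps mem_all_edges Un_iff insert_iff empty_iff) argo

lemma adj_G_P2: "adj G_P2 i j \<longleftrightarrow>
    i \<noteq> j \<and> ({i, j} \<subseteq> {0, 1} \<or> {i, j} \<subseteq> {0, 2, 3, 4} \<or> {i, j} \<subseteq> {0, 5, 6, 7} \<or> {i, j} \<subseteq> {1, 8, 9, 10}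
      \<or> {i, j} \<subseteq> {1, 11, 12, 13})"
  unfolding G_P2_def adj_def fst_conv snd_conv
  by (auto simp: mem_all_edges doubleton_eq_iff)

lemmas adj_forbidden = adj_path_graph adj_complete_graph adj_K4_minus adj_complete_bipartite adj_K33_star adj_co_C6
  adj_G1 adj_G2 adj_G3 adj_G4 adj_H0 adj_G_P2 doubleton_eq_iff

section \<open>Obstructions from directions and from the number of ends\<close>

lemma K5_no_rep: "\<not> rep (adj (complete_graph 5)) (verts (complete_graph 5)) P"
proof
  assume r: "rep (adj (complete_graph 5)) (verts (complete_graph 5)) P"
  note a = adj_complete_graph
  have v: "i \<in> verts (complete_graph 5) \<longleftrightarrow> i < 5" for i
    by (auto simp: complete_graph_def)
  note t = rep_triangle(1)[OF r, unfolded a v]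
  \<comment> \<open>Three of the five paths have the same direction, which no triangle
    allows.\<close>
  show False
    using t[of 0 1 2] t[of 0 1 3] t[of 0 1 4] t[of 0 2 3] t[of 0 2 4] t[of 0 3 4]
      t[of 1 2 3] t[of 1 2 4] t[of 1 3 4] t[of 2 3 4]
    by (cases "horizontal (P 0)"; cases "horizontal (P 1)"; cases "horizontal (P 2)"; cases "horizontal (P 3)") simp_all
qed

text \<open>The two triangles share the edge 2, 3, and these two paths have only one common point;
  all four paths meet there, so 0 and 1 touch.\<close>

lemma K4_minus_no_rep: "\<not> rep (adj K4_minus) (verts K4_minus) P"
proof
  assume r: "rep (adj K4_minus) (verts K4_minus) P"
  note a = adj_K4_minus
  have v: "i \<in> verts K4_minus \<longleftrightarrow> i < 4" for i
    by (auto simp: K4_minus_def delete_edge_def complete_graph_def)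
  obtain e e' where e: "e \<in> path_points (P 2)" "e \<in> path_points (P 3)" "e \<in> path_points (P 0)"
    "e' \<in> path_points (P 2)" "e' \<in> path_points (P 3)" "e' \<in> path_points (P 1)"
    using rep_triangle(2)[OF r, of 2 3 0, unfolded a v] rep_triangle(2)[OF r, of 2 3 1, unfolded a v]
    by (auto simp: doubleton_eq_iff)
  then have "e = e'" using rep_common_point_unique[OF r, of 2 3 e e'] v by auto
  then show False using rep_common_point[OF r, of 0 1 e] e a v by auto
qed

lemma H0_no_rep: "\<not> rep (adj H0) (verts H0) P"
proof
  assume r: "rep (adj H0) (verts H0) P"
  have v: "i \<in> verts H0 \<longleftrightarrow> i < 10" for i
    by (auto simp: H0_def)
  note a = adj_H0 v doubleton_eq_iff
  obtain e1 where e1: "e1 \<in> path_ends (P 0)" "e1 \<in> path_points (P 1)"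
    using rep_K4[OF r, of 0 1 2 3, unfolded v] by (auto simp: a)
  obtain e2 where e2: "e2 \<in> path_ends (P 0)" "e2 \<in> path_points (P 4)"
    using rep_K4[OF r, of 0 4 5 6, unfolded v] by (auto simp: a)
  obtain e3 where e3: "e3 \<in> path_ends (P 0)" "e3 \<in> path_points (P 7)"
    using rep_K4[OF r, of 0 7 8 9, unfolded v] by (auto simp: a)
  have "e1 \<noteq> e2"
    by (rule rep_points_neq[OF r e1(2) e2(2)]) (auto simp: a)
  moreover have "e1 \<noteq> e3"
    by (rule rep_points_neq[OF r e1(2) e3(2)]) (auto simp: a)
  moreover have "e2 \<noteq> e3"
    by (rule rep_points_neq[OF r e2(2) e3(2)]) (auto simp: a)
  ultimately show False using path_ends_pigeonhole e1 e2 e3 by blast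
qed

text \<open>The contact point of \<open>P 0\<close> and \<open>P 1\<close> is an end of one of them,
  yet both ends of each are already used by the K4s at it.\<close>

lemma G_P2_no_rep: "\<not> rep (adj G_P2) (verts G_P2) P"
proof
  assume r: "rep (adj G_P2) (verts G_P2) P"
  have v: "i \<in> verts G_P2 \<longleftrightarrow> i < 14" for i
    by (auto simp: G_P2_def)
  note a = adj_G_P2 v doubleton_eq_iff
  obtain e1 where e1: "e1 \<in> path_ends (P 0)" "e1 \<in> path_points (P 2)"
    using rep_K4[OF r, of 0 2 3 4, unfolded v] by (auto simp: a)
  obtain e2 where e2: "e2 \<in> path_ends (P 0)" "e2 \<in> path_points (P 5)"
    using rep_K4[OF r, of 0 5 6 7, unfolded v] by (auto simp: a)
  obtain e3 where e3: "e3 \<in> path_ends (P 1)" "e3 \<in> path_points (P 8)"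
    using rep_K4[OF r, of 1 8 9 10, unfolded v] by (auto simp: a)
  obtain e4 where e4: "e4 \<in> path_ends (P 1)" "e4 \<in> path_points (P 11)"
    using rep_K4[OF r, of 1 11 12 13, unfolded v] by (auto simp: a)
  obtain e where e: "e \<in> path_points (P 0)" "e \<in> path_points (P 1)" "e \<in> path_ends (P 0) \<or> e \<in> path_ends (P 1)"
    using rep_edge[OF r, of 0 1, unfolded v] by (auto simp: a)
  have "e1 \<noteq> e2"
    by (rule rep_points_neq[OF r e1(2) e2(2)]) (auto simp: a)
  moreover have "e3 \<noteq> e4"
    by (rule rep_points_neq[OF r e3(2) e4(2)]) (auto simp: a)
  moreover have "e \<noteq> e1"
    by (rule rep_points_neq[OF r e(2) e1(2)]) (auto simp: a)
  moreover have "e \<noteq> e2"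
    by (rule rep_points_neq[OF r e(2) e2(2)]) (auto simp: a)
  moreover have "e \<noteq> e3"
    by (rule rep_points_neq[OF r e(1) e3(2)]) (auto simp: a)
  moreover have "e \<noteq> e4"
    by (rule rep_points_neq[OF r e(1) e4(2)]) (auto simp: a)
  ultimately show False using path_ends_pigeonhole e e1 e2 e3 e4 by blast
qed

text \<open>Each side of the triangle 0, 2, 4 lies on an induced four-cycle, so three directions
  would have to be pairwise different.\<close>

lemma co_C6_no_rep:
  "\<not> rep (adj (graph_complement (cycle_graph 6))) (verts (graph_complement (cycle_graph 6))) P"
proof
  let ?G = "graph_complement (cycle_graph 6)"
  assume r: "rep (adj ?G) (verts ?G) P"
  have v: "i \<in> verts ?G \<longleftrightarrow> i < 6" for i
    by (auto simp: graph_complement_def cycle_graph_def)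
  note a = adj_co_C6 v doubleton_eq_iff
  have "horizontal (P 0) \<noteq> horizontal (P 2)" using rep_C4[OF r, of 0 2 5 3, unfolded v] by (auto simp: a)
  moreover have "horizontal (P 0) \<noteq> horizontal (P 4)" using rep_C4[OF r, of 0 4 1 3, unfolded v] by (auto simp: a)
  moreover have "horizontal (P 2) \<noteq> horizontal (P 4)" using rep_C4[OF r, of 2 4 1 5, unfolded v] by (auto simp: a)
  ultimately show False by argo
qed

text \<open>Vertices 0 and 6 are consecutive on one induced four-cycle, while two others make both
  of them parallel to 2.\<close>

lemma G2_no_rep: "\<not> rep (adj G2) (verts G2) P"
proof
  assume r: "rep (adj G2) (verts G2) P"
  have v: "i \<in> verts G2 \<longleftrightarrow> i < 7" for i by (auto simp: G2_def)
  note a = adj_G2 v doubleton_eq_iff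
  have "horizontal (P 0) = horizontal (P 2)" using rep_C4[OF r, of 0 1 2 5, unfolded v] by (auto simp: a)
  moreover have "horizontal (P 0) \<noteq> horizontal (P 6)" using rep_C4[OF r, of 0 6 3 4, unfolded v] by (auto simp: a)
  moreover have "horizontal (P 6) = horizontal (P 2)" using rep_C4[OF r, of 6 5 2 3, unfolded v] by (auto simp: a)
  ultimately show False by argo
qed

text \<open>Opposite corners of induced four-cycles make 5, 4, 2 and 0 parallel, but 5 and 0 are
  consecutive on one of these cycles.\<close>

lemma G3_no_rep: "\<not> rep (adj G3) (verts G3) P"
proof
  assume r: "rep (adj G3) (verts G3) P"
  have v: "i \<in> verts G3 \<longleftrightarrow> i < 7" for i by (auto simp: G3_def)
  note a = adj_G3 v doubleton_eq_iff
  have "horizontal (P 0) = horizontal (P 2) \<and> horizontal (P 1) = horizontal (P 5) \<and> horizontal (P 0) \<noteq> horizontal (P 1)"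
    using rep_C4[OF r, of 0 1 2 5, unfolded v] by (auto simp: a)
  moreover have "horizontal (P 5) = horizontal (P 4)" using rep_C4[OF r, of 0 5 3 4, unfolded v] by (auto simp: a)
  moreover have "horizontal (P 4) = horizontal (P 2)" using rep_C4[OF r, of 6 4 3 2, unfolded v] by (auto simp: a)
  ultimately show False by argo
qed

section \<open>Relative position of rows and columns, and the obstructions based on it\<close>

fun line_pos :: "grid_path \<Rightarrow> int" where
  "line_pos (Horizontal y i j) = y"
| "line_pos (Vertical x i j) = x"

lemma parallel_line_pos_neq:
  assumes "horizontal p = horizontal p'" "horizontal q \<noteq> horizontal p" "touch p q" "touch p' q" "\<not> touch p p'"
    and "nondeg p" "nondeg p'"
  shows "line_pos p \<noteq> line_pos p'"
  using assms by (cases p; cases p'; cases q) auto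

text \<open>\<open>p\<close> reaches from \<open>q1\<close> to \<open>q2\<close> across the line of
  \<open>q\<close>, and \<open>q\<close> from \<open>p1\<close> to \<open>p2\<close> across the line
  of \<open>p\<close>; so the point where the two lines meet is interior to both paths.\<close>

lemma middle_lines_cross:
  assumes "horizontal p \<noteq> horizontal q" "horizontal p1 = horizontal p" "horizontal p2 = horizontal p"
    "horizontal q1 = horizontal q" "horizontal q2 = horizontal q"
    and "line_pos p1 < line_pos p" "line_pos p < line_pos p2" "line_pos q1 < line_pos q" "line_pos q < line_pos q2"
    and "touch p q1" "touch p q2" "touch q p1" "touch q p2"
  shows "\<not> noncross p q"
  using assms by (cases p; cases q; simp; cases p1; simp; cases p2; simp; cases q1; simp; cases q2; simp)

text \<open>Together with \<open>line_pos\<close> and \<open>path_hi\<close> this describes a path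
  by its line and its extent along it, so that arguments about sides can be stated for both
  directions at once.\<close>

fun path_lo :: "grid_path \<Rightarrow> int" where
  "path_lo (Horizontal y i j) = i"
| "path_lo (Vertical x i j) = i"

fun path_hi :: "grid_path \<Rightarrow> int" where
  "path_hi (Horizontal y i j) = j"
| "path_hi (Vertical x i j) = j"

lemma reaches_both_sides:
  assumes "horizontal p \<noteq> horizontal q" "horizontal q1 = horizontal q" "horizontal q2 = horizontal q"
    and "touch p q1" "touch p q2" "line_pos q1 < line_pos q" "line_pos q < line_pos q2"
  shows "path_lo p < line_pos q" "line_pos q < path_hi p"
  using assms by (cases p; cases q; simp; cases q1; simp; cases q2; simp)+

text \<open>The contact point is interior to \<open>p\<close>, so it has to be an end of
  \<open>q\<close>.\<close>

lemma stops_at_end: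
  assumes "horizontal p \<noteq> horizontal q" "path_lo p < line_pos q" "line_pos q < path_hi p"
    and "noncross p q" "touch p q"
  shows "line_pos p = path_lo q \<or> line_pos p = path_hi q"
  using assms by (cases p; cases q; auto)

text \<open>The lines of \<open>p1\<close> and \<open>p2\<close> pass through the two ends of \<open>p3\<close>, so a path touching \<open>p3\<close>
  but neither of them cannot leave the strip between them on the side of \<open>p1\<close>.\<close>

lemma bounded_cell:
  assumes "horizontal p0 = horizontal p1" "horizontal p2 = horizontal p1" "horizontal p3 \<noteq> horizontal p1"
      "horizontal p4 = horizontal p3" "horizontal p5 = horizontal p3"
    and "nondeg p3" "nondeg p6" "noncross p1 p3" "noncross p2 p3" "noncross p3 p6"
    and "touch p1 p3" "touch p1 p4" "touch p1 p5" "touch p2 p3" "touch p2 p4" "touch p2 p5"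
    and "touch p6 p0" "touch p6 p3" "\<not> touch p6 p1" "\<not> touch p6 p2"
    and "line_pos p4 < line_pos p3 \<and> line_pos p3 < line_pos p5"
    and "line_pos p0 < line_pos p1 \<and> line_pos p1 < line_pos p2 \<or> line_pos p2 < line_pos p1 \<and> line_pos p1 < line_pos p0"
  shows False
proof -
  have b: "path_lo p1 < line_pos p3" "line_pos p3 < path_hi p1" "path_lo p2 < line_pos p3" "line_pos p3 < path_hi p2"
    using reaches_both_sides[of p1 p3 p4 p5] reaches_both_sides[of p2 p3 p4 p5] assms by simp_all
  have "line_pos p1 = path_lo p3 \<or> line_pos p1 = path_hi p3"
    "line_pos p2 = path_lo p3 \<or> line_pos p2 = path_hi p3"
    using stops_at_end[of p1 p3] stops_at_end[of p2 p3] b assms by simp_all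
  then have e: "line_pos p1 = path_lo p3 \<and> line_pos p2 = path_hi p3 \<or> line_pos p1 = path_hi p3 \<and> line_pos p2 = path_lo p3"
    using assms(22) by linarith
  show False
  proof (cases "horizontal p6 = horizontal p3")
    case True
    then have "path_lo p3 = path_hi p6 \<or> path_hi p3 = path_lo p6" "line_pos p6 = line_pos p3"
      using assms(6,7,10,18) by (cases p3; cases p6; auto)+
    then have "touch p6 p1 \<or> touch p6 p2"
      using True b e assms(2,3,6,7) by (cases p1; cases p3; simp; cases p2; simp; cases p6; simp; auto)
    then show False using assms by blast
  next
    case False
    then have "path_lo p3 \<le> line_pos p6" "line_pos p6 \<le> path_hi p3"
      using assms(18) by (cases p3; cases p6; auto)+
    moreover have "line_pos p6 = line_pos p0"
      using False assms(1,3,17) by (cases p0; cases p1; simp; cases p3; simp; cases p6; simp)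
    moreover have "line_pos p6 \<noteq> line_pos p1" if "line_pos p6 = path_lo p3 \<or> line_pos p6 = path_hi p3"
      using False b assms(3,18,19) by (cases p1; cases p3; simp; cases p6; auto)
    ultimately show False using e assms(22) by linarith
  qed
qed

text \<open>\<open>b\<close> and \<open>c\<close> are collinear and abut; as \<open>u\<close> meets
  both, it does so at the shared end. Then \<open>v\<close> is on the side of \<open>b\<close> and
  \<open>w\<close> on the side of \<open>c\<close>.\<close>

lemma opposite_sides:
  assumes "horizontal b = horizontal c" "horizontal u \<noteq> horizontal b" "horizontal v = horizontal u" "horizontal w = horizontal u"
    and "nondeg b" "nondeg c" "nondeg u" "nondeg v" "nondeg w" "noncross b c"
    and "touch b c" "touch b u" "touch c u" "touch b v" "touch c w" "\<not> touch u v" "\<not> touch u w"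
  shows "line_pos v < line_pos u \<and> line_pos u < line_pos w \<or> line_pos w < line_pos u \<and> line_pos u < line_pos v"
proof -
  have v: "line_pos v \<noteq> line_pos u" and w: "line_pos w \<noteq> line_pos u"
    using parallel_line_pos_neq[of u v b] parallel_line_pos_neq[of u w c] assms by (auto simp: touch_sym)
  have perp: "path_lo p \<le> line_pos q \<and> line_pos q \<le> path_hi p" if "touch p q" "horizontal p \<noteq> horizontal q" for p q
    using that by (cases p; cases q) auto
  have b: "path_lo b \<le> line_pos u" "line_pos u \<le> path_hi b" "path_lo b \<le> line_pos v" "line_pos v \<le> path_hi b"
    and c: "path_lo c \<le> line_pos u" "line_pos u \<le> path_hi c" "path_lo c \<le> line_pos w" "line_pos w \<le> path_hi c"
    using perp[of b u] perp[of b v] perp[of c u] perp[of c w] assms by auto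
  have "path_hi b \<le> path_lo c \<or> path_hi c \<le> path_lo b"
    using assms(1,10,11) by (cases b; cases c) auto
  then show ?thesis using b c v w by linarith
qed

text \<open>As \<open>v\<close> and \<open>w\<close> lie on opposite sides of \<open>u\<close> and
  \<open>a\<close> reaches both, \<open>a\<close> passes strictly across the line of
  \<open>u\<close>. So it can touch \<open>u\<close> only at an end of \<open>u\<close>.\<close>

lemma end_on_transversal:
  assumes "horizontal a = horizontal b" "horizontal b = horizontal c" "horizontal u \<noteq> horizontal b"
      "horizontal v = horizontal u" "horizontal w = horizontal u"
    and "nondeg b" "nondeg c" "nondeg u" "nondeg v" "nondeg w" "noncross b c" "noncross a u"
    and "touch a u" "touch a v" "touch a w"
    and "touch b c" "touch b u" "touch c u" "touch b v" "touch c w" "\<not> touch u v" "\<not> touch u w"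
  shows "\<exists>e \<in> path_ends u. e \<in> path_points a"
proof -
  have "line_pos v < line_pos u \<and> line_pos u < line_pos w \<or> line_pos w < line_pos u \<and> line_pos u < line_pos v"
    by (rule opposite_sides[of b c]) (use assms in auto)
  then have "path_lo a < line_pos u \<and> line_pos u < path_hi a"
    using reaches_both_sides[of a u v w] reaches_both_sides[of a u w v] assms(1-5,14,15) by argo
  then have "line_pos a = path_lo u \<or> line_pos a = path_hi u"
    using stops_at_end[of a u] assms(1,2,3,12,13) by argo
  then show ?thesis
    using assms(1,2,3,13) by (cases a; cases u; auto)
qed

lemma linorder_middle:
  fixes x y z :: int
  assumes "x \<noteq> y" "y \<noteq> z" "x \<noteq> z"
  obtains "x < y \<and> y < z \<or> z < y \<and> y < x" | "y < x \<and> x < z \<or> z < x \<and> x < y" | "x < z \<and> z < y \<or> y < z \<and> z < x"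
  using assms by linarith

text \<open>The two K4s at 5 take both ends of \<open>P 5\<close>, which no path of the cycle can
  then contain; but \<open>P 0\<close> is a transversal that has to pass through one of
  them.\<close>

lemma G1_no_rep: "\<not> rep (adj G1) (verts G1) P"
proof
  assume r: "rep (adj G1) (verts G1) P"
  have v: "i \<in> verts G1 \<longleftrightarrow> i < 12" for i by (auto simp: G1_def)
  note a = adj_G1 v doubleton_eq_iff
  obtain e where e: "e \<in> path_ends (P 5)" "e \<in> path_points (P 6)"
    using rep_K4[OF r, of 5 6 7 8, unfolded v] by (auto simp: a)
  obtain e' where e': "e' \<in> path_ends (P 5)" "e' \<in> path_points (P 9)"
    using rep_K4[OF r, of 5 9 10 11, unfolded v] by (auto simp: a)
  have "e \<noteq> e'"
    by (rule rep_points_neq[OF r e(2) e'(2)]) (auto simp: a)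
  then have ends: "path_ends (P 5) = {e, e'}"
    using path_ends_pigeonhole e(1) e'(1) by blast
  have out: "e \<notin> path_points (P i) \<and> e' \<notin> path_points (P i)" if "i < 5" for i
    using rep_common_point[OF r _ _ _ e(2), of i] rep_common_point[OF r _ _ _ e'(2), of i] that
    by (auto simp: a)
  have out: "path_ends (P 5) \<inter> path_points (P i) = {}" if "i < 5" for i
    using out[OF that] ends by simp
  note C4 = rep_C4[OF r, unfolded v]
  have o: "horizontal (P 0) = horizontal (P 2) \<and> horizontal (P 1) = horizontal (P 5) \<and> horizontal (P 0) \<noteq> horizontal (P 1)"
    using C4[of 0 1 2 5] by (auto simp: a)
  have o': "horizontal (P 0) = horizontal (P 3) \<and> horizontal (P 5) = horizontal (P 4)"
    using C4[of 0 5 3 4] by (auto simp: a)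
  note T = rep_touch[OF r, unfolded v]
  have t: "touch (P 0) (P 5)" "touch (P 2) (P 5)" "touch (P 3) (P 5)" "touch (P 2) (P 3)" "touch (P 0) (P 1)"
      "touch (P 2) (P 1)" "touch (P 0) (P 4)" "touch (P 3) (P 4)"
      "\<not> touch (P 5) (P 1)" "\<not> touch (P 5) (P 4)"
    using T[of 0 5] T[of 2 5] T[of 3 5] T[of 2 3] T[of 0 1] T[of 2 1] T[of 0 4] T[of 3 4] T[of 5 1] T[of 5 4]
    by (auto simp: a)
  have n: "nondeg (P i)" "i \<noteq> 5 \<Longrightarrow> noncross (P i) (P 5)" if "i < 6" for i
    using rep_nondeg[OF r] rep_noncross[OF r] v that by auto
  have n': "noncross (P 2) (P 3)"
    using rep_noncross[OF r] v by auto
  have "\<exists>e \<in> path_ends (P 5). e \<in> path_points (P 0)"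
    by (rule end_on_transversal[of _ "P 2" "P 3" _ "P 1" "P 4"]) (use t o o' n n' in auto)
  then show False using out[of 0] by auto
qed

text \<open>Three distinct ends of \<open>P 5\<close> would be needed: one for the K4 and one for
  each of the nonadjacent transversals \<open>P 0\<close> and \<open>P 6\<close>.\<close>

lemma G4_no_rep: "\<not> rep (adj G4) (verts G4) P"
proof
  assume r: "rep (adj G4) (verts G4) P"
  have v: "i \<in> verts G4 \<longleftrightarrow> i < 10" for i by (auto simp: G4_def)
  note a = adj_G4 v doubleton_eq_iff
  obtain e where e: "e \<in> path_ends (P 5)" "e \<in> path_points (P 7)"
    using rep_K4[OF r, of 5 7 8 9, unfolded v] by (auto simp: a)
  have out: "e \<notin> path_points (P i)" if "i \<in> {0, 6}" for i
    using rep_common_point[OF r _ _ _ e(2), of i] that by (auto simp: a)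
  note C4 = rep_C4[OF r, unfolded v]
  have o: "horizontal (P 0) = horizontal (P 2) \<and> horizontal (P 1) = horizontal (P 5) \<and> horizontal (P 0) \<noteq> horizontal (P 1)"
    using C4[of 0 1 2 5] by (auto simp: a)
  have o': "horizontal (P 0) = horizontal (P 3) \<and> horizontal (P 5) = horizontal (P 4)"
    using C4[of 0 5 3 4] by (auto simp: a)
  have o'': "horizontal (P 0) = horizontal (P 6)"
    using C4[of 1 0 5 6] by (auto simp: a)
  note T = rep_touch[OF r, unfolded v]
  have t: "touch (P 0) (P 5)" "touch (P 0) (P 1)" "touch (P 0) (P 4)"
    "touch (P 6) (P 5)" "touch (P 6) (P 1)" "touch (P 6) (P 4)"
    "touch (P 2) (P 5)" "touch (P 3) (P 5)" "touch (P 2) (P 3)" "touch (P 2) (P 1)" "touch (P 3) (P 4)"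
    "\<not> touch (P 5) (P 1)" "\<not> touch (P 5) (P 4)" "\<not> touch (P 0) (P 6)"
    using T[of 0 5] T[of 0 1] T[of 0 4] T[of 6 5] T[of 6 1] T[of 6 4]
      T[of 2 5] T[of 3 5] T[of 2 3] T[of 2 1] T[of 3 4] T[of 5 1] T[of 5 4] T[of 0 6]
    by (auto simp: a)
  have n: "nondeg (P i)" "i \<noteq> 5 \<Longrightarrow> noncross (P i) (P 5)" if "i < 7" for i
    using rep_nondeg[OF r] rep_noncross[OF r] v that by auto
  have n': "noncross (P 2) (P 3)"
    using rep_noncross[OF r] v by auto
  have ends: "\<exists>e \<in> path_ends (P 5). e \<in> path_points (P i)" if "i \<in> {0, 6}" for i
    by (rule end_on_transversal[of _ "P 2" "P 3" _ "P 1" "P 4"])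
      (use t o o' o'' n n' that in auto)
  obtain e0 where e0: "e0 \<in> path_ends (P 5)" "e0 \<in> path_points (P 0)" using ends[of 0] by auto
  obtain e6 where e6: "e6 \<in> path_ends (P 5)" "e6 \<in> path_points (P 6)" using ends[of 6] by auto
  have "e0 \<noteq> e6" by (rule rep_points_neq[OF r e0(2) e6(2)]) (auto simp: a)
  moreover have "e \<noteq> e0" "e \<noteq> e6" using out[of 0] out[of 6] e0 e6 by auto
  ultimately show False using path_ends_pigeonhole e(1) e0(1) e6(1) by blast
qed

lemma K33_no_rep:
  "\<not> rep (adj (complete_bipartite_graph 3 3)) (verts (complete_bipartite_graph 3 3)) P"
proof
  let ?G = "complete_bipartite_graph 3 3"
  assume r: "rep (adj ?G) (verts ?G) P"
  have v: "i \<in> verts ?G \<longleftrightarrow> i < 6" for i by (auto simp: complete_bipartite_graph_def)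
  note a = adj_complete_bipartite
  have o: "horizontal (P i) = horizontal (P i') \<and> horizontal (P j) = horizontal (P j') \<and> horizontal (P i) \<noteq> horizontal (P j)"
    if "i < 3" "i' < 3" "3 \<le> j" "j < 6" "3 \<le> j'" "j' < 6" "i \<noteq> i'" "j \<noteq> j'" for i i' j j'
    using rep_C4[OF r, of i j i' j', unfolded v a] that by auto
  have o': "horizontal (P 1) = horizontal (P 0)" "horizontal (P 2) = horizontal (P 0)" "horizontal (P 3) \<noteq> horizontal (P 0)"
    "horizontal (P 4) = horizontal (P 3)" "horizontal (P 5) = horizontal (P 3)"
    using o[of 0 1 3 4] o[of 0 2 3 5] by auto
  note T = rep_touch[OF r, unfolded v a]
  have t: "touch (P i) (P j)" "touch (P j) (P i)" if "i < 3" "3 \<le> j" "j < 6" for i j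
    using T[of i j] T[of j i] that by auto
  have nt: "\<not> touch (P i) (P j)" if "i < 3 \<and> j < 3 \<or> 3 \<le> i \<and> i < 6 \<and> 3 \<le> j \<and> j < 6" "i \<noteq> j" for i j
    using T[of i j] that by auto
  have n: "nondeg (P i)" if "i < 6" for i using rep_nondeg[OF r] v that by auto
  have nc: "noncross (P i) (P j)" if "i < 3" "3 \<le> j" "j < 6" for i j
    using rep_noncross[OF r] v that by auto
  note neq = parallel_line_pos_neq
  have d: "line_pos (P 0) \<noteq> line_pos (P 1)" "line_pos (P 1) \<noteq> line_pos (P 2)" "line_pos (P 0) \<noteq> line_pos (P 2)"
    by (rule neq[of _ _ "P 3"]; use o' t nt n in simp)+
  have d': "line_pos (P 3) \<noteq> line_pos (P 4)" "line_pos (P 4) \<noteq> line_pos (P 5)" "line_pos (P 3) \<noteq> line_pos (P 5)"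
    by (rule neq[of _ _ "P 0"]; use o' t nt n in simp)+
  have "\<exists>i1\<in>{0,1,2}. \<exists>i\<in>{0,1,2}. \<exists>i2\<in>{0,1,2}. line_pos (P i1) < line_pos (P i) \<and> line_pos (P i) < line_pos (P i2)"
    by (rule linorder_middle[OF d]; auto)
  then obtain i1 i i2 where i': "i1 \<in> {0,1,2}" "i \<in> {0,1,2}" "i2 \<in> {0,1,2}"
    and i'': "line_pos (P i1) < line_pos (P i)" "line_pos (P i) < line_pos (P i2)"
    by blast
  then have i: "i1 < 3" "i < 3" "i2 < 3" "line_pos (P i1) < line_pos (P i)" "line_pos (P i) < line_pos (P i2)"
    by auto
  have "\<exists>j1\<in>{3,4,5}. \<exists>j\<in>{3,4,5}. \<exists>j2\<in>{3,4,5}. line_pos (P j1) < line_pos (P j) \<and> line_pos (P j) < line_pos (P j2)"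
    by (rule linorder_middle[OF d']; auto)
  then obtain j1 j j2 where j: "j1 \<in> {3,4,5}" "j \<in> {3,4,5}" "j2 \<in> {3,4,5}"
    "line_pos (P j1) < line_pos (P j)" "line_pos (P j) < line_pos (P j2)"
    by blast
  have oi: "horizontal (P k) = horizontal (P 0)" if "k < 3" for k
    using o'(1,2) that by (auto simp: less_Suc_eq numeral_3_eq_3 numeral_2_eq_2)
  have oj: "horizontal (P k) \<noteq> horizontal (P 0)" if "k \<in> {3,4,5}" for k
    using o' that by auto
  have tj: "touch (P i) (P k)" "touch (P k) (P i)" if "k \<in> {3,4,5}" "i < 3" for i k
    using t[of i k] that by auto
  have "\<not> noncross (P i) (P j)"
    using middle_lines_cross[of "P i" "P j" "P i1" "P i2" "P j1" "P j2"] i(4,5) j(4,5)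
      oi[OF i(1)] oi[OF i(2)] oi[OF i(3)] oj[OF j(1)] oj[OF j(2)] oj[OF j(3)]
      tj(1)[OF j(1) i(2)] tj(1)[OF j(3) i(2)] tj(2)[OF j(2) i(1)] tj(2)[OF j(2) i(3)] by argo
  then show False using nc[OF i(2), of j] j(2) by auto
qed

text \<open>The middle paths of the two directions are compared. If they are \<open>P 0\<close> and
  \<open>P 3\<close>, or neither belongs to the subdivided edge, both still reach the outer lines
  and cross as for K33. If exactly one belongs to it, say \<open>P 3\<close>, this path is stopped
  at both ends by \<open>P 1\<close> and \<open>P 2\<close>, and \<open>P 6\<close> cannot get from
  it to \<open>P 0\<close> outside that strip.\<close>

lemma K33_star_no_rep: "\<not> rep (adj K33_star) (verts K33_star) P"
proof
  assume r: "rep (adj K33_star) (verts K33_star) P"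
  have v: "i \<in> verts K33_star \<longleftrightarrow> i < 7" for i
    by (auto simp: K33_star_def subdivide_edge_def complete_bipartite_graph_def)
  note a = adj_K33_star
  note C4 = rep_C4[OF r, unfolded v a doubleton_eq_iff]
  have o': "horizontal (P 1) = horizontal (P 0)" "horizontal (P 2) = horizontal (P 0)" "horizontal (P 3) \<noteq> horizontal (P 0)"
    "horizontal (P 4) = horizontal (P 3)" "horizontal (P 5) = horizontal (P 3)"
    using C4[of 1 4 2 5] C4[of 1 3 2 5] C4[of 0 4 1 5] by auto
  note T = rep_touch[OF r, unfolded v a doubleton_eq_iff]
  have t: "touch (P i) (P j)" "touch (P j) (P i)" if "i < 3" "3 \<le> j" "j < 6" "i \<noteq> 0 \<or> j \<noteq> 3" for i j
    using T[of i j] T[of j i] that by auto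
  have t6: "touch (P 6) (P 0)" "touch (P 6) (P 3)" "touch (P 0) (P 6)" "touch (P 3) (P 6)"
    using T[of 6 0] T[of 6 3] T[of 0 6] T[of 3 6] by auto
  have nt: "\<not> touch (P i) (P j)" if "i < 3 \<and> j < 3 \<or> 3 \<le> i \<and> i < 6 \<and> 3 \<le> j \<and> j < 6" "i \<noteq> j" for i j
    using T[of i j] that by auto
  have nt6: "\<not> touch (P 6) (P j)" if "j \<in> {1, 2, 4, 5}" for j
    using T[of 6 j] that by auto
  have n: "nondeg (P i)" if "i < 7" for i using rep_nondeg[OF r] v that by auto
  have nc: "noncross (P i) (P j)" if "i < 7" "j < 7" "i \<noteq> j" for i j
    using rep_noncross[OF r] v that by auto
  note neq = parallel_line_pos_neq
  have d: "line_pos (P 0) \<noteq> line_pos (P 1)" "line_pos (P 1) \<noteq> line_pos (P 2)" "line_pos (P 0) \<noteq> line_pos (P 2)"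
    by (rule neq[of _ _ "P 4"]; use o' t nt n in simp)+
  have d': "line_pos (P 3) \<noteq> line_pos (P 4)" "line_pos (P 4) \<noteq> line_pos (P 5)" "line_pos (P 3) \<noteq> line_pos (P 5)"
    by (rule neq[of _ _ "P 1"]; use o' t nt n in simp)+
  let ?m = "\<lambda>i j k. line_pos (P i) < line_pos (P j) \<and> line_pos (P j) < line_pos (P k)
    \<or> line_pos (P k) < line_pos (P j) \<and> line_pos (P j) < line_pos (P i)"
  have cross: False if ij: "{i1, i, i2} = {0, 1, 2}" "{j1, j, j2} = {3, 4, 5}" "?m i1 i i2" "?m j1 j j2"
      "i = 0 \<longleftrightarrow> j = 3" for i1 i i2 j1 j j2
  proof -
    have s: "i1 \<in> {0,1,2}" "i \<in> {0,1,2}" "i2 \<in> {0,1,2}" "j1 \<in> {3,4,5}" "j \<in> {3,4,5}" "j2 \<in> {3,4,5}"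
      using ij(1,2) by blast+
    have ne: "i \<noteq> i1" "i \<noteq> i2" "j \<noteq> j1" "j \<noteq> j2" using ij(3,4) by auto
    have oi: "horizontal (P k) = horizontal (P 0)" if "k \<in> {0,1,2}" for k
      using o'(1,2) that by auto
    have oj: "horizontal (P k) = horizontal (P 3)" if "k \<in> {3,4,5}" for k
      using o' that by auto
    have "k < 3" if "k \<in> {0,1,2}" for k :: nat using that by auto
    moreover have "3 \<le> k \<and> k < 6" if "k \<in> {3,4,5}" for k :: nat using that by auto
    ultimately have bounds: "i1 < 3" "i < 3" "i2 < 3" "3 \<le> j1" "j1 < 6" "3 \<le> j" "j < 6" "3 \<le> j2" "j2 < 6"
      using s by metis+
    have ex: "i \<noteq> 0 \<or> j1 \<noteq> 3" "i \<noteq> 0 \<or> j2 \<noteq> 3" "i1 \<noteq> 0 \<or> j \<noteq> 3" "i2 \<noteq> 0 \<or> j \<noteq> 3"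
      using ne ij(5) by metis+
    have tt: "touch (P i) (P j1)" "touch (P i) (P j2)" "touch (P j) (P i1)" "touch (P j) (P i2)"
      using t[of i j1] t[of i j2] t[of i1 j] t[of i2 j] bounds ex by simp_all
    have "\<not> noncross (P i) (P j)"
      using middle_lines_cross[of "P i" "P j" "P i1" "P i2" "P j1" "P j2"]
        middle_lines_cross[of "P i" "P j" "P i1" "P i2" "P j2" "P j1"]
        middle_lines_cross[of "P i" "P j" "P i2" "P i1" "P j1" "P j2"]
        middle_lines_cross[of "P i" "P j" "P i2" "P i1" "P j2" "P j1"]
        ij(3,4) tt oi[OF s(1)] oi[OF s(2)] oi[OF s(3)] oj[OF s(4)] oj[OF s(5)] oj[OF s(6)] o'(3) by metis
    then show False using nc[of i j] bounds by linarith
  qed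
  have cell: False if "{i, i2} = {1, 2}" "?m 0 i i2" "?m 4 3 5" for i i2
  proof -
    have s: "i = 1 \<and> i2 = 2 \<or> i = 2 \<and> i2 = 1" using that(1) by (auto simp: doubleton_eq_iff)
    show False
      using bounded_cell[of "P 0" "P i" "P i2" "P 3" "P 4" "P 5" "P 6"]
        bounded_cell[of "P 0" "P i" "P i2" "P 3" "P 5" "P 4" "P 6"] that(2,3) s o' t n nc t6 nt6
      by (elim disjE conjE) simp_all
  qed
  have cell': False if "{j, j2} = {4, 5}" "?m 3 j j2" "?m 1 0 2" for j j2
  proof -
    have s: "j = 4 \<and> j2 = 5 \<or> j = 5 \<and> j2 = 4" using that(1) by (auto simp: doubleton_eq_iff)
    show False
      using bounded_cell[of "P 3" "P j" "P j2" "P 0" "P 1" "P 2" "P 6"]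
        bounded_cell[of "P 3" "P j" "P j2" "P 0" "P 2" "P 1" "P 6"] that(2,3) s o' t n nc t6 nt6
      by (elim disjE conjE) simp_all
  qed
  consider "?m 0 1 2" | "?m 1 0 2" | "?m 0 2 1"
    using linorder_middle[OF d] by blast
  moreover consider "?m 3 4 5" | "?m 4 3 5" | "?m 3 5 4"
    using linorder_middle[OF d'] by blast
  ultimately show False
    using cell[of 1 2] cell[of 2 1] cell'[of 4 5] cell'[of 5 4]
      cross[of 1 0 2 4 3 5] cross[of 0 1 2 3 4 5] cross[of 0 1 2 3 5 4]
      cross[of 0 2 1 3 4 5] cross[of 0 2 1 3 5 4]
    by (smt (verit, ccfv_threshold) insert_commute numeral_eq_iff semiring_norm zero_neq_numeral one_eq_numeral_iff zero_neq_one)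
qed

lemma forbidden_no_rep:
  assumes "H \<in> forbidden_graphs"
  shows "\<not> rep (adj H) (verts H) P"
  using assms unfolding forbidden_graphs_def insert_iff empty_iff
  by (elim disjE FalseE)
    (simp_all only: K5_no_rep H0_no_rep G_P2_no_rep K33_no_rep K33_star_no_rep co_C6_no_rep
      G1_no_rep G2_no_rep G3_no_rep G4_no_rep K4_minus_no_rep not_False_eq_True)

lemma contact_forbidden_free:
  assumes "contact_B0_VPG G"
  shows "graph_free forbidden_graphs G"
  unfolding graph_free_def
proof (rule notI, elim exE conjE)
  fix S and H :: "nat graph"
  assume "S \<subseteq> verts G" "H \<in> forbidden_graphs" "graph_iso (induced_subgraph G S) H"
  then show False using contact_induced_rep[OF assms] forbidden_no_rep by metis
qed

section \<open>Extending representations\<close>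

text \<open>Contacts survive doubling, while the midpoints of old grid edges become grid points,
  where short new paths find room.\<close>

fun dbl :: "grid_path \<Rightarrow> grid_path" where
  "dbl (Horizontal y i j) = Horizontal (2 * y) (2 * i) (2 * j)"
| "dbl (Vertical x i j) = Vertical (2 * x) (2 * i) (2 * j)"

abbreviation dbl_point :: "int \<times> int \<Rightarrow> int \<times> int" where
  "dbl_point \<equiv> map_prod ((*) 2) ((*) 2)"

lemma dbl_simps [simp]:
  "nondeg (dbl p) \<longleftrightarrow> nondeg p"
  "noncross (dbl p) (dbl q) \<longleftrightarrow> noncross p q"
  "touch (dbl p) (dbl q) \<longleftrightarrow> touch p q"
  "dbl_point e \<in> path_points (dbl p) \<longleftrightarrow> e \<in> path_points p"
  "path_ends (dbl p) = dbl_point ` path_ends p"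
  by (cases p; cases q; cases e; auto)+

text \<open>These are the places where a pendant triangle can be drawn; each such triangle uses one
  up.\<close>

definition free_ends :: "'a set \<Rightarrow> ('a \<Rightarrow> grid_path) \<Rightarrow> 'a \<Rightarrow> (int \<times> int) set" where
  "free_ends V P v = {e \<in> path_ends (P v). \<forall>u\<in>V. u \<noteq> v \<longrightarrow> e \<notin> path_points (P u)}"

lemma finite_free_ends [simp]: "finite (free_ends V P v)"
proof -
  have "finite (path_ends (P v))" by (cases "P v") auto
  then show ?thesis unfolding free_ends_def by simp
qed

text \<open>After doubling the grid, \<open>r\<close> can be added next to \<open>p\<close>, provided that no other path
  passes through the points in \<open>E\<close>.\<close>

definition pendant_path :: "grid_path \<Rightarrow> (int \<times> int) set \<Rightarrow> grid_path \<Rightarrow> bool" where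
  "pendant_path p E r \<longleftrightarrow> nondeg r \<and> noncross r (dbl p) \<and> touch r (dbl p) \<and>
     (\<forall>q. nondeg q \<longrightarrow> noncross p q \<longrightarrow> E \<inter> path_points q = {} \<longrightarrow> noncross r (dbl q) \<and> \<not> touch r (dbl q)) \<and>
     (\<forall>e. dbl_point e \<in> path_points r \<longrightarrow> e \<in> E)"

definition pendant_clique :: "grid_path \<Rightarrow> (int \<times> int) set \<Rightarrow> grid_path list \<Rightarrow> bool" where
  "pendant_clique p E rs \<longleftrightarrow> (\<forall>r\<in>set rs. pendant_path p E r) \<and>
     (\<forall>i<length rs. \<forall>j<length rs. i \<noteq> j \<longrightarrow> noncross (rs ! i) (rs ! j) \<and> touch (rs ! i) (rs ! j))"

text \<open>No other noncrossing path passes through the midpoint of the first grid edge of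
  \<open>p\<close>. There \<open>p\<close> occupies two of the four directions, so two short paths
  fit on opposite sides and no end is spent.\<close>

lemma pendant_pair:
  assumes "nondeg p"
  shows "\<exists>r1 r2. pendant_clique p {} [r1, r2]"
proof (cases p)
  case (Horizontal y i j)
  let ?U = "Vertical (2 * i + 1) (2 * y) (2 * y + 1)" and ?D = "Vertical (2 * i + 1) (2 * y - 1) (2 * y)"
  have "pendant_path p {} r" if "r = ?U \<or> r = ?D" for r
    unfolding pendant_path_def
  proof (intro conjI allI impI)
    fix q assume "nondeg q" "noncross p q"
    then show "noncross r (dbl q)" "\<not> touch r (dbl q)"
      using that Horizontal assms by (elim disjE; cases q; simp; presburger)+
  qed (use that Horizontal assms in \<open>auto, presburger+\<close>)
  then have "pendant_clique p {} [?U, ?D]"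
    unfolding pendant_clique_def by (auto simp: less_Suc_eq nth_Cons')
  then show ?thesis by blast
next
  case (Vertical x i j)
  let ?R = "Horizontal (2 * i + 1) (2 * x) (2 * x + 1)" and ?L = "Horizontal (2 * i + 1) (2 * x - 1) (2 * x)"
  have "pendant_path p {} r" if "r = ?R \<or> r = ?L" for r
    unfolding pendant_path_def
  proof (intro conjI allI impI)
    fix q assume "nondeg q" "noncross p q"
    then show "noncross r (dbl q)" "\<not> touch r (dbl q)"
      using that Vertical assms by (elim disjE; cases q; simp; presburger)+
  qed (use that Vertical assms in \<open>auto, presburger+\<close>)
  then have "pendant_clique p {} [?R, ?L]"
    unfolding pendant_clique_def by (auto simp: less_Suc_eq nth_Cons')
  then show ?thesis by blast
qed

text \<open>The four unit steps from the doubled point. Each covers half of an old grid edge, so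
  that a doubled nondegenerate path meeting one of them contains the doubled point itself.\<close>

fun unit_paths :: "int \<times> int \<Rightarrow> grid_path set" where
  "unit_paths (x, y) = {Horizontal (2 * y) (2 * x) (2 * x + 1), Horizontal (2 * y) (2 * x - 1) (2 * x),
     Vertical (2 * x) (2 * y) (2 * y + 1), Vertical (2 * x) (2 * y - 1) (2 * y)}"

lemma unit_path_pendant:
  assumes "r \<in> unit_paths e" "e \<in> path_ends p" "nondeg p" "noncross r (dbl p)"
  shows "pendant_path p {e} r"
proof -
  obtain x y where e: "e = (x, y)" by fastforce
  show ?thesis unfolding pendant_path_def
  proof (intro conjI allI impI)
    show "nondeg r" "noncross r (dbl p)" using assms(1,4) e by auto
    show "touch r (dbl p)" using assms(1,2,3) e by (cases p) auto
  next
    fix q assume "nondeg q" "noncross p q" "{e} \<inter> path_points q = {}"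
    then have q: "nondeg q" "(x, y) \<notin> path_points q" using e by auto
    have "\<not> touch r (dbl q)"
      using assms(1) q unfolding e unit_paths.simps insert_iff empty_iff
      by (elim disjE FalseE; cases q; simp; presburger)
    moreover have "noncross r (dbl q)" if "\<not> touch r (dbl q)"
      using that assms(1) q unfolding e unit_paths.simps insert_iff empty_iff
      by (elim disjE FalseE; cases q; simp; presburger)
    ultimately show "noncross r (dbl q)" "\<not> touch r (dbl q)" by blast+
  next
    fix d assume "dbl_point d \<in> path_points r"
    then show "d \<in> {e}"
      using assms(1) unfolding e unit_paths.simps insert_iff empty_iff
      by (cases d; elim disjE FalseE; simp; presburger)
  qed
qed

text \<open>At an end, \<open>p\<close> leaves three of the four directions open; the cases
  distinguish which one it occupies.\<close>

lemma pendant_triple: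
  assumes "nondeg p" "e \<in> path_ends p"
  shows "\<exists>r1 r2 r3. pendant_clique p {e} [r1, r2, r3]"
proof -
  obtain x y where e: "e = (x, y)" by fastforce
  let ?R = "Horizontal (2 * y) (2 * x) (2 * x + 1)" and ?L = "Horizontal (2 * y) (2 * x - 1) (2 * x)"
    and ?U = "Vertical (2 * x) (2 * y) (2 * y + 1)" and ?D = "Vertical (2 * x) (2 * y - 1) (2 * y)"
  have cl: "pendant_clique p {e} rs"
    if "rs \<in> {[?L, ?U, ?D], [?R, ?U, ?D], [?R, ?L, ?U], [?R, ?L, ?D]}" "\<forall>r\<in>set rs. noncross r (dbl p)" for rs
    unfolding pendant_clique_def
  proof
    have "set rs \<subseteq> unit_paths e"
      using that(1) unfolding e by (elim insertE emptyE) simp_all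
    then show "\<forall>r\<in>set rs. pendant_path p {e} r"
      using unit_path_pendant[OF _ assms(2,1)] that(2) by blast
    show "\<forall>i<length rs. \<forall>j<length rs. i \<noteq> j \<longrightarrow> noncross (rs ! i) (rs ! j) \<and> touch (rs ! i) (rs ! j)"
      using that(1) by (auto simp: less_Suc_eq nth_Cons')
  qed
  show ?thesis
  proof (cases p)
    case (Horizontal y' i j)
    then have "x = i \<and> (\<forall>r\<in>set [?L, ?U, ?D]. noncross r (dbl p)) \<or> x = j \<and> (\<forall>r\<in>set [?R, ?U, ?D]. noncross r (dbl p))"
      using assms e by auto
    then show ?thesis using cl[of "[?L, ?U, ?D]"] cl[of "[?R, ?U, ?D]"] by blast
  next
    case (Vertical x' i j)
    then have "y = i \<and> (\<forall>r\<in>set [?R, ?L, ?D]. noncross r (dbl p)) \<or> y = j \<and> (\<forall>r\<in>set [?R, ?L, ?U]. noncross r (dbl p))"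
      using assms e by auto
    then show ?thesis using cl[of "[?R, ?L, ?U]"] cl[of "[?R, ?L, ?D]"] by blast
  qed
qed

text \<open>The new paths meet doubled old points only over \<open>E\<close>, so every free end
  outside \<open>E\<close> survives as its doubled point.\<close>

lemma attach_paths:
  assumes P: "rep A V P" and v: "v \<in> V" and Q: "finite Q" "Q \<inter> V = {}" "card Q \<le> length rs"
    and rs: "pendant_clique (P v) E rs"
    and E: "\<And>u. u \<in> V \<Longrightarrow> u \<noteq> v \<Longrightarrow> E \<inter> path_points (P u) = {}"
    and sym: "\<And>u w. A u w \<Longrightarrow> A w u"
    and cl: "\<And>q q'. q \<in> Q \<Longrightarrow> q' \<in> Q \<Longrightarrow> q \<noteq> q' \<Longrightarrow> A q q'"
    and att: "\<And>q u. q \<in> Q \<Longrightarrow> u \<in> V \<Longrightarrow> A q u \<longleftrightarrow> u = v"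
  shows "\<exists>P'. rep A (V \<union> Q) P' \<and> (\<forall>u\<in>V. dbl_point ` (free_ends V P u - E) \<subseteq> free_ends (V \<union> Q) P' u)"
proof -
  obtain f where f: "bij_betw f Q {..<card Q}"
    using ex_bij_betw_finite_nat[OF Q(1)] by (auto simp: atLeast0LessThan)
  have fl: "f q < length rs" if "q \<in> Q" for q
    using bij_betwE[OF f] that Q(3) by (meson lessThan_iff less_le_trans)
  have finj: "f q \<noteq> f q'" if "q \<in> Q" "q' \<in> Q" "q \<noteq> q'" for q q'
    using f that by (auto simp: bij_betw_def inj_on_def)
  define P' where "P' w = (if w \<in> Q then rs ! f w else dbl (P w))" for w
  have pp: "pendant_path (P v) E (rs ! f q)" if "q \<in> Q" for q
    using rs fl[OF that] unfolding pendant_clique_def by simp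
  have old: "P' u = dbl (P u)" if "u \<in> V" for u
    using that Q(2) unfolding P'_def by auto
  have new: "P' q = rs ! f q" if "q \<in> Q" for q
    using that unfolding P'_def by auto
  have qu: "noncross (P' q) (P' u) \<and> (A q u \<longleftrightarrow> touch (P' q) (P' u))" if "q \<in> Q" "u \<in> V" for q u
  proof (cases "u = v")
    case True
    then show ?thesis
      using pp[OF that(1)] att[OF that] old[OF that(2)] new[OF that(1)] unfolding pendant_path_def by simp
  next
    case False
    then have "noncross (rs ! f q) (dbl (P u)) \<and> \<not> touch (rs ! f q) (dbl (P u))"
      using pp[OF that(1)] E[OF that(2)] rep_nondeg[OF P that(2)] rep_noncross[OF P v that(2)]
      unfolding pendant_path_def by auto
    then show ?thesis using False att[OF that] old[OF that(2)] new[OF that(1)] by simp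
  qed
  have "rep A (V \<union> Q) P'"
    unfolding rep_def
  proof (intro conjI ballI impI)
    fix w assume "w \<in> V \<union> Q"
    then show "nondeg (P' w)"
      using old new pp rep_nondeg[OF P] unfolding pendant_path_def by auto
  next
    fix u w assume uw: "u \<in> V \<union> Q" "w \<in> V \<union> Q" "u \<noteq> w"
    have "noncross (P' u) (P' w) \<and> (A u w \<longleftrightarrow> touch (P' u) (P' w))"
    proof (cases "u \<in> Q"; cases "w \<in> Q")
      assume "u \<in> Q" "w \<in> Q"
      then show ?thesis
        using rs fl finj[of u w] cl uw new unfolding pendant_clique_def by simp
    next
      assume "u \<in> Q" "w \<notin> Q"
      then show ?thesis using qu uw by blast
    next
      assume "u \<notin> Q" "w \<in> Q"
      then show ?thesis using qu[of w u] uw sym noncross_sym touch_sym by blast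
    next
      assume "u \<notin> Q" "w \<notin> Q"
      then show ?thesis
        using uw old rep_noncross[OF P] rep_touch[OF P] by auto
    qed
    then show "noncross (P' u) (P' w)" "A u w \<longleftrightarrow> touch (P' u) (P' w)" by auto
  qed
  moreover have "dbl_point ` (free_ends V P u - E) \<subseteq> free_ends (V \<union> Q) P' u" if u: "u \<in> V" for u
  proof
    fix d assume "d \<in> dbl_point ` (free_ends V P u - E)"
    then obtain e where e: "d = dbl_point e" "e \<in> free_ends V P u" "e \<notin> E"
      by (elim imageE DiffE)
    have "d \<notin> path_points (P' w)" if "w \<in> V \<union> Q" "w \<noteq> u" for w
    proof (cases "w \<in> Q")
      case True
      have "dbl_point e \<notin> path_points (rs ! f w)"
        using pp[OF True] e(3) unfolding pendant_path_def by blast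
      then show ?thesis using new[OF True] e(1) by simp
    next
      case False
      then have "w \<in> V" using that by blast
      then have "e \<notin> path_points (P w)" using e(2) that(2) unfolding free_ends_def by blast
      then show ?thesis using old[OF \<open>w \<in> V\<close>] e(1) by simp
    qed
    then show "d \<in> free_ends (V \<union> Q) P' u"
      using e old[OF u] unfolding free_ends_def by auto
  qed
  ultimately show ?thesis by blast
qed

text \<open>Up to two vertices are drawn at a midpoint, with \<open>E\<close> empty; three need an
  end, and \<open>E\<close> consists of that point. The conclusion bounds the loss of free ends
  because further cliques will be attached.\<close>

lemma attach_clique:
  assumes P: "rep A V P" and v: "v \<in> V" and Q: "finite Q" "Q \<inter> V = {}" "card Q \<le> 3"
    and e: "card Q = 3 \<Longrightarrow> free_ends V P v \<noteq> {}"
    and sym: "\<And>u w. A u w \<Longrightarrow> A w u"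
    and cl: "\<And>q q'. q \<in> Q \<Longrightarrow> q' \<in> Q \<Longrightarrow> q \<noteq> q' \<Longrightarrow> A q q'"
    and att: "\<And>q u. q \<in> Q \<Longrightarrow> u \<in> V \<Longrightarrow> A q u \<longleftrightarrow> u = v"
  shows "\<exists>P'. rep A (V \<union> Q) P' \<and>
    (\<forall>u\<in>V. card (free_ends V P u) \<le> card (free_ends (V \<union> Q) P' u) + (if card Q = 3 \<and> u = v then 1 else 0))"
proof -
  have "\<exists>E rs. pendant_clique (P v) E rs \<and> card Q \<le> length rs \<and> (\<forall>u\<in>V. u \<noteq> v \<longrightarrow> E \<inter> path_points (P u) = {}) \<and>
    card E \<le> (if card Q = 3 then 1 else 0) \<and> finite E \<and> E \<subseteq> free_ends V P v"
  proof (cases "card Q = 3")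
    case True
    then obtain e where "e \<in> free_ends V P v" using e by blast
    then obtain r1 r2 r3 where "pendant_clique (P v) {e} [r1, r2, r3]"
      using pendant_triple rep_nondeg[OF P v] unfolding free_ends_def by blast
    moreover have "\<forall>u\<in>V. u \<noteq> v \<longrightarrow> {e} \<inter> path_points (P u) = {}"
      using \<open>e \<in> free_ends V P v\<close> unfolding free_ends_def by auto
    ultimately show ?thesis
      using True \<open>e \<in> free_ends V P v\<close> by (intro exI[of _ "{e}"] exI[of _ "[r1, r2, r3]"]) simp
  next
    case False
    obtain r1 r2 where "pendant_clique (P v) {} [r1, r2]"
      using pendant_pair rep_nondeg[OF P v] by blast
    then show ?thesis
      using False Q(3) by (intro exI[of _ "{}"] exI[of _ "[r1, r2]"]) simp
  qed
  then obtain E rs where E: "pendant_clique (P v) E rs" "card Q \<le> length rs"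
    "\<And>u. u \<in> V \<Longrightarrow> u \<noteq> v \<Longrightarrow> E \<inter> path_points (P u) = {}"
    "card E \<le> (if card Q = 3 then 1 else 0)" "finite E" "E \<subseteq> free_ends V P v"
    by blast
  obtain P' where P': "rep A (V \<union> Q) P'"
    "\<And>u. u \<in> V \<Longrightarrow> dbl_point ` (free_ends V P u - E) \<subseteq> free_ends (V \<union> Q) P' u"
    using attach_paths[OF P v Q(1,2) E(2,1,3) sym cl att] by blast
  have "card (free_ends V P u) \<le> card (free_ends (V \<union> Q) P' u) + (if card Q = 3 \<and> u = v then 1 else 0)"
    if u: "u \<in> V" for u
  proof -
    have "inj_on dbl_point S" for S
      by (auto simp: inj_on_def)
    then have c: "card (free_ends V P u - E) \<le> card (free_ends (V \<union> Q) P' u)"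
      using card_mono[OF finite_free_ends P'(2)[OF u]] by (simp add: card_image)
    have "card (free_ends V P u) \<le> card (free_ends V P u - E) + (if card Q = 3 \<and> u = v then 1 else 0)"
    proof (cases "u = v")
      case True
      then show ?thesis
        using E(4,5,6) diff_card_le_card_Diff[of E "free_ends V P u"] by auto
    next
      case False
      have "path_ends (P u) \<subseteq> path_points (P u)"
        using rep_nondeg[OF P u] by (cases "P u") auto
      then have "free_ends V P u \<inter> E = {}"
        using E(3)[OF u False] unfolding free_ends_def by blast
      then show ?thesis by (simp add: Diff_triv)
    qed
    then show ?thesis using c by linarith
  qed
  then show ?thesis using P'(1) by blast
qed

text \<open>With \<open>c\<close> each such triangle is a K4, so their number is the number of free
  ends that attaching \<open>W\<close> demands at \<open>c\<close>.\<close>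

definition triangles_at :: "('a \<Rightarrow> 'a \<Rightarrow> bool) \<Rightarrow> 'a set \<Rightarrow> 'a \<Rightarrow> 'a set set" where
  "triangles_at A W c = {Q. Q \<subseteq> W \<and> card Q = 3 \<and> (\<forall>q\<in>Q. \<forall>q'\<in>Q. q \<noteq> q' \<longrightarrow> A q q') \<and> (\<forall>q\<in>Q. A q c)}"

text \<open>One component of \<open>W\<close> is attached at a time: \<open>trans\<close> makes it a
  clique and \<open>same\<close> gives it a single anchor. The count of free ends is part of the
  induction, so that every triangle still finds one.\<close>

lemma attach_cliques:
  assumes W: "finite W" "C \<inter> W = {}" and P: "rep A C P"
    and sym: "\<And>u w. A u w \<Longrightarrow> A w u"
    and g: "\<And>w. w \<in> W \<Longrightarrow> g w \<in> C" "\<And>w c. w \<in> W \<Longrightarrow> c \<in> C \<Longrightarrow> A w c \<longleftrightarrow> c = g w"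
    and same: "\<And>w w'. w \<in> W \<Longrightarrow> w' \<in> W \<Longrightarrow> A w w' \<Longrightarrow> g w = g w'"
    and trans: "\<And>u v w. u \<in> W \<Longrightarrow> v \<in> W \<Longrightarrow> w \<in> W \<Longrightarrow> A u v \<Longrightarrow> A v w \<Longrightarrow> u \<noteq> w \<Longrightarrow> A u w"
    and K4: "\<And>Q. Q \<subseteq> W \<Longrightarrow> (\<forall>q\<in>Q. \<forall>q'\<in>Q. q \<noteq> q' \<longrightarrow> A q q') \<Longrightarrow> card Q \<le> 3"
    and tri: "\<And>c. c \<in> C \<Longrightarrow> card (triangles_at A W c) \<le> card (free_ends C P c)"
  shows "\<exists>P'. rep A (C \<union> W) P' \<and>
    (\<forall>c\<in>C. card (free_ends C P c) \<le> card (free_ends (C \<union> W) P' c) + card (triangles_at A W c))"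
proof -
  let ?Q = "\<lambda>U P'. rep A (C \<union> U) P' \<and>
    (\<forall>c\<in>C. card (free_ends C P c) \<le> card (free_ends (C \<union> U) P' c) + card (triangles_at A U c))"
  have fin: "finite (triangles_at A U c)" if "U \<subseteq> W" for U c
    by (rule finite_subset[of _ "Pow W"]) (use that W(1) in \<open>auto simp: triangles_at_def\<close>)
  have mono: "card (triangles_at A U c) \<le> card (triangles_at A U' c)" if "U \<subseteq> U'" "U' \<subseteq> W" for U U' c
    by (rule card_mono[OF fin[OF that(2)]]) (use that in \<open>auto simp: triangles_at_def\<close>)
  have "\<exists>P'. ?Q U P'" if "U \<subseteq> W" for U
    using finite_subset[OF that W(1)] that
  proof (induction U rule: finite_psubset_induct)
    case (psubset U)
    show ?case
    proof (cases "U = {}")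
      case True
      then show ?thesis using P by auto
    next
      case False
      then obtain w where w: "w \<in> U" by blast
      \<comment> \<open>As adjacency is transitive on \<open>W\<close>, this is a whole connected
        component of \<open>U\<close>.\<close>
      define Q where "Q = insert w {x \<in> U. A w x}"
      define v where "v = g w"
      have UW: "U \<subseteq> W" by (rule psubset.prems)
      have QU: "Q \<subseteq> U" and wQ: "w \<in> Q" using w unfolding Q_def by auto
      have Qcl: "A q q'" if "q \<in> Q" "q' \<in> Q" "q \<noteq> q'" for q q'
        using that sym trans[of q w q'] w UW unfolding Q_def by blast
      have Qout: "\<not> A q x" if "q \<in> Q" "x \<in> U - Q" for q x
        using that sym trans[of w q x] w UW unfolding Q_def by blast
      have Qg: "g q = v" if "q \<in> Q" for q
      proof (cases "q = w")
        case False
        then have "A w q" "q \<in> W" "w \<in> W" using that w UW unfolding Q_def by blast+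
        then show ?thesis using same unfolding v_def by metis
      qed (simp add: v_def)
      have vC: "v \<in> C" using g(1) w UW unfolding v_def by blast
      have Qatt: "A q u \<longleftrightarrow> u = v" if "q \<in> Q" "u \<in> C" for q u
        using g(2)[of q u] Qg[OF that(1)] QU UW that by auto
      let ?U = "U - Q"
      obtain P1 where P1: "rep A (C \<union> ?U) P1"
        "\<And>c. c \<in> C \<Longrightarrow> card (free_ends C P c) \<le> card (free_ends (C \<union> ?U) P1 c) + card (triangles_at A ?U c)"
        using psubset.IH[of ?U] w wQ UW by blast
      \<comment> \<open>The triangle \<open>Q\<close> is counted for \<open>U\<close> but not for
        the rest. This strict inequality, together with \<open>tri\<close>, leaves a free end at
        \<open>v\<close> for \<open>Q\<close>.\<close>
      have tQ: "card (triangles_at A ?U v) + 1 \<le> card (triangles_at A U v)" if "card Q = 3"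
      proof -
        have "insert Q (triangles_at A ?U v) \<subseteq> triangles_at A U v"
          using that QU Qcl Qatt vC unfolding triangles_at_def by auto
        then have "card (insert Q (triangles_at A ?U v)) \<le> card (triangles_at A U v)"
          by (rule card_mono[OF fin[OF UW]])
        moreover have "Q \<notin> triangles_at A ?U v" using wQ unfolding triangles_at_def by auto
        moreover have "finite (triangles_at A ?U v)" by (rule fin) (use UW in blast)
        ultimately show ?thesis by simp
      qed
      have "\<exists>P'. rep A ((C \<union> ?U) \<union> Q) P' \<and>
        (\<forall>u\<in>C \<union> ?U. card (free_ends (C \<union> ?U) P1 u)
          \<le> card (free_ends ((C \<union> ?U) \<union> Q) P' u) + (if card Q = 3 \<and> u = v then 1 else 0))"
      proof (rule attach_clique[OF P1(1)])
        show "v \<in> C \<union> ?U" using vC by blast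
        show "finite Q" using QU psubset.hyps finite_subset by blast
        show "Q \<inter> (C \<union> ?U) = {}" using W(2) QU UW by blast
        show "card Q \<le> 3" using K4[of Q] Qcl QU UW by blast
        show "free_ends (C \<union> ?U) P1 v \<noteq> {}" if "card Q = 3"
          using tQ[OF that] P1(2)[OF vC] tri[OF vC] mono[OF UW, of v] by auto
        show "A w u" if "A u w" for u w using sym[OF that] .
        show "A q q'" if "q \<in> Q" "q' \<in> Q" "q \<noteq> q'" for q q' by (rule Qcl[OF that])
        show "A q u \<longleftrightarrow> u = v" if "q \<in> Q" "u \<in> C \<union> ?U" for q u
          using Qatt[OF that(1), of u] Qout[OF that(1), of u] that W(2) UW vC by blast
      qed
      moreover have "(C \<union> ?U) \<union> Q = C \<union> U" using QU by blast
      ultimately obtain P2 where P2: "rep A (C \<union> U) P2"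
        "\<And>u. u \<in> C \<union> ?U \<Longrightarrow> card (free_ends (C \<union> ?U) P1 u)
          \<le> card (free_ends (C \<union> U) P2 u) + (if card Q = 3 \<and> u = v then 1 else 0)"
        by metis
      have "card (free_ends C P c) \<le> card (free_ends (C \<union> U) P2 c) + card (triangles_at A U c)" if c: "c \<in> C" for c
      proof -
        have "card (triangles_at A ?U c) + (if card Q = 3 \<and> c = v then 1 else 0) \<le> card (triangles_at A U c)"
          using tQ mono[of ?U U c] UW by auto
        then show ?thesis using P1(2)[OF c] P2(2)[of c] c by auto
      qed
      then show ?thesis using P2(1) by blast
    qed
  qed
  then show ?thesis by blast
qed

section \<open>Two representations side by side\<close>

fun shift :: "int \<Rightarrow> grid_path \<Rightarrow> grid_path" where
  "shift k (Horizontal y i j) = Horizontal y (i + k) (j + k)"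
| "shift k (Vertical x i j) = Vertical (x + k) i j"

lemma shift_simps [simp]:
  "nondeg (shift k p) \<longleftrightarrow> nondeg p"
  "noncross (shift k p) (shift k q) \<longleftrightarrow> noncross p q"
  "touch (shift k p) (shift k q) \<longleftrightarrow> touch p q"
  by (cases p; cases q; auto)+

fun x_bound :: "grid_path \<Rightarrow> int" where
  "x_bound (Horizontal y i j) = max \<bar>i\<bar> \<bar>j\<bar>"
| "x_bound (Vertical x i j) = \<bar>x\<bar>"

text \<open>The first path stays strictly between the columns \<open>- k\<close> and
  \<open>k\<close>, the shifted one strictly between \<open>k\<close> and
  \<open>3 * k\<close>.\<close>

lemma shift_far:
  assumes "x_bound p < k" "x_bound q < k" "nondeg p" "nondeg q"
  shows "noncross p (shift (2 * k) q)" "\<not> touch p (shift (2 * k) q)"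
  using assms by (cases p; cases q; auto)+

lemma rep_disjoint_union:
  assumes "rep A U P" "rep A V R" "finite U" "finite V" "U \<inter> V = {}"
    and "\<And>u v. u \<in> U \<Longrightarrow> v \<in> V \<Longrightarrow> \<not> A u v \<and> \<not> A v u"
  shows "\<exists>P. rep A (U \<union> V) P"
proof -
  \<comment> \<open>The 0 keeps the set nonempty for \<open>Max\<close>, and the 1 added in
    \<open>k\<close> makes the bounds strict.\<close>
  let ?B = "insert 0 (x_bound ` P ` U \<union> x_bound ` R ` V)"
  define k where "k = Max ?B + 1"
  have fin: "finite ?B" using assms(3,4) by simp
  have kU: "x_bound (P u) < k" if "u \<in> U" for u
    using Max_ge[OF fin, of "x_bound (P u)"] that unfolding k_def by simp
  have kV: "x_bound (R v) < k" if "v \<in> V" for v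
    using Max_ge[OF fin, of "x_bound (R v)"] that unfolding k_def by simp
  define S where "S w = (if w \<in> U then P w else shift (2 * k) (R w))" for w
  have SU: "S u = P u" if "u \<in> U" for u using that unfolding S_def by simp
  have SV: "S v = shift (2 * k) (R v)" if "v \<in> V" for v using that assms(5) unfolding S_def by auto
  have far: "noncross (S u) (S v)" "\<not> touch (S u) (S v)" if "u \<in> U" "v \<in> V" for u v
    using shift_far[OF kU[OF that(1)] kV[OF that(2)]] rep_nondeg[OF assms(1) that(1)]
      rep_nondeg[OF assms(2) that(2)] SU[OF that(1)] SV[OF that(2)] by simp_all
  have "rep A (U \<union> V) S"
    unfolding rep_def
  proof (intro conjI ballI impI)
    fix w assume "w \<in> U \<union> V"
    then show "nondeg (S w)"
      using SU SV rep_nondeg[OF assms(1)] rep_nondeg[OF assms(2)] by auto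
  next
    fix u w assume uw: "u \<in> U \<union> V" "w \<in> U \<union> V" "u \<noteq> w"
    have "noncross (S u) (S w) \<and> (A u w \<longleftrightarrow> touch (S u) (S w))"
    proof (cases "u \<in> U"; cases "w \<in> U")
      assume "u \<in> U" "w \<in> U"
      then show ?thesis using SU rep_noncross[OF assms(1)] rep_touch[OF assms(1)] uw(3) by auto
    next
      assume "u \<in> U" "w \<notin> U"
      then show ?thesis using far[of u w] assms(6)[of u w] uw by auto
    next
      assume "u \<notin> U" "w \<in> U"
      then show ?thesis
        using far[of w u] assms(6)[of w u] uw noncross_sym[of "S u"] touch_sym[of "S u"] by auto
    next
      assume "u \<notin> U" "w \<notin> U"
      then show ?thesis using SV rep_noncross[OF assms(2)] rep_touch[OF assms(2)] uw by auto
    qed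
    then show "noncross (S u) (S w)" "A u w \<longleftrightarrow> touch (S u) (S w)" by auto
  qed
  then show ?thesis by blast
qed

section \<open>Graphs without the forbidden subgraphs\<close>

lemma adj_commute: "adj G u v \<longleftrightarrow> adj G v u"
  by (simp add: adj_def insert_commute)

lemma simple_adjD:
  assumes "simple_graph G" "adj G u v"
  shows "u \<in> verts G" "v \<in> verts G" "u \<noteq> v"
  using assms unfolding simple_graph_def adj_def all_edges_def by fastforce+

text \<open>The entries above the diagonal are compared by recursion along the list, so that for a
  concrete list simplification produces the finitely many adjacencies to be checked.\<close>

fun same_row :: "'a graph \<Rightarrow> nat graph \<Rightarrow> nat \<Rightarrow> 'a \<Rightarrow> nat \<Rightarrow> 'a list \<Rightarrow> bool" where
  "same_row G H k x l [] \<longleftrightarrow> True"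
| "same_row G H k x l (y # ys) \<longleftrightarrow> (adj G x y \<longleftrightarrow> adj H k l) \<and> same_row G H k x (l + 1) ys"

fun same_table :: "'a graph \<Rightarrow> nat graph \<Rightarrow> nat \<Rightarrow> 'a list \<Rightarrow> bool" where
  "same_table G H k [] \<longleftrightarrow> True"
| "same_table G H k (x # xs) \<longleftrightarrow> same_row G H k x (k + 1) xs \<and> same_table G H (k + 1) xs"

lemma same_row_nth: "same_row G H k x l ys \<Longrightarrow> j < length ys \<Longrightarrow> adj G x (ys ! j) \<longleftrightarrow> adj H k (l + j)"
proof (induction ys arbitrary: l j)
  case (Cons y ys)
  then show ?case using Cons.IH[of "l + 1" "j - 1"] by (cases j) auto
qed simp

lemma same_table_nth:
  "same_table G H k xs \<Longrightarrow> i < j \<Longrightarrow> j < length xs \<Longrightarrow> adj G (xs ! i) (xs ! j) \<longleftrightarrow> adj H (k + i) (k + j)"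
proof (induction xs arbitrary: k i j)
  case (Cons x xs)
  show ?case
  proof (cases i)
    case 0
    then show ?thesis using Cons.prems same_row_nth[of G H k x "k + 1" xs "j - 1"] by (cases j) auto
  next
    case (Suc i')
    then show ?thesis using Cons.prems Cons.IH[of "k + 1" i' "j - 1"] by (cases j) auto
  qed
qed simp

text \<open>The table covers only pairs in increasing position; the diagonal comes from
  irreflexivity and the rest from symmetry.\<close>

lemma induced_copy:
  assumes "graph_free \<H> G" "H \<in> \<H>" "simple_graph G" "verts H = {..<length xs}"
    and "distinct xs" "set xs \<subseteq> verts G" "\<And>i. \<not> adj H i i"
    and tab: "same_table G H 0 xs"
  shows False
proof -
  let ?f = "inv_into {..<length xs} ((!) xs)"
  have b: "bij_betw ((!) xs) {..<length xs} (set xs)"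
    using assms(5) by (rule bij_betw_nth) auto
  have f: "?f (xs ! i) = i" if "i < length xs" for i
    using bij_betw_inv_into_left[OF b] that by simp
  have full: "adj G (xs ! i) (xs ! j) \<longleftrightarrow> adj H i j" if "i < length xs" "j < length xs" for i j
  proof (cases i j rule: linorder_cases)
    case less
    then show ?thesis using same_table_nth[OF tab less that(2)] by simp
  next
    case equal
    then show ?thesis using assms(7) simple_adjD(3)[OF assms(3)] by metis
  next
    case greater
    then show ?thesis using same_table_nth[OF tab greater that(1)] adj_commute[of G] adj_commute[of H] by simp
  qed
  have "graph_iso (induced_subgraph G (set xs)) H"
    unfolding graph_iso_def
  proof (intro exI conjI ballI)
    show "bij_betw ?f (verts (induced_subgraph G (set xs))) (verts H)"
      using bij_betw_inv_into[OF b] assms(4) by (simp add: induced_subgraph_def)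
  next
    fix u v assume "u \<in> verts (induced_subgraph G (set xs))" "v \<in> verts (induced_subgraph G (set xs))"
    then have uv: "u \<in> set xs" "v \<in> set xs" by (simp_all add: induced_subgraph_def)
    then obtain i j where ij: "i < length xs" "u = xs ! i" "j < length xs" "v = xs ! j"
      by (metis in_set_conv_nth)
    have "adj (induced_subgraph G (set xs)) u v \<longleftrightarrow> adj G u v"
      using uv by (simp add: adj_def induced_subgraph_def)
    then show "adj (induced_subgraph G (set xs)) u v \<longleftrightarrow> adj H (?f u) (?f v)"
      using full ij f by simp
  qed
  then show False using assms(1,2,6) unfolding graph_free_def by blast
qed

locale free_graph =
  fixes G :: "'a graph"
  assumes simple: "simple_graph G"
    and P5_free: "graph_free {path_graph 5} G"
    and forbidden_free: "graph_free forbidden_graphs G"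
begin

abbreviation A :: "'a \<Rightarrow> 'a \<Rightarrow> bool" where "A \<equiv> adj G"
abbreviation V :: "'a set" where "V \<equiv> verts G"

lemma finite_V: "finite V"
  using simple unfolding simple_graph_def by simp

lemma A_sym: "A u v \<Longrightarrow> A v u"
  by (simp add: adj_commute)

lemma A_irrefl [simp]: "\<not> A u u"
  using simple_adjD(3)[OF simple] by blast

lemma A_V: "A u v \<Longrightarrow> u \<in> V" "A u v \<Longrightarrow> v \<in> V"
  using simple_adjD[OF simple] by blast+

lemmas copy = induced_copy[OF forbidden_free _ simple]

lemma no_P5:
  assumes "A a b" "A b c" "A c d" "A d e"
    and "\<not> A a c" "\<not> A a d" "\<not> A a e" "\<not> A b d" "\<not> A b e" "\<not> A c e"
  shows False
proof (rule induced_copy[OF P5_free _ simple, of "path_graph 5" "[a, b, c, d, e]"])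
  show "distinct [a, b, c, d, e]" using assms A_sym by auto
  show "set [a, b, c, d, e] \<subseteq> V" using assms A_V by auto
  show "\<not> adj (path_graph 5) i i" for i by (auto simp: adj_forbidden)
  show "same_table G (path_graph 5) 0 [a, b, c, d, e]"
    using assms by (simp add: adj_forbidden adj_commute[of G] del: One_nat_def)
qed (auto simp: path_graph_def)

lemma no_diamond:
  assumes "A a b" "A a c" "A b c" "A a d" "A b d" "c \<noteq> d"
  shows "A c d"
proof (rule ccontr)
  assume n: "\<not> A c d"
  show False
  proof (rule copy[of "K4_minus" "[c, d, a, b]"])
    show "distinct [c, d, a, b]" using assms n A_sym by auto
    show "set [c, d, a, b] \<subseteq> V" using assms n A_V by auto
    show "\<not> adj (K4_minus) i i" for i by (auto simp: adj_forbidden)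
    show "same_table G (K4_minus) 0 [c, d, a, b]"
      using assms n by (simp add: adj_forbidden adj_commute[of G] del: One_nat_def)
  qed (auto simp: forbidden_graphs_def K4_minus_def delete_edge_def complete_graph_def)
qed

lemma no_K5:
  assumes "A a b" "A a c" "A a d" "A a e" "A b c" "A b d" "A b e" "A c d" "A c e" "A d e"
  shows False
proof (rule copy[of "complete_graph 5" "[a, b, c, d, e]"])
  show "distinct [a, b, c, d, e]" using assms A_sym by auto
  show "set [a, b, c, d, e] \<subseteq> V" using assms A_V by auto
  show "\<not> adj (complete_graph 5) i i" for i by (auto simp: adj_forbidden)
  show "same_table G (complete_graph 5) 0 [a, b, c, d, e]"
    using assms by (simp add: adj_forbidden adj_commute[of G] del: One_nat_def)
qed (auto simp: forbidden_graphs_def complete_graph_def)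

lemma no_K33:
  assumes "A a x" "A a y" "A a z" "A b x" "A b y" "A b z" "A c x" "A c y" "A c z"
    and "\<not> A a b" "\<not> A a c" "\<not> A b c" "\<not> A x y" "\<not> A x z" "\<not> A y z"
    and "distinct [a, b, c, x, y, z]"
  shows False
proof (rule copy[of "complete_bipartite_graph 3 3" "[a, b, c, x, y, z]"])
  show "distinct [a, b, c, x, y, z]" using assms A_sym by auto
  show "set [a, b, c, x, y, z] \<subseteq> V" using assms A_V by auto
  show "\<not> adj (complete_bipartite_graph 3 3) i i" for i by (auto simp: adj_forbidden)
  show "same_table G (complete_bipartite_graph 3 3) 0 [a, b, c, x, y, z]"
    using assms by (simp add: adj_forbidden adj_commute[of G] del: One_nat_def)
qed (auto simp: forbidden_graphs_def complete_bipartite_graph_def)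

text \<open>Here \<open>w\<close> subdivides the edge from \<open>a\<close> to
  \<open>x\<close>.\<close>

lemma no_K33_star:
  assumes "A a y" "A a z" "A a w" "A b x" "A b y" "A b z" "A c x" "A c y" "A c z" "A x w"
    and "\<not> A a b" "\<not> A a c" "\<not> A a x" "\<not> A b c" "\<not> A b w" "\<not> A c w" "\<not> A x y" "\<not> A x z" "\<not> A y z" "\<not> A y w" "\<not> A z w"
    and "distinct [a, b, c, x, y, z, w]"
  shows False
proof (rule copy[of "K33_star" "[a, b, c, x, y, z, w]"])
  show "distinct [a, b, c, x, y, z, w]" using assms A_sym by auto
  show "set [a, b, c, x, y, z, w] \<subseteq> V" using assms A_V by auto
  show "\<not> adj (K33_star) i i" for i by (auto simp: adj_forbidden)
  show "same_table G (K33_star) 0 [a, b, c, x, y, z, w]"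
    using assms by (simp add: adj_forbidden adj_commute[of G] del: One_nat_def)
qed (auto simp: forbidden_graphs_def K33_star_def subdivide_edge_def complete_bipartite_graph_def)

text \<open>The graph is a prism: triangles \<open>a\<close>, \<open>b\<close>, \<open>c\<close> and
  \<open>x\<close>, \<open>y\<close>, \<open>z\<close> joined by the matching \<open>ay\<close>,
  \<open>bz\<close>, \<open>cx\<close>. The list follows the six-cycle formed by the
  non-edges.\<close>

lemma no_co_C6:
  assumes "A a b" "A a y" "A a c" "A x y" "A x c" "A x z" "A b c" "A b z" "A y z"
    and "\<not> A a x" "\<not> A a z" "\<not> A x b" "\<not> A b y" "\<not> A y c" "\<not> A c z"
    and "distinct [a, x, b, y, c, z]"
  shows False
proof (rule copy[of "graph_complement (cycle_graph 6)" "[a, x, b, y, c, z]"])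
  show "distinct [a, x, b, y, c, z]" using assms A_sym by auto
  show "set [a, x, b, y, c, z] \<subseteq> V" using assms A_V by auto
  show "\<not> adj (graph_complement (cycle_graph 6)) i i" for i by (auto simp: adj_forbidden)
  show "same_table G (graph_complement (cycle_graph 6)) 0 [a, x, b, y, c, z]"
    using assms by (simp add: adj_forbidden adj_commute[of G] del: One_nat_def)
qed (auto simp: forbidden_graphs_def graph_complement_def verts_cycle_graph)

lemma no_G2:
  assumes "A a v" "A a w" "A a u" "A a z" "A v b" "A b c" "A b u" "A c w" "A c z" "A u z"
    and "\<not> A a b" "\<not> A a c" "\<not> A v c" "\<not> A v w" "\<not> A v u" "\<not> A v z" "\<not> A b w" "\<not> A b z" "\<not> A c u" "\<not> A w u" "\<not> A w z"
    and "distinct [a, v, b, c, w, u, z]"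
  shows False
proof (rule copy[of "G2" "[a, v, b, c, w, u, z]"])
  show "distinct [a, v, b, c, w, u, z]" using assms A_sym by auto
  show "set [a, v, b, c, w, u, z] \<subseteq> V" using assms A_V by auto
  show "\<not> adj (G2) i i" for i by (auto simp: adj_forbidden)
  show "same_table G (G2) 0 [a, v, b, c, w, u, z]"
    using assms by (simp add: adj_forbidden adj_commute[of G] del: One_nat_def)
qed (auto simp: forbidden_graphs_def G2_def)

lemma no_G3:
  assumes "A a v" "A a w" "A a u" "A v b" "A v z" "A b c" "A b u" "A b z" "A c w" "A c u" "A w z"
    and "\<not> A a b" "\<not> A a c" "\<not> A a z" "\<not> A v c" "\<not> A v w" "\<not> A v u" "\<not> A b w" "\<not> A c z" "\<not> A w u" "\<not> A u z"
    and "distinct [a, v, b, c, w, u, z]"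
  shows False
proof (rule copy[of "G3" "[a, v, b, c, w, u, z]"])
  show "distinct [a, v, b, c, w, u, z]" using assms A_sym by auto
  show "set [a, v, b, c, w, u, z] \<subseteq> V" using assms A_V by auto
  show "\<not> adj (G3) i i" for i by (auto simp: adj_forbidden)
  show "same_table G (G3) 0 [a, v, b, c, w, u, z]"
    using assms by (simp add: adj_forbidden adj_commute[of G] del: One_nat_def)
qed (auto simp: forbidden_graphs_def G3_def)

end

section \<open>Cliques and triangles at a vertex, and attaching them to a core\<close>

context free_graph
begin

text \<open>Disjointness is included, so that these facts also supply the distinctness of the listed
  vertices.\<close>

definition anticomplete :: "'a set \<Rightarrow> 'a set \<Rightarrow> bool" where
  "anticomplete X Y \<longleftrightarrow> (\<forall>x\<in>X. \<forall>y\<in>Y. x \<noteq> y \<and> \<not> A x y)"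

lemma anticomplete_insert [simp]:
  "anticomplete (insert x X) Y \<longleftrightarrow> (\<forall>y\<in>Y. x \<noteq> y \<and> \<not> A x y) \<and> anticomplete X Y" "anticomplete {} Y"
  by (auto simp: anticomplete_def)

lemma triangle_elements:
  assumes "Q \<in> triangles_at A W c"
  obtains x y z where "Q = {x, y, z}" "distinct [x, y, z]" "A x y" "A x z" "A y z" "A x c" "A y c" "A z c"
proof -
  obtain x y z where "Q = {x, y, z}" "x \<noteq> y" "x \<noteq> z" "y \<noteq> z"
    using assms unfolding triangles_at_def by (auto simp: card_3_iff)
  then show ?thesis using that[of x y z] assms unfolding triangles_at_def by auto
qed

lemma no_H0:
  assumes "P \<in> triangles_at A V c" "Q \<in> triangles_at A V c" "R \<in> triangles_at A V c"
    and anti: "anticomplete P Q" "anticomplete P R" "anticomplete Q R"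
  shows False
proof -
  obtain p1 p2 p3 where p: "P = {p1, p2, p3}" "distinct [p1, p2, p3]" "A p1 p2" "A p1 p3" "A p2 p3" "A p1 c" "A p2 c" "A p3 c"
    using triangle_elements[OF assms(1)] .
  obtain q1 q2 q3 where q: "Q = {q1, q2, q3}" "distinct [q1, q2, q3]" "A q1 q2" "A q1 q3" "A q2 q3" "A q1 c" "A q2 c" "A q3 c"
    using triangle_elements[OF assms(2)] .
  obtain r1 r2 r3 where r: "R = {r1, r2, r3}" "distinct [r1, r2, r3]" "A r1 r2" "A r1 r3" "A r2 r3" "A r1 c" "A r2 c" "A r3 c"
    using triangle_elements[OF assms(3)] .
  let ?l = "[c, p1, p2, p3, q1, q2, q3, r1, r2, r3]"
  have n: "c \<notin> P" "c \<notin> Q" "c \<notin> R" using p q r by auto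
  note facts = anti[unfolded p(1) q(1) r(1)] n[unfolded p(1) q(1) r(1)] p(2-) q(2-) r(2-)
  show False
  proof (rule copy[of H0 ?l])
    show "distinct ?l" using facts by simp
    show "set ?l \<subseteq> V" using facts A_V by auto
    show "\<not> adj H0 i i" for i by (auto simp: adj_forbidden)
    show "same_table G H0 0 ?l"
      using facts by (simp add: adj_forbidden adj_commute[of G] del: One_nat_def)
  qed (auto simp: forbidden_graphs_def H0_def)
qed

lemma no_G_P2:
  assumes "P \<in> triangles_at A V c" "Q \<in> triangles_at A V c" "R \<in> triangles_at A V d" "S \<in> triangles_at A V d" "A c d"
    and anti: "anticomplete P Q" "anticomplete P R" "anticomplete P S" "anticomplete Q R" "anticomplete Q S"
      "anticomplete R S" "anticomplete {c} R" "anticomplete {c} S" "anticomplete {d} P" "anticomplete {d} Q"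
  shows False
proof -
  obtain p1 p2 p3 where p: "P = {p1, p2, p3}" "distinct [p1, p2, p3]" "A p1 p2" "A p1 p3" "A p2 p3" "A p1 c" "A p2 c" "A p3 c"
    using triangle_elements[OF assms(1)] .
  obtain q1 q2 q3 where q: "Q = {q1, q2, q3}" "distinct [q1, q2, q3]" "A q1 q2" "A q1 q3" "A q2 q3" "A q1 c" "A q2 c" "A q3 c"
    using triangle_elements[OF assms(2)] .
  obtain r1 r2 r3 where r: "R = {r1, r2, r3}" "distinct [r1, r2, r3]" "A r1 r2" "A r1 r3" "A r2 r3" "A r1 d" "A r2 d" "A r3 d"
    using triangle_elements[OF assms(3)] .
  obtain s1 s2 s3 where s: "S = {s1, s2, s3}" "distinct [s1, s2, s3]" "A s1 s2" "A s1 s3" "A s2 s3" "A s1 d" "A s2 d" "A s3 d"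
    using triangle_elements[OF assms(4)] .
  let ?l = "[c, d, p1, p2, p3, q1, q2, q3, r1, r2, r3, s1, s2, s3]"
  have n: "c \<notin> P" "c \<notin> Q" "d \<notin> R" "d \<notin> S" "c \<noteq> d" using p q r s assms(5) by auto
  note facts = anti[unfolded p(1) q(1) r(1) s(1)] n[unfolded p(1) q(1) r(1) s(1)] assms(5) p(2-) q(2-) r(2-) s(2-)
  show False
  proof (rule copy[of G_P2 ?l])
    show "distinct ?l" using facts by (simp add: eq_commute)
    show "set ?l \<subseteq> V" using facts A_V by auto
    show "\<not> adj G_P2 i i" for i by (auto simp: adj_forbidden)
    show "same_table G G_P2 0 ?l"
      using facts by (simp add: adj_forbidden adj_commute[of G] del: One_nat_def)
  qed (auto simp: forbidden_graphs_def G_P2_def)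
qed

lemma no_G1:
  assumes "A a v" "A v b" "A b c" "A c w" "A w a" "A u a" "A u b" "A u c"
    and "\<not> A a b" "\<not> A a c" "\<not> A v c" "\<not> A v w" "\<not> A b w" "\<not> A u v" "\<not> A u w"
    and "P \<in> triangles_at A V u" "Q \<in> triangles_at A V u"
    and anti: "anticomplete P Q" "anticomplete {a, v, b, c, w} P" "anticomplete {a, v, b, c, w} Q"
  shows False
proof -
  obtain p1 p2 p3 where p: "P = {p1, p2, p3}" "distinct [p1, p2, p3]" "A p1 p2" "A p1 p3" "A p2 p3" "A p1 u" "A p2 u" "A p3 u"
    using triangle_elements[OF assms(16)] .
  obtain q1 q2 q3 where q: "Q = {q1, q2, q3}" "distinct [q1, q2, q3]" "A q1 q2" "A q1 q3" "A q2 q3" "A q1 u" "A q2 u" "A q3 u"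
    using triangle_elements[OF assms(17)] .
  let ?l = "[a, v, b, c, w, u, p1, p2, p3, q1, q2, q3]"
  have n: "u \<notin> P" "u \<notin> Q" using p q by auto
  have d: "distinct [a, v, b, c, w, u]" using assms(1-15) A_sym by auto
  note facts = anti[unfolded p(1) q(1)] n[unfolded p(1) q(1)] d assms(1-15) p(2-) q(2-)
  show False
  proof (rule copy[of G1 ?l])
    show "distinct ?l" using facts by (simp add: eq_commute)
    show "set ?l \<subseteq> V" using facts A_V by auto
    show "\<not> adj G1 i i" for i by (auto simp: adj_forbidden)
    show "same_table G G1 0 ?l"
      using facts by (simp add: adj_forbidden adj_commute[of G] del: One_nat_def)
  qed (auto simp: forbidden_graphs_def G1_def)
qed

lemma no_G4:
  assumes "A a v" "A v b" "A b c" "A c w" "A w a" "A u a" "A u b" "A u c" "A z v" "A z w" "A z u"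
    and "\<not> A a b" "\<not> A a c" "\<not> A v c" "\<not> A v w" "\<not> A b w" "\<not> A u v" "\<not> A u w"
      "\<not> A z a" "\<not> A z b" "\<not> A z c"
    and "distinct [a, v, b, c, w, u, z]"
    and "P \<in> triangles_at A V u"
    and anti: "anticomplete {a, v, b, c, w, z} P"
  shows False
proof -
  obtain p1 p2 p3 where p: "P = {p1, p2, p3}" "distinct [p1, p2, p3]" "A p1 p2" "A p1 p3" "A p2 p3" "A p1 u" "A p2 u" "A p3 u"
    using triangle_elements[OF assms(23)] .
  let ?l = "[a, v, b, c, w, u, z, p1, p2, p3]"
  have n: "u \<notin> P" using p by auto
  note facts = anti[unfolded p(1)] n[unfolded p(1)] assms(1-22) p(2-)
  show False
  proof (rule copy[of G4 ?l])
    show "distinct ?l" using facts by (simp add: eq_commute)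
    show "set ?l \<subseteq> V" using facts A_V by auto
    show "\<not> adj G4 i i" for i by (auto simp: adj_forbidden)
    show "same_table G G4 0 ?l"
      using facts by (simp add: adj_forbidden adj_commute[of G] del: One_nat_def)
  qed (auto simp: forbidden_graphs_def G4_def)
qed

definition clique :: "'a set \<Rightarrow> bool" where
  "clique Q \<longleftrightarrow> Q \<subseteq> V \<and> (\<forall>x\<in>Q. \<forall>y\<in>Q. x \<noteq> y \<longrightarrow> A x y)"

lemma cliqueD: "clique Q \<Longrightarrow> x \<in> Q \<Longrightarrow> y \<in> Q \<Longrightarrow> x \<noteq> y \<Longrightarrow> A x y"
  by (auto simp: clique_def)

lemma clique_finite: "clique Q \<Longrightarrow> finite Q"
  using finite_V finite_subset by (auto simp: clique_def)

lemma clique_card: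
  assumes "clique Q"
  shows "card Q \<le> 4"
proof (rule ccontr)
  assume "\<not> card Q \<le> 4"
  then have "5 \<le> card Q" by simp
  then obtain T where T: "T \<subseteq> Q" "card T = 5" by (meson obtain_subset_with_card_n)
  obtain xs where xs: "set xs = T" "distinct xs"
    using finite_distinct_list[of T] T clique_finite[OF assms] finite_subset by blast
  then have "length xs = Suc (Suc (Suc (Suc (Suc 0))))" using T(2) distinct_card[of xs] by simp
  then obtain a b c d e where "xs = [a, b, c, d, e]" by (auto simp: length_Suc_conv)
  then show False
    using no_K5[of a b c d e] xs T(1) cliqueD[OF assms] by auto
qed

text \<open>If \<open>x\<close> and \<open>z\<close> were distinct and nonadjacent, \<open>y\<close>
  and \<open>c\<close> would be the degree-three vertices of a diamond. So the neighbourhood of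
  \<open>c\<close> splits into cliques.\<close>

lemma nbhd_trans:
  assumes "A x c" "A y c" "A z c" "x = y \<or> A x y" "y = z \<or> A y z"
  shows "x = z \<or> A x z"
  using assms no_diamond[of c y x z] A_sym by blast

text \<open>Two different triangles in one component of the neighbourhood of \<open>c\<close> would
  form, together with \<open>c\<close>, a clique of at least five vertices.\<close>

lemma triangles_at_anticomplete:
  assumes "P \<in> triangles_at A W c" "Q \<in> triangles_at A W' c" "P \<noteq> Q"
  shows "anticomplete P Q"
  unfolding anticomplete_def
proof (intro ballI, rule ccontr)
  fix x y assume xy: "x \<in> P" "y \<in> Q" "\<not> (x \<noteq> y \<and> \<not> A x y)"
  have P: "card P = 3" "\<And>p p'. p \<in> P \<Longrightarrow> p' \<in> P \<Longrightarrow> p \<noteq> p' \<Longrightarrow> A p p'" "\<And>p. p \<in> P \<Longrightarrow> A p c"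
    and Q: "card Q = 3" "\<And>p p'. p \<in> Q \<Longrightarrow> p' \<in> Q \<Longrightarrow> p \<noteq> p' \<Longrightarrow> A p p'" "\<And>p. p \<in> Q \<Longrightarrow> A p c"
    using assms(1,2) unfolding triangles_at_def by auto
  have pq: "p = q \<or> A p q" if "p \<in> P" "q \<in> Q" for p q
  proof -
    have "p = y \<or> A p y"
      using nbhd_trans[of p c x y] P Q xy that by blast
    then show ?thesis
      using nbhd_trans[of p c y q] P Q xy that by blast
  qed
  have cl: "clique (insert c (P \<union> Q))"
    unfolding clique_def using pq P(2,3) Q(2,3) A_sym A_V xy by blast
  have fin: "finite P" "finite Q" using P(1) Q(1) by (auto intro: card_ge_0_finite)
  have "\<not> Q \<subseteq> P" using card_subset_eq[OF fin(1)] P(1) Q(1) assms(3) by metis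
  then obtain q where q: "q \<in> Q" "q \<notin> P" by blast
  have "card (insert q P) = 4" using q fin P(1) by simp
  moreover have "card (insert q P) \<le> card (P \<union> Q)" using q fin by (intro card_mono) auto
  moreover have "c \<notin> P \<union> Q" using P(3)[of c] Q(3)[of c] by auto
  ultimately have "card (insert c (P \<union> Q)) \<ge> 5" using fin by simp
  then show False using clique_card[OF cl] by simp
qed

lemma finite_triangles_at: "finite (triangles_at A V c)"
  by (rule finite_subset[of _ "Pow V"]) (auto simp: triangles_at_def finite_V)

text \<open>Three triangles at one vertex are pairwise anticomplete and hence give
  \<open>H0\<close>.\<close>

lemma card_triangles_at: "card (triangles_at A V c) \<le> 2"
proof (rule ccontr)
  assume "\<not> card (triangles_at A V c) \<le> 2"
  then have "3 \<le> card (triangles_at A V c)" by simp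
  then obtain T where "T \<subseteq> triangles_at A V c" "card T = 3" by (meson obtain_subset_with_card_n)
  then obtain P Q R where "P \<in> triangles_at A V c" "Q \<in> triangles_at A V c" "R \<in> triangles_at A V c"
    "P \<noteq> Q" "P \<noteq> R" "Q \<noteq> R"
    unfolding card_3_iff by auto
  then show False using no_H0 triangles_at_anticomplete by meson
qed

lemma triangles_at_mono: "W \<subseteq> W' \<Longrightarrow> triangles_at A W c \<subseteq> triangles_at A W' c"
  by (auto simp: triangles_at_def)

text \<open>This is the criterion behind all cores with pendant cliques: each outer vertex has one
  anchor in \<open>C\<close>, adjacent outer vertices share it, and the neighbourhood of an anchor
  splits into cliques, so only the supply of free ends has to be checked for a drawing of
  \<open>C\<close>.\<close>

lemma pendant_rep:
  assumes C: "C \<subseteq> V" and P: "rep A C P"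
    and ex: "\<And>w. w \<in> V - C \<Longrightarrow> \<exists>c\<in>C. A w c"
    and un: "\<And>w c d. w \<in> V - C \<Longrightarrow> c \<in> C \<Longrightarrow> d \<in> C \<Longrightarrow> A w c \<Longrightarrow> A w d \<Longrightarrow> c = d"
    and same: "\<And>w w' c d. w \<in> V - C \<Longrightarrow> w' \<in> V - C \<Longrightarrow> A w w' \<Longrightarrow> c \<in> C \<Longrightarrow> d \<in> C \<Longrightarrow> A w c \<Longrightarrow> A w' d \<Longrightarrow> c = d"
    and tri: "\<And>c. c \<in> C \<Longrightarrow> card (triangles_at A (V - C) c) \<le> card (free_ends C P c)"
  shows "contact_B0_VPG G"
proof -
  obtain g where g: "\<And>w. w \<in> V - C \<Longrightarrow> g w \<in> C \<and> A w (g w)" using ex by metis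
  have "\<exists>P'. rep A (C \<union> (V - C)) P' \<and>
    (\<forall>c\<in>C. card (free_ends C P c) \<le> card (free_ends (C \<union> (V - C)) P' c) + card (triangles_at A (V - C) c))"
  proof (rule attach_cliques[of "V - C" C A P g])
    show "finite (V - C)" using finite_V by simp
    show "A u w \<Longrightarrow> A w u" for u w by (rule A_sym)
    show "g w \<in> C" if "w \<in> V - C" for w using g[OF that] by blast
    show "A w c \<longleftrightarrow> c = g w" if "w \<in> V - C" "c \<in> C" for w c
      using g[OF that(1)] un[OF that(1,2)] by blast
    show "g w = g w'" if "w \<in> V - C" "w' \<in> V - C" "A w w'" for w w'
      using same[OF that] g[OF that(1)] g[OF that(2)] by blast
    show "A u w" if "u \<in> V - C" "v \<in> V - C" "w \<in> V - C" "A u v" "A v w" "u \<noteq> w" for u v w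
    proof -
      have "g u = g v" "g v = g w"
        using same[OF that(1,2,4), of "g u" "g v"] same[OF that(2,3,5), of "g v" "g w"]
          g[OF that(1)] g[OF that(2)] g[OF that(3)] by simp_all
      then have "A u (g u)" "A v (g u)" "A w (g u)"
        using g[OF that(1)] g[OF that(2)] g[OF that(3)] by simp_all
      then show ?thesis using nbhd_trans[of u "g u" v w] that(4-6) by blast
    qed
    show "card Q \<le> 3" if Q: "Q \<subseteq> V - C" "\<forall>q\<in>Q. \<forall>q'\<in>Q. q \<noteq> q' \<longrightarrow> A q q'" for Q
    proof (cases "Q = {}")
      case False
      then obtain q where q: "q \<in> Q" by blast
      have qg: "A p (g q)" if "p \<in> Q" for p
      proof -
        have V: "p \<in> V - C" "q \<in> V - C" using Q(1) q that by auto
        then show ?thesis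
          using g[OF V(1)] g[OF V(2)] same[OF V, of "g p" "g q"] Q(2) q that by (cases "p = q") auto
      qed
      have "clique (insert (g q) Q)"
        unfolding clique_def using Q qg A_sym A_V q by blast
      moreover have "g q \<notin> Q" using g[of q] q Q(1) by blast
      moreover have "finite Q" using Q(1) finite_V finite_subset by blast
      ultimately show ?thesis using clique_card[of "insert (g q) Q"] by simp
    qed simp
  qed (use P tri in auto)
  moreover have "C \<union> (V - C) = V" using C by blast
  ultimately show ?thesis unfolding contact_B0_VPG_def contact_rep_iff by auto
qed

end

lemma free_ends_ge_1:
  assumes "e \<in> path_ends (P c)" "\<And>u. u \<in> C \<Longrightarrow> u \<noteq> c \<Longrightarrow> e \<notin> path_points (P u)"
  shows "1 \<le> card (free_ends C P c)"
proof -
  have "{e} \<subseteq> free_ends C P c" using assms unfolding free_ends_def by blast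
  then have "card {e} \<le> card (free_ends C P c)" by (rule card_mono[OF finite_free_ends])
  then show ?thesis by simp
qed

lemma free_ends_ge_2:
  assumes "e \<in> path_ends (P c)" "\<And>u. u \<in> C \<Longrightarrow> u \<noteq> c \<Longrightarrow> e \<notin> path_points (P u)"
    and "e' \<in> path_ends (P c)" "\<And>u. u \<in> C \<Longrightarrow> u \<noteq> c \<Longrightarrow> e' \<notin> path_points (P u)" "e \<noteq> e'"
  shows "2 \<le> card (free_ends C P c)"
proof -
  have "{e, e'} \<subseteq> free_ends C P c" using assms unfolding free_ends_def by blast
  then have "card {e, e'} \<le> card (free_ends C P c)" by (rule card_mono[OF finite_free_ends])
  then show ?thesis using assms(5) by simp
qed

lemma card_le_2_subset:
  assumes "finite S" "card S \<le> 2"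
  shows "\<exists>x y. S \<subseteq> {x, y}"
proof -
  have "card S = 0 \<or> card S = 1 \<or> card S = 2" using assms(2) by linarith
  then show ?thesis using assms(1) by (auto simp: card_1_singleton_iff card_2_iff)
qed

section \<open>Graphs without induced four- and five-cycles\<close>

text \<open>Connectedness is stated by cuts. This form yields the escaping edge in the distance
  arguments and, negated, the splitting of a disconnected graph.\<close>

locale connected_free_graph = free_graph +
  assumes connected: "\<And>D. D \<subseteq> V \<Longrightarrow> D \<noteq> {} \<Longrightarrow> D \<noteq> V \<Longrightarrow> \<exists>u\<in>D. \<exists>v\<in>V - D. A u v"
begin

definition hole4 :: "'a \<Rightarrow> 'a \<Rightarrow> 'a \<Rightarrow> 'a \<Rightarrow> bool" where
  "hole4 a b c d \<longleftrightarrow> A a b \<and> A b c \<and> A c d \<and> A d a \<and> \<not> A a c \<and> \<not> A b d \<and> a \<noteq> c \<and> b \<noteq> d"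

text \<open>Distinctness follows from the clauses, since for instance \<open>e\<close> tells
  \<open>a\<close> from \<open>c\<close>. Opposite corners of a four-cycle have the same neighbours
  on it, so \<open>hole4\<close> states distinctness explicitly.\<close>

definition hole5 :: "'a \<Rightarrow> 'a \<Rightarrow> 'a \<Rightarrow> 'a \<Rightarrow> 'a \<Rightarrow> bool" where
  "hole5 a b c d e \<longleftrightarrow> A a b \<and> A b c \<and> A c d \<and> A d e \<and> A e a \<and>
     \<not> A a c \<and> \<not> A b d \<and> \<not> A c e \<and> \<not> A d a \<and> \<not> A e b"

text \<open>Two triangles at each end of the edge \<open>cd\<close> would be \<open>G_P2\<close>;
  the conditions on \<open>W\<close> make the triangles at \<open>c\<close> anticomplete to
  \<open>d\<close> and to those at \<open>d\<close>.\<close>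

lemma triangles_at_two_large:
  assumes "A c d" "\<And>w. w \<in> W \<Longrightarrow> \<not> (A w c \<and> A w d)"
    and "\<And>w w'. w \<in> W \<Longrightarrow> w' \<in> W \<Longrightarrow> A w c \<Longrightarrow> A w' d \<Longrightarrow> \<not> A w w'"
    and "W \<subseteq> V" "c \<notin> W" "d \<notin> W" "2 \<le> card (triangles_at A W c)" "2 \<le> card (triangles_at A W d)"
  shows False
proof -
  have two: "\<exists>P Q. P \<in> triangles_at A W x \<and> Q \<in> triangles_at A W x \<and> P \<noteq> Q" if two': "2 \<le> card (triangles_at A W x)" for x
  proof -
    obtain T where "T \<subseteq> triangles_at A W x" "card T = 2"
      by (rule obtain_subset_with_card_n[OF two'])
    then show ?thesis by (auto simp: card_2_iff)
  qed
  obtain P Q where P: "P \<in> triangles_at A W c" "Q \<in> triangles_at A W c" "P \<noteq> Q" using two[OF assms(7)] by blast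
  obtain R S where R: "R \<in> triangles_at A W d" "S \<in> triangles_at A W d" "R \<noteq> S" using two[OF assms(8)] by blast
  have cross: "anticomplete X Y" if "X \<in> triangles_at A W c" "Y \<in> triangles_at A W d" for X Y
  proof -
    have "X \<subseteq> W" "Y \<subseteq> W" "\<And>x. x \<in> X \<Longrightarrow> A x c" "\<And>y. y \<in> Y \<Longrightarrow> A y d"
      using that unfolding triangles_at_def by auto
    then show ?thesis unfolding anticomplete_def using assms(2,3) by blast
  qed
  have cR: "anticomplete {c} Y" if "Y \<in> triangles_at A W d" for Y
  proof -
    have "Y \<subseteq> W" "\<And>y. y \<in> Y \<Longrightarrow> A y d" using that unfolding triangles_at_def by auto
    then show ?thesis unfolding anticomplete_def using assms(2,5) A_sym by blast
  qed
  have dP: "anticomplete {d} Y" if "Y \<in> triangles_at A W c" for Y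
  proof -
    have "Y \<subseteq> W" "\<And>y. y \<in> Y \<Longrightarrow> A y c" using that unfolding triangles_at_def by auto
    then show ?thesis unfolding anticomplete_def using assms(2,6) A_sym by blast
  qed
  have up: "X \<in> triangles_at A V x" if "X \<in> triangles_at A W x" for X x
    using triangles_at_mono[OF assms(4)] that by blast
  show False
    by (rule no_G_P2[OF up[OF P(1)] up[OF P(2)] up[OF R(1)] up[OF R(2)] assms(1)])
      (use P R cross cR dP triangles_at_anticomplete in auto)
qed

text \<open>\<open>t\<close> is the demand for free ends, and at most one vertex \<open>k1\<close>
  asks for two. All paths meet at the origin: four vertices fill the four directions and keep one
  free end each, whereas with at most three \<open>k1\<close> runs straight through and keeps both
  its ends.\<close>

lemma clique_core_rep:
  assumes K: "clique K" "K \<noteq> {}"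
    and le2: "\<And>k. k \<in> K \<Longrightarrow> t k \<le> (2 :: nat)"
    and one: "\<And>k l. k \<in> K \<Longrightarrow> l \<in> K \<Longrightarrow> k \<noteq> l \<Longrightarrow> \<not> (t k = 2 \<and> t l = 2)"
    and K4: "\<And>k. card K = 4 \<Longrightarrow> k \<in> K \<Longrightarrow> t k \<le> 1"
  shows "\<exists>P. rep A K P \<and> (\<forall>k\<in>K. t k \<le> card (free_ends K P k))"
proof -
  have fin: "finite K" using clique_finite[OF K(1)] .
  obtain k1 where k1: "k1 \<in> K" "\<And>k. k \<in> K \<Longrightarrow> k \<noteq> k1 \<Longrightarrow> t k \<le> 1"
  proof (cases "\<exists>k\<in>K. t k = 2")
    case True
    then obtain k where k: "k \<in> K" "t k = 2" by blast
    have "t l \<le> 1" if "l \<in> K" "l \<noteq> k" for l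
      using le2[OF that(1)] one[OF that(1) k(1) that(2)] k(2) by linarith
    then show ?thesis using that[OF k(1)] by blast
  next
    case False
    have "t l \<le> 1" if "l \<in> K" for l
      using le2[OF that] False that by (metis le_SucE numeral_2_eq_2 One_nat_def)
    then show ?thesis using that K(2) by blast
  qed
  show ?thesis
  proof (cases "card K = 4")
    case True
    then have "card (K - {k1}) = 3" using k1(1) fin by simp
    then obtain k2 k3 k4 where k: "K - {k1} = {k2, k3, k4}" "k2 \<noteq> k3" "k2 \<noteq> k4" "k3 \<noteq> k4"
      by (auto simp: card_3_iff)
    have Keq: "K = {k1, k2, k3, k4}" and ne: "k1 \<noteq> k2" "k1 \<noteq> k3" "k1 \<noteq> k4" using k k1(1) by auto
    define P where "P v = (if v = k1 then Horizontal 0 (-1) 0 else if v = k2 then Horizontal 0 0 1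
      else if v = k3 then Vertical 0 0 1 else Vertical 0 (-1) 0)" for v
    have "rep A K P"
      unfolding rep_def using cliqueD[OF K(1)] unfolding Keq P_def using k(2-) ne by auto
    moreover have "t v \<le> card (free_ends K P v)" if v: "v \<in> K" for v
    proof -
      have "1 \<le> card (free_ends K P v)"
        by (rule free_ends_ge_1[of "if v = k1 then (-1, 0) else if v = k2 then (1, 0)
          else if v = k3 then (0, 1) else (0, -1)"])
          (use v k(2-) ne in \<open>auto simp: P_def Keq split: if_splits\<close>)
      then show ?thesis using K4[OF True v] by linarith
    qed
    ultimately show ?thesis by blast
  next
    case False
    then have "card (K - {k1}) \<le> 2" using clique_card[OF K(1)] k1(1) fin by simp
    then obtain k2 k3 where k: "K - {k1} \<subseteq> {k2, k3}"
      using card_le_2_subset[of "K - {k1}"] fin by blast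
    define P where "P v = (if v = k1 then Horizontal 0 (-1) 1 else if v = k2 then Vertical 0 0 1
      else Vertical 0 (-1) 0)" for v
    have P: "P k1 = Horizontal 0 (-1) 1" "k1 \<noteq> k2 \<Longrightarrow> P k2 = Vertical 0 0 1"
      "k1 \<noteq> k3 \<Longrightarrow> k2 \<noteq> k3 \<Longrightarrow> P k3 = Vertical 0 (-1) 0"
      by (auto simp: P_def)
    have K': "v = k1 \<or> v = k2 \<and> k1 \<noteq> k2 \<or> v = k3 \<and> k1 \<noteq> k3 \<and> k2 \<noteq> k3" if "v \<in> K" for v
      using that k by blast
    have "rep A K P"
      unfolding rep_def
    proof (intro conjI ballI impI)
      fix v assume "v \<in> K" then show "nondeg (P v)" by (auto simp: P_def)
    next
      fix u v assume uv: "u \<in> K" "v \<in> K" "u \<noteq> v"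
      show "noncross (P u) (P v)" "A u v \<longleftrightarrow> touch (P u) (P v)"
        using K'[OF uv(1)] K'[OF uv(2)] uv(3) cliqueD[OF K(1) uv] P by auto
    qed
    moreover have "t v \<le> card (free_ends K P v)" if v: "v \<in> K" for v
    proof (cases "v = k1")
      case True
      have "2 \<le> card (free_ends K P k1)"
        by (rule free_ends_ge_2[of "(-1, 0)" _ _ _ "(1, 0)"]) (auto simp: P_def)
      then show ?thesis using le2[OF v] True by simp
    next
      case False
      have "1 \<le> card (free_ends K P v)"
        by (rule free_ends_ge_1[of "if v = k2 then (0, 1) else (0, -1)"])
          (use K'[OF v] K' False P in \<open>auto simp: P_def split: if_splits\<close>)
      then show ?thesis using k1(2)[OF v False] by linarith
    qed
    ultimately show ?thesis by blast
  qed
qed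

definition closed_nbhd :: "'a set \<Rightarrow> 'a set" where
  "closed_nbhd K = K \<union> {v. \<exists>k\<in>K. A v k}"

lemma closed_nbhd_V: "K \<subseteq> V \<Longrightarrow> closed_nbhd K \<subseteq> V"
  unfolding closed_nbhd_def using A_V by blast

lemma no_hole_contact:
  assumes n4: "\<And>a b c d. \<not> hole4 a b c d" and n5: "\<And>a b c d e. \<not> hole5 a b c d e" and ne: "V \<noteq> {}"
  shows "contact_B0_VPG G"
proof -
  \<comment> \<open>A clique has at most four vertices, so with weight 5 the closed neighbourhood
    decides first and the size of the clique breaks ties.\<close>
  define m where "m K = 5 * card (closed_nbhd K) + card K" for K
  obtain v where v: "v \<in> V" using ne by blast
  have "m K < 5 * card V + card V + 1" if "clique K" for K
    using card_mono[OF finite_V closed_nbhd_V[of K]] card_mono[OF finite_V, of K] that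
    unfolding m_def clique_def by simp
  moreover have "clique {v}" using v by (simp add: clique_def)
  ultimately obtain K where K: "clique K" "\<And>K'. clique K' \<Longrightarrow> m K' \<le> m K"
    using ex_has_greatest_nat[of clique "{v}" m "5 * card V + card V + 1"] by blast
  have KV: "K \<subseteq> V" using K(1) by (simp add: clique_def)
  have fN: "finite (closed_nbhd X)" if "X \<subseteq> V" for X
    using closed_nbhd_V[OF that] finite_V finite_subset by blast
  have Kne: "K \<noteq> {}"
  proof
    assume "K = {}"
    moreover have "clique {v}" using v by (simp add: clique_def)
    moreover have "closed_nbhd {} = {}" unfolding closed_nbhd_def by simp
    ultimately show False using K(2)[of "{v}"] unfolding m_def by simp
  qed
  \<comment> \<open>Without diamonds, two neighbours in \<open>K\<close> make \<open>w\<close>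
    complete to \<open>K\<close>; then \<open>insert w K\<close> would beat
    \<open>K\<close>.\<close>
  have un: "k = l" if "w \<notin> K" "k \<in> K" "l \<in> K" "A w k" "A w l" for w k l
  proof (rule ccontr)
    assume kl: "k \<noteq> l"
    have "A w x" if "x \<in> K" for x
    proof (cases "x = k \<or> x = l")
      case False
      then show ?thesis
        using no_diamond[of k l w x] cliqueD[OF K(1)] \<open>w \<notin> K\<close> \<open>k \<in> K\<close> \<open>l \<in> K\<close> \<open>A w k\<close> \<open>A w l\<close> kl that A_sym by blast
    qed (use \<open>A w k\<close> \<open>A w l\<close> in auto)
    then have cl: "clique (insert w K)"
      using K(1) A_sym A_V(1)[OF that(4)] unfolding clique_def by blast
    have "closed_nbhd K \<subseteq> closed_nbhd (insert w K)" unfolding closed_nbhd_def by blast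
    then have "card (closed_nbhd K) \<le> card (closed_nbhd (insert w K))"
      using cl by (intro card_mono fN) (auto simp: clique_def)
    moreover have "card (insert w K) = card K + 1" using that(1) clique_finite[OF K(1)] by simp
    ultimately show False using K(2)[OF cl] unfolding m_def by linarith
  qed
  have same: "k = l" if "w \<notin> K" "w' \<notin> K" "A w w'" "k \<in> K" "l \<in> K" "A w k" "A w' l" for w w' k l
  proof (rule ccontr)
    assume kl: "k \<noteq> l"
    have "hole4 w k l w'"
      unfolding hole4_def using that kl cliqueD[OF K(1)] un A_sym by blast
    then show False using n4 by blast
  qed
  \<comment> \<open>A vertex \<open>s\<close> beyond the closed neighbourhood hangs at some
    \<open>u\<close> next to \<open>k\<close>. An outer vertex attached to another \<open>x\<close>
    in \<open>K\<close> would give a five-cycle or a P5 through \<open>s\<close>, \<open>u\<close>,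
    \<open>k\<close>, \<open>x\<close>. So \<open>{k, u}\<close> sees all of
    \<open>closed_nbhd K\<close> and \<open>s\<close> as well, against the choice of
    \<open>K\<close>.\<close>
  have V: "closed_nbhd K = V"
  proof (rule ccontr)
    assume neq: "closed_nbhd K \<noteq> V"
    have "closed_nbhd K \<noteq> {}" using Kne unfolding closed_nbhd_def by blast
    then obtain u s where us: "u \<in> closed_nbhd K" "s \<in> V" "s \<notin> closed_nbhd K" "A u s"
      using connected[OF closed_nbhd_V[OF KV] _ neq] by blast
    have uK: "u \<notin> K" using us A_sym unfolding closed_nbhd_def by blast
    then obtain k where k: "k \<in> K" "A u k" using us unfolding closed_nbhd_def by blast
    have sK: "\<not> A s x" "s \<notin> K" if "x \<in> K" for x using us(3) that unfolding closed_nbhd_def by blast+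
    have only: "x = k" if "w \<notin> K" "x \<in> K" "A w x" for w x
    proof (rule ccontr)
      assume xk: "x \<noteq> k"
      have kx: "A k x" using cliqueD[OF K(1) k(1) that(2)] xk by blast
      have n: "\<not> A u x" "\<not> A k w" "\<not> A u w"
        using un[OF uK k(1) that(2) k(2)] un[OF that(1,2) k(1) that(3)] same[OF uK that(1) _ k(1) that(2) k(2) that(3)]
          xk A_sym by blast+
      show False
      proof (cases "A s w")
        case True
        have "hole5 s u k x w"
          unfolding hole5_def using True us(4) k kx that n sK A_sym by blast
        then show False using n5 by blast
      next
        case False
        then show False
          using no_P5[of s u k x w] us(4) k kx that n sK A_sym by blast
      qed
    qed
    have cl: "clique {k, u}" using k A_sym A_V unfolding clique_def by blast
    have "closed_nbhd K \<subseteq> closed_nbhd {k, u}"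
    proof
      fix w assume "w \<in> closed_nbhd K"
      then show "w \<in> closed_nbhd {k, u}"
        using only[of w] cliqueD[OF K(1) _ k(1)] unfolding closed_nbhd_def by blast
    qed
    moreover have "s \<in> closed_nbhd {k, u}"
      using A_sym[OF us(4)] unfolding closed_nbhd_def by simp
    ultimately have "closed_nbhd K \<subset> closed_nbhd {k, u}"
      using us(3) by blast
    then have "card (closed_nbhd K) < card (closed_nbhd {k, u})"
      using cl by (intro psubset_card_mono fN) (auto simp: clique_def)
    then show False
      using K(2)[OF cl] clique_card[OF K(1)] unfolding m_def by linarith
  qed
  let ?t = "\<lambda>k. card (triangles_at A (V - K) k)"
  have t2: "?t k \<le> 2" for k
    using card_mono[OF finite_triangles_at triangles_at_mono[of "V - K" V], of k] card_triangles_at[of k] by auto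
  have "\<exists>P. rep A K P \<and> (\<forall>k\<in>K. ?t k \<le> card (free_ends K P k))"
  proof (rule clique_core_rep[OF K(1) Kne t2])
    fix k l assume kl: "k \<in> K" "l \<in> K" "k \<noteq> l"
    show "\<not> (?t k = 2 \<and> ?t l = 2)"
    proof
      assume "?t k = 2 \<and> ?t l = 2"
      then have t: "2 \<le> ?t k" "2 \<le> ?t l" by simp_all
      show False
        by (rule triangles_at_two_large[OF cliqueD[OF K(1) kl] _ _ _ _ _ t]) (use un same kl in blast)+
    qed
  next
    fix k assume k: "card K = 4" "k \<in> K"
    \<comment> \<open>The rest of \<open>K\<close> is itself one of the at most two triangles at
      \<open>k\<close>, and it is not pendant.\<close>
    have c3: "card (K - {k}) = 3" using k clique_finite[OF K(1)] by simp
    then have "K - {k} \<noteq> {}" by (metis card.empty zero_neq_numeral)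
    then have "K - {k} \<notin> triangles_at A (V - K) k" unfolding triangles_at_def by blast
    moreover have "K - {k} \<in> triangles_at A V k"
      unfolding triangles_at_def using c3 KV cliqueD[OF K(1)] k(2) by blast
    ultimately have "triangles_at A (V - K) k \<subset> triangles_at A V k"
      using triangles_at_mono[of "V - K" V k] by blast
    then have "?t k < card (triangles_at A V k)" by (rule psubset_card_mono[OF finite_triangles_at])
    then show "?t k \<le> 1" using card_triangles_at[of k] by linarith
  qed
  then obtain P where P: "rep A K P" "\<And>k. k \<in> K \<Longrightarrow> ?t k \<le> card (free_ends K P k)" by blast
  show ?thesis
  proof (rule pendant_rep[OF KV P(1) _ _ _ P(2)])
    show "\<exists>c\<in>K. A w c" if "w \<in> V - K" for w using that V unfolding closed_nbhd_def by blast
  qed (use un same in blast)+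
qed

end

section \<open>Induced five-cycles\<close>

text \<open>The bound is at least one even for empty \<open>S\<close>, so that rows drawn up to
  \<open>N\<close> are nondegenerate.\<close>

lemma ex_int_enumeration:
  assumes "finite S"
  shows "\<exists>(g :: 'a \<Rightarrow> int) N. (\<forall>x\<in>S. 1 \<le> g x \<and> g x \<le> N) \<and> inj_on g S \<and> 1 \<le> N"
proof -
  obtain f :: "'a \<Rightarrow> nat" and n where f: "f ` S = {i. i < n}" "inj_on f S"
    using finite_imp_inj_to_nat_seg[OF assms] by blast
  have "inj_on (\<lambda>x. int (f x) + 1) S"
    using f(2) by (auto simp: inj_on_def)
  moreover have "f x < n" if "x \<in> S" for x using f(1) that by blast
  ultimately show ?thesis
    by (intro exI[of _ "\<lambda>x. int (f x) + 1"] exI[of _ "int n + 1"]) fastforce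
qed

text \<open>The picture is a ladder: the row \<open>h\<close> at height 1 runs above the rows
  \<open>l\<close> and \<open>r\<close> at height 0, which abut at the origin. \<open>L\<close> and
  \<open>R\<close> are rungs to the left and right; the vertex of \<open>U\<close>, if any, is the
  rung at the origin, prolonged downwards to have a free end.\<close>

lemma hub_rep:
  assumes fin: "finite (L \<union> R)"
    and sym: "\<And>u v. A u v \<Longrightarrow> A v u"
    and hlr: "distinct [h, l, r]" "\<not> A h l" "\<not> A h r" "A l r"
    and L: "\<And>x. x \<in> L \<Longrightarrow> A x h \<and> A x l \<and> \<not> A x r \<and> x \<noteq> h \<and> x \<noteq> l \<and> x \<noteq> r \<and> x \<notin> R"
    and R: "\<And>x. x \<in> R \<Longrightarrow> A x h \<and> \<not> A x l \<and> A x r \<and> x \<noteq> h \<and> x \<noteq> l \<and> x \<noteq> r"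
    and LR: "\<And>x y. x \<in> L \<union> R \<Longrightarrow> y \<in> L \<union> R \<Longrightarrow> \<not> A x y"
    and U: "\<And>x. x \<in> U \<Longrightarrow> A x h \<and> A x l \<and> A x r \<and> x \<noteq> h \<and> x \<noteq> l \<and> x \<noteq> r \<and> x \<notin> L \<and> x \<notin> R"
    and U1: "\<And>x y. x \<in> U \<Longrightarrow> y \<in> U \<Longrightarrow> x = y"
    and ULR: "\<And>x y. x \<in> U \<Longrightarrow> y \<in> L \<union> R \<Longrightarrow> \<not> A x y"
  shows "\<exists>P. rep A ({h, l, r} \<union> L \<union> R \<union> U) P \<and>
    (\<forall>u\<in>U. 1 \<le> card (free_ends ({h, l, r} \<union> L \<union> R \<union> U) P u))"
proof -
  obtain g :: "'a \<Rightarrow> int" and N where g: "\<And>x. x \<in> L \<union> R \<Longrightarrow> 1 \<le> g x \<and> g x \<le> N" "inj_on g (L \<union> R)" "1 \<le> N"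
    using ex_int_enumeration[OF fin] by blast
  let ?C = "{h, l, r} \<union> L \<union> R \<union> U"
  define P where "P v = (if v = h then Horizontal 1 (- N) N else if v = l then Horizontal 0 (- N) 0
    else if v = r then Horizontal 0 0 N else if v \<in> U then Vertical 0 (-1) 1
    else if v \<in> L then Vertical (- g v) 0 1 else Vertical (g v) 0 1)" for v
  have P: "P h = Horizontal 1 (- N) N" "P l = Horizontal 0 (- N) 0" "P r = Horizontal 0 0 N"
    "\<And>v. v \<in> U \<Longrightarrow> P v = Vertical 0 (-1) 1"
    "\<And>v. v \<in> L \<Longrightarrow> P v = Vertical (- g v) 0 1" "\<And>v. v \<in> R \<Longrightarrow> P v = Vertical (g v) 0 1"
    using hlr(1) L R U by (auto simp: P_def)
  have g': "1 \<le> g x" "g x \<le> N" if "x \<in> L \<or> x \<in> R" for x using g(1)[of x] that by auto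
  have ginj: "g x \<noteq> g y" if "x \<in> L \<or> x \<in> R" "y \<in> L \<or> y \<in> R" "x \<noteq> y" for x y
    using g(2) that by (auto simp: inj_on_def)
  have comm: "A u v \<longleftrightarrow> A v u" for u v using sym by blast
  let ?ok = "\<lambda>u v. noncross (P u) (P v) \<and> (A u v \<longleftrightarrow> touch (P u) (P v))"
  have h: "?ok h v" if "v \<in> {l, r} \<union> L \<union> R \<union> U" for v
    using that(1) unfolding Un_iff insert_iff empty_iff
    by (elim disjE FalseE) (use hlr comm[of h v] g(3) L[of v] R[of v] U[of v] g'[of v] in \<open>simp_all add: P\<close>)
  have l: "?ok l v" if "v \<in> {r} \<union> L \<union> R \<union> U" for v
    using that(1) unfolding Un_iff insert_iff empty_iff
    by (elim disjE FalseE) (use hlr comm[of l v] g(3) L[of v] R[of v] U[of v] g'[of v] in \<open>simp_all add: P\<close>)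
  have r: "?ok r v" if "v \<in> L \<union> R \<union> U" for v
    using that(1) unfolding Un_iff
    by (elim disjE) (use hlr comm[of r v] g(3) L[of v] R[of v] U[of v] g'[of v] in \<open>simp_all add: P\<close>)
  have "rep A (L \<union> R) P"
    unfolding rep_def
  proof (intro conjI ballI impI)
    show "nondeg (P u)" if "u \<in> L \<union> R" for u using that by (auto simp: P)
    fix u v assume uv: "u \<in> L \<union> R" "v \<in> L \<union> R" "u \<noteq> v"
    have "?ok u v"
      using uv(1,2) LR[OF uv(1,2)] unfolding Un_iff
      by (elim disjE) (use uv(3) g'[of u] g'[of v] ginj[of u v] in \<open>simp_all add: P\<close>)
    then show "noncross (P u) (P v)" "A u v \<longleftrightarrow> touch (P u) (P v)" by blast+
  qed
  moreover have "rep A U P" by (rule rep_at_most_one) (use U1 in \<open>auto simp: P\<close>)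
  ultimately have s1: "rep A (L \<union> R \<union> U) P"
  proof (rule rep_Un[OF _ _ comm])
    show "?ok u v" if "u \<in> L \<union> R" "v \<in> U" for u v
      using that(1) ULR[OF that(2,1)] comm[of u v] unfolding Un_iff
      by (elim disjE) (use that(2) g'[of u] in \<open>simp_all add: P\<close>)
  qed
  have s2: "rep A ({r} \<union> L \<union> R \<union> U) P" using rep_insert[OF s1 _ comm r] g(3) by (simp add: P)
  have s3: "rep A ({l, r} \<union> L \<union> R \<union> U) P" using rep_insert[OF s2 _ comm l] g(3) by (simp add: P)
  have rep: "rep A ?C P" using rep_insert[OF s3 _ comm h] g(3) by (simp add: P)
  have "1 \<le> card (free_ends ?C P u)" if u: "u \<in> U" for u
  proof (rule free_ends_ge_1)
    show "(0, -1) \<in> path_ends (P u)" using P(4)[OF u] by simp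
    show "(0, -1) \<notin> path_points (P v)" if "v \<in> ?C" "v \<noteq> u" for v
      using that U1[OF u] by (auto simp: P)
  qed
  then show ?thesis using rep by blast
qed

section \<open>How vertices attach to a five-cycle\<close>

context connected_free_graph
begin

lemma hole5_rot: "hole5 a b c d e \<Longrightarrow> hole5 b c d e a"
  by (auto simp: hole5_def adj_commute[of G])

lemma hole5_reflect: "hole5 a b c d e \<Longrightarrow> hole5 a e d c b"
  by (auto simp: hole5_def adj_commute[of G])

text \<open>\<open>twin a b c d e\<close> contains \<open>a\<close> itself when \<open>a, b, c, d, e\<close> is a hole.\<close>

definition twin :: "'a \<Rightarrow> 'a \<Rightarrow> 'a \<Rightarrow> 'a \<Rightarrow> 'a \<Rightarrow> 'a set" where
  "twin a b c d e = {x. A x b \<and> A x e \<and> \<not> A x a \<and> \<not> A x c \<and> \<not> A x d}"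

text \<open>Such a vertex forms a triangle with the side \<open>cd\<close> opposite to
  \<open>a\<close>. Twins and triads are the only ways to attach to a five-cycle.\<close>

definition triad :: "'a \<Rightarrow> 'a \<Rightarrow> 'a \<Rightarrow> 'a \<Rightarrow> 'a \<Rightarrow> 'a set" where
  "triad a b c d e = {x. A x a \<and> A x c \<and> A x d \<and> \<not> A x b \<and> \<not> A x e}"

lemma twin_reflect: "twin a e d c b = twin a b c d e"
  by (auto simp: twin_def)

lemma triad_reflect: "triad a e d c b = triad a b c d e"
  by (auto simp: triad_def)

lemma twin_self: "hole5 a b c d e \<Longrightarrow> a \<in> twin a b c d e"
  by (auto simp: twin_def hole5_def adj_commute[of G])

lemmas hole_simps = hole5_def twin_def triad_def mem_Collect_eq adj_commute[of G]

text \<open>Without P5 no vertex sees a single corner or just two consecutive ones, and without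
  diamonds none sees three consecutive ones. What remains, up to rotation, is two corners at
  distance two, or a corner with its opposite side.\<close>

lemma hole5_nbr_class:
  assumes h: "hole5 a b c d e" and x: "A x a \<or> A x b \<or> A x c \<or> A x d \<or> A x e"
  shows "x \<in> twin a b c d e \<union> twin b c d e a \<union> twin c d e a b \<union> twin d e a b c \<union> twin e a b c d
    \<union> triad a b c d e \<union> triad b c d e a \<union> triad c d e a b \<union> triad d e a b c \<union> triad e a b c d"
proof -
  have three: "\<not> (A x a \<and> A x b \<and> A x c)" if h: "hole5 a b c d e" for a b c d e
  proof
    assume "A x a \<and> A x b \<and> A x c"
    then have "A a c"
      using no_diamond[of x b a c] h unfolding hole5_def by (metis A_irrefl A_sym)
    then show False using h unfolding hole5_def by blast
  qed
  have two: "\<not> (A x a \<and> A x b \<and> \<not> A x c \<and> \<not> A x d \<and> \<not> A x e)" if h: "hole5 a b c d e" for a b c d e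
    using no_P5[of x b c d e] h unfolding hole5_def by (metis A_sym)
  have single: "\<not> (A x a \<and> \<not> A x b \<and> \<not> A x c \<and> \<not> A x d \<and> \<not> A x e)" if h: "hole5 a b c d e" for a b c d e
    using no_P5[of x a b c d] h unfolding hole5_def by (metis A_sym)
  note r1 = hole5_rot[OF h]
  note r2 = hole5_rot[OF r1]
  note r3 = hole5_rot[OF r2]
  note r4 = hole5_rot[OF r3]
  show ?thesis
    using three[OF h] three[OF r1] three[OF r2] three[OF r3] three[OF r4]
      two[OF h] two[OF r1] two[OF r2] two[OF r3] two[OF r4]
      single[OF h] single[OF r1] single[OF r2] single[OF r3] single[OF r4] x
    unfolding twin_def triad_def Un_iff mem_Collect_eq by argo
qed

lemma twin_adjacent_classes:
  assumes h: "hole5 a b c d e" and x: "x \<in> twin a b c d e" and y: "y \<in> twin b c d e a"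
  shows "A x y"
proof (rule ccontr)
  assume n: "\<not> A x y"
  show False
    by (rule no_P5[of y c d e x]; use h x y n in \<open>simp add: hole_simps\<close>)
qed

text \<open>A second vertex in each of two consecutive classes would extend the cycle to
  \<open>K33_star\<close>, with \<open>d\<close> as subdividing vertex.\<close>

lemma twin_one_single:
  assumes h: "hole5 a b c d e" and x: "x \<in> twin a b c d e" and y: "y \<in> twin b c d e a"
  shows "x = a \<or> y = b"
proof (rule ccontr)
  assume n: "\<not> (x = a \<or> y = b)"
  have xy: "A x y" by (rule twin_adjacent_classes[OF h x y])
  show False
    by (rule no_K33_star[where a = c and b = a and c = x and x = e and y = b and z = y and w = d]; use h x y xy n in \<open>auto simp: hole_simps\<close>)
qed

lemma twin_nonadj_self:
  assumes h: "hole5 a b c d e" and x: "x \<in> twin a b c d e" and y: "y \<in> twin a b c d e"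
  shows "\<not> A x y"
proof
  assume "A x y"
  then have "A b e"
    using no_diamond[of x y b e] h x y unfolding hole5_def twin_def mem_Collect_eq
    by (metis A_irrefl A_sym)
  then show False using h A_sym unfolding hole5_def by blast
qed

text \<open>Adjacent twins of \<open>a\<close> and \<open>c\<close> would form \<open>G2\<close>
  with the cycle.\<close>

lemma twin_distance_2:
  assumes h: "hole5 a b c d e" and x: "x \<in> twin a b c d e" and y: "y \<in> twin c d e a b"
  shows "\<not> A x y"
proof
  assume xy: "A x y"
  have "x \<noteq> a" "y \<noteq> c" using x y xy by (auto simp: hole_simps)
  show False
    by (rule no_G2[where a = b and v = a and b = e and c = d and w = c and u = x and z = y]; use h x y xy in \<open>auto simp: hole_simps\<close>)
qed

text \<open>Both lie over the edge \<open>cd\<close>, hence are adjacent; then \<open>x\<close>,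
  \<open>y\<close>, \<open>a\<close>, \<open>c\<close> would be a diamond.\<close>

lemma triad_unique:
  assumes h: "hole5 a b c d e" and x: "x \<in> triad a b c d e" and y: "y \<in> triad a b c d e"
  shows "x = y"
proof (rule ccontr)
  assume n: "x \<noteq> y"
  have "A x y"
    using no_diamond[of c d x y] h x y n unfolding hole5_def triad_def mem_Collect_eq by (metis A_sym)
  then have "A a c"
    using no_diamond[of x y a c] h x y unfolding hole5_def triad_def mem_Collect_eq by (metis A_irrefl A_sym)
  then show False using h unfolding hole5_def by blast
qed

text \<open>Adjacent triads would give a diamond, nonadjacent ones \<open>G3\<close>.\<close>

lemma triad_distance_1:
  assumes h: "hole5 a b c d e" and x: "x \<in> triad a b c d e" and y: "y \<in> triad b c d e a"
  shows False
proof (cases "A x y")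
  case True
  then have "A y c"
    using no_diamond[of x d y c] h x y unfolding hole5_def triad_def mem_Collect_eq by (metis A_irrefl A_sym)
  then show False using y unfolding triad_def by blast
next
  case False
  show False
    by (rule no_G3[where a = b and v = c and b = d and c = e and w = a and u = y and z = x]; use h x y False in \<open>auto simp: hole_simps\<close>)
qed

text \<open>Adjacent triads would give a diamond, nonadjacent ones the complement of a
  six-cycle.\<close>

lemma triad_distance_2:
  assumes h: "hole5 a b c d e" and x: "x \<in> triad a b c d e" and y: "y \<in> triad c d e a b"
  shows False
proof (cases "A x y")
  case True
  then have "A x e"
    using no_diamond[of y a x e] h x y unfolding hole5_def triad_def mem_Collect_eq by (metis A_irrefl A_sym)
  then show False using x unfolding triad_def by blast
next
  case False
  show False
    by (rule no_co_C6[where a = x and x = e and b = c and y = a and c = d and z = y]; use h x y False in \<open>auto simp: hole_simps\<close>)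
qed

lemma triad_twin_opposite:
  assumes h: "hole5 a b c d e" and u: "u \<in> triad a b c d e" and x: "x \<in> twin a b c d e"
  shows "A u x"
proof (rule ccontr)
  assume n: "\<not> A u x"
  show False
    by (rule no_P5[of u d e x b]; use h x u n in \<open>simp add: hole_simps\<close>)
qed

text \<open>With \<open>a\<close> and two further twins there would be three vertices complete to
  \<open>b\<close>, \<open>e\<close> and \<open>u\<close>, which is K33.\<close>

lemma triad_twin_opposite_le_2:
  assumes h: "hole5 a b c d e" and u: "u \<in> triad a b c d e"
    and x: "x \<in> twin a b c d e" and y: "y \<in> twin a b c d e" and n: "x \<noteq> a" "y \<noteq> a"
  shows "x = y"
proof (rule ccontr)
  assume xy: "x \<noteq> y"
  show False
    by (rule no_K33[where a = a and b = x and c = y and x = b and y = e and z = u];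
        use h x y n xy u twin_nonadj_self[OF h x y] triad_twin_opposite[OF h u x] triad_twin_opposite[OF h u y]
        in \<open>auto simp: hole_simps\<close>)
qed

lemma triad_twin_nonadj:
  assumes h: "hole5 a b c d e" and u: "u \<in> triad a b c d e" and x: "x \<in> twin b c d e a"
  shows "\<not> A u x"
proof
  assume "A u x"
  then have "A x d"
    using no_diamond[of u c x d] h x u unfolding hole5_def triad_def twin_def mem_Collect_eq by (metis A_irrefl A_sym)
  then show False using x unfolding twin_def by blast
qed

text \<open>In the hole with \<open>x\<close> in place of \<open>c\<close>, the vertex
  \<open>c\<close> is a twin of \<open>x\<close> and \<open>u\<close> is a twin of \<open>e\<close>.
  Twins at distance two are nonadjacent, but \<open>u\<close> is adjacent to
  \<open>c\<close>.\<close>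

lemma triad_twin_single:
  assumes h: "hole5 a b c d e" and u: "u \<in> triad a b c d e" and x: "x \<in> twin c d e a b"
  shows "x = c"
proof (rule ccontr)
  assume n: "x \<noteq> c"
  have ux: "\<not> A u x"
  proof
    assume "A u x"
    then have "A x c"
      using no_diamond[of u d x c] h x u n unfolding hole5_def triad_def twin_def mem_Collect_eq by (metis A_sym)
    then show False using x unfolding twin_def by blast
  qed
  have h': "hole5 x d e a b" using h x by (simp add: hole_simps)
  have "c \<in> twin x d e a b" using h x by (simp add: hole_simps)
  moreover have "u \<in> twin e a b x d" using h u x ux by (simp add: hole_simps)
  ultimately show False using twin_distance_2[OF h'] u A_sym unfolding triad_def by blast
qed

lemma twin_no_far_nbr:
  assumes h: "hole5 a b c d e" and x: "x \<in> twin a b c d e" and s: "\<not> A s b" "\<not> A s c" "\<not> A s d"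
  shows "\<not> A s x"
proof
  assume sx: "A s x"
  show False
    by (rule no_P5[of s x b c d]; use h x s sx in \<open>simp add: hole_simps\<close>)
qed

end

section \<open>Representing a graph with an induced five-cycle\<close>

context connected_free_graph
begin

lemma hole5_twins_V: "twin a b c d e \<subseteq> V"
  unfolding twin_def using A_V by blast

text \<open>In the ladder \<open>a\<close> is the upper row and \<open>d\<close>, \<open>c\<close>
  are the lower rows; twins of \<open>e\<close> and of \<open>b\<close> are the outer rungs and the
  triad is the middle one.\<close>

lemma hub_core:
  assumes h: "hole5 a b c d e" and c: "twin c d e a b = {c}" and d: "twin d e a b c = {d}"
  shows "\<exists>P. rep A ({a, c, d} \<union> twin b c d e a \<union> twin e a b c d \<union> triad a b c d e) P \<and>
    (\<forall>u\<in>triad a b c d e. 1 \<le> card (free_ends ({a, c, d} \<union> twin b c d e a \<union> twin e a b c d \<union> triad a b c d e) P u))"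
proof -
  let ?L = "twin e a b c d" and ?R = "twin b c d e a" and ?U = "triad a b c d e"
  note r1 = hole5_rot[OF h]
  note r4 = hole5_rot[OF hole5_rot[OF hole5_rot[OF r1]]]
  have eq: "{a, d, c} \<union> ?L \<union> ?R \<union> ?U = {a, c, d} \<union> ?R \<union> ?L \<union> ?U" by blast
  have "\<exists>P. rep A ({a, d, c} \<union> ?L \<union> ?R \<union> ?U) P \<and>
    (\<forall>u\<in>?U. 1 \<le> card (free_ends ({a, d, c} \<union> ?L \<union> ?R \<union> ?U) P u))"
  proof (rule hub_rep)
    show "finite (?L \<union> ?R)" using hole5_twins_V finite_V by (meson finite_Un finite_subset)
    show "A v u" if "A u v" for u v using A_sym[OF that] .
    show "distinct [a, d, c]" "\<not> A a d" "\<not> A a c" "A d c"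
      using h by (auto simp: hole5_def adj_commute[of G])
    show "A x a \<and> A x d \<and> \<not> A x c \<and> x \<noteq> a \<and> x \<noteq> d \<and> x \<noteq> c \<and> x \<notin> ?R" if "x \<in> ?L" for x
      using that h by (auto simp: hole_simps)
    show "A x a \<and> \<not> A x d \<and> A x c \<and> x \<noteq> a \<and> x \<noteq> d \<and> x \<noteq> c" if "x \<in> ?R" for x
      using that h by (auto simp: hole_simps)
    show "\<not> A x y" if "x \<in> ?L \<union> ?R" "y \<in> ?L \<union> ?R" for x y
      using that twin_nonadj_self[OF r4, of x y] twin_nonadj_self[OF r1, of x y]
        twin_distance_2[OF r4, of x y] twin_distance_2[OF r4, of y x] A_sym by blast
    show "A x a \<and> A x d \<and> A x c \<and> x \<noteq> a \<and> x \<noteq> d \<and> x \<noteq> c \<and> x \<notin> ?L \<and> x \<notin> ?R" if "x \<in> ?U" for x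
      using that h by (auto simp: hole_simps)
    show "x = y" if "x \<in> ?U" "y \<in> ?U" for x y
      using triad_unique[OF h that] .
    show "\<not> A x y" if "x \<in> ?U" "y \<in> ?L \<union> ?R" for x y
      using that triad_twin_nonadj[OF h that(1), of y]
        triad_twin_nonadj[OF hole5_reflect[OF h], of x y] twin_reflect[of e d c b a] triad_reflect[of a e d c b]
      by (auto simp: twin_reflect triad_reflect)
  qed
  then show ?thesis unfolding eq .
qed

lemma reach_all:
  assumes D: "D \<subseteq> V" "D \<noteq> {}" and no: "\<And>u v. u \<in> D \<Longrightarrow> v \<in> V - D \<Longrightarrow> \<not> A u v"
  shows "D = V"
  using connected[OF D] no by blast

text \<open>Of two consecutive classes one is a singleton, so some class and the two opposite to it
  are singletons. After a rotation this is the situation drawn by the ladder, and no vertex lies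
  outside the twin classes.\<close>

lemma hole5_no_triad_contact:
  assumes h: "hole5 a b c d e"
    and no: "triad a b c d e = {}" "triad b c d e a = {}" "triad c d e a b = {}" "triad d e a b c = {}" "triad e a b c d = {}"
  shows "contact_B0_VPG G"
proof -
  note r1 = hole5_rot[OF h]
  note r2 = hole5_rot[OF r1]
  note r3 = hole5_rot[OF r2]
  note r4 = hole5_rot[OF r3]
  let ?T = "twin a b c d e \<union> twin b c d e a \<union> twin c d e a b \<union> twin d e a b c \<union> twin e a b c d"
  have V: "?T = V"
  proof (rule reach_all)
    show "?T \<subseteq> V" using hole5_twins_V by blast
    show "?T \<noteq> {}" using twin_self[OF h] by blast
    fix u s assume u: "u \<in> ?T" and s: "s \<in> V - ?T"
    have "\<not> (A s a \<or> A s b \<or> A s c \<or> A s d \<or> A s e)"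
      using hole5_nbr_class[OF h, of s] no s by auto
    then show "\<not> A u s"
      using u twin_no_far_nbr[OF h, of u s] twin_no_far_nbr[OF r1, of u s] twin_no_far_nbr[OF r2, of u s]
        twin_no_far_nbr[OF r3, of u s] twin_no_far_nbr[OF r4, of u s] A_sym by blast
  qed
  have fin: "contact_B0_VPG G" if H: "hole5 a b c d e" "twin a b c d e = {a}" "twin c d e a b = {c}" "twin d e a b c = {d}"
    "twin a b c d e \<union> twin b c d e a \<union> twin c d e a b \<union> twin d e a b c \<union> twin e a b c d = V" for a b c d e
  proof -
    obtain P where "rep A ({a, c, d} \<union> twin b c d e a \<union> twin e a b c d \<union> triad a b c d e) P"
      using hub_core[OF H(1,3,4)] by blast
    then have "rep A V P"
      by (rule rep_subset) (use H(2-5) in blast)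
    then show ?thesis unfolding contact_B0_VPG_def contact_rep_iff by blast
  qed
  have single: "twin a b c d e = {a} \<or> twin b c d e a = {b}" if "hole5 a b c d e" for a b c d e
    using twin_one_single[OF that] twin_self[OF that] twin_self[OF hole5_rot[OF that]] by blast
  have "twin a b c d e = {a} \<and> twin c d e a b = {c} \<and> twin d e a b c = {d} \<or>
    twin b c d e a = {b} \<and> twin d e a b c = {d} \<and> twin e a b c d = {e} \<or>
    twin c d e a b = {c} \<and> twin e a b c d = {e} \<and> twin a b c d e = {a} \<or>
    twin d e a b c = {d} \<and> twin a b c d e = {a} \<and> twin b c d e a = {b} \<or>
    twin e a b c d = {e} \<and> twin b c d e a = {b} \<and> twin c d e a b = {c}"
    using single[OF h] single[OF r1] single[OF r2] single[OF r3] single[OF r4] by argo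
  moreover have W: "twin b c d e a \<union> twin c d e a b \<union> twin d e a b c \<union> twin e a b c d \<union> twin a b c d e = V"
    "twin c d e a b \<union> twin d e a b c \<union> twin e a b c d \<union> twin a b c d e \<union> twin b c d e a = V"
    "twin d e a b c \<union> twin e a b c d \<union> twin a b c d e \<union> twin b c d e a \<union> twin c d e a b = V"
    "twin e a b c d \<union> twin a b c d e \<union> twin b c d e a \<union> twin c d e a b \<union> twin d e a b c = V"
    using V by (simp_all only: Un_ac)
  ultimately show ?thesis
    using fin[OF h _ _ _ V] fin[OF r1 _ _ _ W(1)] fin[OF r2 _ _ _ W(2)] fin[OF r3 _ _ _ W(3)] fin[OF r4 _ _ _ W(4)]
    by argo
qed

text \<open>The triad \<open>u\<close> is the only one, and the vertices that see no corner hang at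
  \<open>u\<close> alone. If \<open>a\<close> has no further twin, the ladder leaves
  \<open>u\<close> a free end, and two triangles at \<open>u\<close> would be \<open>G1\<close>.
  Otherwise \<open>u\<close> is drawn without free ends, but then a single triangle at
  \<open>u\<close> would already be \<open>G4\<close>.\<close>

lemma hole5_triad_contact:
  assumes h: "hole5 a b c d e" and u: "u \<in> triad a b c d e"
  shows "contact_B0_VPG G"
proof -
  note r1 = hole5_rot[OF h]
  note r2 = hole5_rot[OF r1]
  note r3 = hole5_rot[OF r2]
  note r4 = hole5_rot[OF r3]
  note f = hole5_reflect[OF h]
  have uf: "u \<in> triad a e d c b" using u by (simp add: triad_reflect)
  have c: "twin c d e a b = {c}"
    using triad_twin_single[OF h u] twin_self[OF r2] by blast
  have d: "twin d e a b c = {d}"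
    using triad_twin_single[OF f uf] twin_self[OF r3] twin_reflect[of d e a b c] by auto
  have U: "triad a b c d e = {u}" using triad_unique[OF h _ u] u by blast
  have no: "triad b c d e a = {}" "triad c d e a b = {}" "triad d e a b c = {}" "triad e a b c d = {}"
    using triad_distance_1[OF h u] triad_distance_2[OF h u] triad_distance_1[OF f uf] triad_distance_2[OF f uf]
    by (auto simp: triad_reflect)
  define S where "S = {s \<in> V. \<not> A s a \<and> \<not> A s b \<and> \<not> A s c \<and> \<not> A s d \<and> \<not> A s e}"
  let ?T = "twin a b c d e \<union> twin b c d e a \<union> {c, d} \<union> twin e a b c d"
  have far: "\<not> A s x" if "s \<in> S" "x \<in> ?T" for s x
  proof -
    have "c \<in> twin c d e a b" "d \<in> twin d e a b c" using c d by auto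
    then show ?thesis
      using that twin_no_far_nbr[OF h, of x s] twin_no_far_nbr[OF r1, of x s] twin_no_far_nbr[OF r2, of x s]
        twin_no_far_nbr[OF r3, of x s] twin_no_far_nbr[OF r4, of x s] unfolding S_def by blast
  qed
  have cls: "x \<in> ?T \<union> {u} \<union> S" if "x \<in> V" for x
    using that hole5_nbr_class[OF h, of x] no U c d unfolding S_def by blast
  have TV: "?T \<subseteq> V" using hole5_twins_V c d by blast
  have uV: "u \<in> V" using u A_V unfolding triad_def by blast
  have uS: "u \<notin> S" using u unfolding triad_def S_def by blast
  have notT: "x \<notin> S" if "x \<in> ?T" for x
  proof
    assume "x \<in> S"
    then show False using that h unfolding S_def by (auto simp: hole_simps)
  qed
  have all: "?T \<union> {u} \<union> {s \<in> S. A s u} = V"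
  proof (rule reach_all)
    show "?T \<union> {u} \<union> {s \<in> S. A s u} \<subseteq> V" using TV uV unfolding S_def by blast
    show "?T \<union> {u} \<union> {s \<in> S. A s u} \<noteq> {}" by blast
    fix x s assume x: "x \<in> ?T \<union> {u} \<union> {s \<in> S. A s u}" and s: "s \<in> V - (?T \<union> {u} \<union> {s \<in> S. A s u})"
    have s': "s \<in> S" "\<not> A s u" using cls[of s] s by blast+
    show "\<not> A x s"
    proof
      assume xs: "A x s"
      then have "x \<noteq> u" "x \<notin> ?T" using s' far A_sym by blast+
      then have x': "x \<in> S" "A x u" using x by blast+
      show False
        by (rule no_P5[of s x u a b]; use s' x' xs u h in \<open>simp add: hole_simps S_def\<close>)
    qed
  qed
  have SV: "S \<subseteq> V" unfolding S_def by blast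
  have V: "?T \<union> {u} \<union> S = V" using all SV by blast
  have Su: "A s u" if "s \<in> S" for s using all SV that notT uS by blast
  have onlyu: "x = u" if "s \<in> S" "x \<in> ?T \<union> {u}" "A s x" for s x
    using far[of s x] that by blast
  have antiS: "anticomplete X Q" if "Q \<in> triangles_at A S u" "X \<subseteq> ?T" for X Q
    unfolding anticomplete_def
  proof (intro ballI)
    fix x y assume "x \<in> X" "y \<in> Q"
    then have "y \<in> S" "x \<in> ?T" using that unfolding triangles_at_def by blast+
    then show "x \<noteq> y \<and> \<not> A x y" using far notT A_sym by blast
  qed
  have trie: "triangles_at A S x = {}" if "x \<in> ?T" for x
  proof -
    have "\<not> A s x" if "s \<in> S" for s using far[OF that \<open>x \<in> ?T\<close>] .
    moreover have "Q \<noteq> {}" if "card Q = 3" for Q :: "'a set" using that by auto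
    ultimately show ?thesis unfolding triangles_at_def by blast
  qed
  have five: "{a, b, c, d, e} \<subseteq> ?T"
    using twin_self[OF h] twin_self[OF r1] twin_self[OF r4] by blast
  have hb: "A a b" "A b c" "A c d" "A d e" "A e a" "A u a" "A u c" "A u d"
    "\<not> A a c" "\<not> A a d" "\<not> A b d" "\<not> A b e" "\<not> A c e" "\<not> A u b" "\<not> A u e"
    using h u by (auto simp: hole_simps)
  have finish: "contact_B0_VPG G"
    if CT: "C = ?T \<union> {u}" and P: "rep A C P" and tu: "card (triangles_at A S u) \<le> card (free_ends C P u)" for C P
  proof -
    have CV: "C \<subseteq> V" unfolding CT using V by blast
    have VC: "V - C = S" unfolding CT using V uS notT by blast
    show ?thesis
    proof (rule pendant_rep[OF CV P], unfold VC)
      show "\<exists>x\<in>C. A s x" if "s \<in> S" for s using Su[OF that] unfolding CT by blast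
      show "x = y" if "s \<in> S" "x \<in> C" "y \<in> C" "A s x" "A s y" for s x y
        using onlyu[OF that(1) _ that(4)] onlyu[OF that(1) _ that(5)] that(2,3) unfolding CT by blast
      show "x = y" if "s \<in> S" "s' \<in> S" "A s s'" "x \<in> C" "y \<in> C" "A s x" "A s' y" for s s' x y
        using onlyu[OF that(1) _ that(6)] onlyu[OF that(2) _ that(7)] that(4,5) unfolding CT by blast
      show "card (triangles_at A S x) \<le> card (free_ends C P x)" if "x \<in> C" for x
        using tu trie[of x] that unfolding CT by (cases "x = u") simp_all
    qed
  qed
  show ?thesis
  proof (cases "twin a b c d e = {a}")
    case True
    let ?C = "{a, c, d} \<union> twin b c d e a \<union> twin e a b c d \<union> triad a b c d e"
    have CT: "?C = ?T \<union> {u}" using True U by blast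
    obtain P where P: "rep A ?C P" "\<And>x. x \<in> triad a b c d e \<Longrightarrow> 1 \<le> card (free_ends ?C P x)"
      using hub_core[OF h c d] by blast
    have "card (triangles_at A S u) \<le> 1"
    proof (rule ccontr)
      assume "\<not> card (triangles_at A S u) \<le> 1"
      then have "2 \<le> card (triangles_at A S u)" by simp
      then obtain T where "T \<subseteq> triangles_at A S u" "card T = 2" by (rule obtain_subset_with_card_n)
      then obtain Q R where QR: "Q \<in> triangles_at A S u" "R \<in> triangles_at A S u" "Q \<noteq> R"
        by (auto simp: card_2_iff)
      have QR': "Q \<in> triangles_at A V u" "R \<in> triangles_at A V u"
        using QR triangles_at_mono[OF SV] by blast+
      show False
        by (rule no_G1[OF hb QR' triangles_at_anticomplete[OF QR] antiS[OF QR(1) five] antiS[OF QR(2) five]])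
    qed
    then show ?thesis using finish[OF CT P(1)] P(2)[OF u] by simp
  next
    case False
    then obtain z where z: "z \<in> twin a b c d e" "z \<noteq> a" using twin_self[OF h] by blast
    have a2: "twin a b c d e = {a, z}"
      using triad_twin_opposite_le_2[OF h u _ z(1) _ z(2)] z twin_self[OF h] by blast
    have b1: "twin b c d e a = {b}"
      using twin_one_single[OF h z(1)] z(2) twin_self[OF r1] by blast
    have e1: "twin e a b c d = {e}"
      using twin_one_single[OF r4 _ z(1)] z(2) twin_self[OF r4] by blast
    let ?C = "{a, b, c, d, e, z, u}"
    have CT: "?C = ?T \<union> {u}" unfolding a2 b1 e1 by blast
    have uz: "A z u" using triad_twin_opposite[OF h u z(1)] A_sym by blast
    have zb: "A z b" "A z e" "\<not> A z a" "\<not> A z c" "\<not> A z d" using z(1) unfolding twin_def by auto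
    have dist: "distinct [a, b, c, d, e, u, z]"
      using hb zb uz z(2) A_sym by auto
    \<comment> \<open>The columns \<open>a\<close> and \<open>z\<close> and the rows
      \<open>b\<close> and \<open>e\<close> bound a square. The row \<open>u\<close> halves it, and
      \<open>c\<close>, \<open>d\<close> abut on \<open>u\<close> at the origin, linking it to
      \<open>b\<close> and \<open>e\<close>.\<close>
    define P where "P v = (if v = a then Vertical (-1) (-1) 1 else if v = z then Vertical 1 (-1) 1
      else if v = u then Horizontal 0 (-1) 1 else if v = b then Horizontal 1 (-1) 1
      else if v = e then Horizontal (-1) (-1) 1 else if v = c then Vertical 0 0 1 else Vertical 0 (-1) 0)" for v
    have Pv: "P a = Vertical (-1) (-1) 1" "P z = Vertical 1 (-1) 1" "P u = Horizontal 0 (-1) 1"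
      "P b = Horizontal 1 (-1) 1" "P e = Horizontal (-1) (-1) 1" "P c = Vertical 0 0 1" "P d = Vertical 0 (-1) 0"
      using dist by (auto simp: P_def)
    have P: "rep A ?C P"
      unfolding rep_def
      using hb zb uz dist by (simp add: Pv adj_commute[of G] eq_commute)
    have "triangles_at A S u = {}"
    proof (rule ccontr)
      assume "triangles_at A S u \<noteq> {}"
      then obtain Q where Q: "Q \<in> triangles_at A S u" by blast
      have "{a, b, c, d, e, z} \<subseteq> ?T" using five z(1) by blast
      then show False
        using no_G4[OF hb(1-8) zb(1,2) uz hb(9-15) zb(3-5) dist _ antiS[OF Q]] triangles_at_mono[OF SV] Q by blast
    qed
    then show ?thesis using finish[OF CT P] by simp
  qed
qed

lemma hole5_contact:
  assumes h: "hole5 a b c d e"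
  shows "contact_B0_VPG G"
proof -
  note r1 = hole5_rot[OF h]
  note r2 = hole5_rot[OF r1]
  note r3 = hole5_rot[OF r2]
  note r4 = hole5_rot[OF r3]
  show ?thesis
    using hole5_no_triad_contact[OF h] hole5_triad_contact[OF h] hole5_triad_contact[OF r1] hole5_triad_contact[OF r2]
      hole5_triad_contact[OF r3] hole5_triad_contact[OF r4] by blast
qed

end

section \<open>Induced four-cycles\<close>

text \<open>\<open>a\<close> and \<open>b\<close> are rows, \<open>x\<close> and \<open>w\<close>
  columns; \<open>Y\<close> adds columns between the two rows and \<open>Z\<close> short rows
  between the two columns. \<open>E1\<close> and \<open>E2\<close> are the arms pointing outward
  from the corner of \<open>a\<close> and \<open>x\<close>. Prolonging \<open>a\<close> and
  \<open>x\<close> to \<open>N + 2\<close> gives each a free end beyond the grid.\<close>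

lemma square_rep:
  assumes fin: "finite (Y \<union> Z)"
    and sym: "\<And>u v. A u v \<Longrightarrow> A v u"
    and sq: "distinct [a, x, b, w]" "A a x" "A x b" "A b w" "A w a" "\<not> A a b" "\<not> A x w"
    and Y: "\<And>y. y \<in> Y \<Longrightarrow> A y a \<and> A y b \<and> \<not> A y x \<and> \<not> A y w \<and> y \<noteq> a \<and> y \<noteq> b \<and> y \<noteq> x \<and> y \<noteq> w"
    and Z: "\<And>z. z \<in> Z \<Longrightarrow> A z x \<and> A z w \<and> \<not> A z a \<and> \<not> A z b \<and> z \<noteq> a \<and> z \<noteq> b \<and> z \<noteq> x \<and> z \<noteq> w \<and> z \<notin> Y"
    and YZ: "\<And>y z. y \<in> Y \<union> Z \<Longrightarrow> z \<in> Y \<union> Z \<Longrightarrow> \<not> A y z"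
    and E: "\<And>e. e \<in> E1 \<union> E2 \<Longrightarrow> A e a \<and> A e x \<and> \<not> A e b \<and> \<not> A e w \<and> e \<noteq> a \<and> e \<noteq> b \<and> e \<noteq> x \<and> e \<noteq> w \<and> e \<notin> Y \<and> e \<notin> Z"
    and EYZ: "\<And>e y. e \<in> E1 \<union> E2 \<Longrightarrow> y \<in> Y \<union> Z \<Longrightarrow> \<not> A e y"
    and E12: "\<And>e f. e \<in> E1 \<Longrightarrow> f \<in> E2 \<Longrightarrow> e \<noteq> f \<and> A e f"
    and E1: "\<And>e f. e \<in> E1 \<Longrightarrow> f \<in> E1 \<Longrightarrow> e = f" and E2: "\<And>e f. e \<in> E2 \<Longrightarrow> f \<in> E2 \<Longrightarrow> e = f"
  defines "C \<equiv> {a, x, b, w} \<union> Y \<union> Z \<union> E1 \<union> E2"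
  shows "\<exists>P. rep A C P \<and> 1 \<le> card (free_ends C P x) \<and> 1 \<le> card (free_ends C P a) \<and>
    (E2 = {} \<longrightarrow> 2 \<le> card (free_ends C P a))"
proof -
  obtain g :: "'a \<Rightarrow> int" and N where g: "\<And>y. y \<in> Y \<union> Z \<Longrightarrow> 1 \<le> g y \<and> g y \<le> N" "inj_on g (Y \<union> Z)" "1 \<le> N"
    using ex_int_enumeration[OF fin] by blast
  \<comment> \<open>Without \<open>E2\<close> the row \<open>a\<close> itself takes the left arm at
    the corner, and its left end is a second free end.\<close>
  define s :: int where "s = (if E2 = {} then - 1 else 0)"
  have s: "s \<le> 0" "- 1 \<le> s" "E2 \<noteq> {} \<Longrightarrow> s = 0" by (auto simp: s_def)
  define P where "P v = (if v = a then Horizontal 0 s (N + 2) else if v = x then Vertical 0 0 (N + 2)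
    else if v = b then Horizontal (N + 1) 0 (N + 1) else if v = w then Vertical 1 0 (N + 1)
    else if v \<in> Y then Vertical (1 + g v) 0 (N + 1) else if v \<in> Z then Horizontal (g v) 0 1
    else if v \<in> E1 then Vertical 0 (- 1) 0 else Horizontal 0 (- 1) 0)" for v
  have dis: "v \<notin> E1" if "v \<in> E2" for v using E12[of v v] that by blast
  have P: "P a = Horizontal 0 s (N + 2)" "P x = Vertical 0 0 (N + 2)" "P b = Horizontal (N + 1) 0 (N + 1)"
    "P w = Vertical 1 0 (N + 1)" "\<And>v. v \<in> Y \<Longrightarrow> P v = Vertical (1 + g v) 0 (N + 1)"
    "\<And>v. v \<in> Z \<Longrightarrow> P v = Horizontal (g v) 0 1" "\<And>v. v \<in> E1 \<Longrightarrow> P v = Vertical 0 (- 1) 0"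
    "\<And>v. v \<in> E2 \<Longrightarrow> P v = Horizontal 0 (- 1) 0"
    using sq(1) Y Z E dis by (auto simp: P_def)
  have g': "1 \<le> g y" "g y \<le> N" if "y \<in> Y \<or> y \<in> Z" for y using g(1)[of y] that by auto
  have ginj: "g y \<noteq> g z" if "y \<in> Y \<or> y \<in> Z" "z \<in> Y \<or> z \<in> Z" "y \<noteq> z" for y z
    using g(2) that by (auto simp: inj_on_def)
  have comm: "A u v \<longleftrightarrow> A v u" for u v using sym by blast
  let ?ok = "\<lambda>u v. noncross (P u) (P v) \<and> (A u v \<longleftrightarrow> touch (P u) (P v))"
  have a: "?ok a v" if "v \<in> {x, b, w} \<union> Y \<union> Z \<union> E1 \<union> E2" for v
    using that(1) unfolding Un_iff insert_iff empty_iff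
    by (elim disjE FalseE; use sq comm[of a v] g(3) Y[of v] Z[of v] E[of v] g'[of v] s in \<open>force simp: P\<close>)
  have x: "?ok x v" if "v \<in> {b, w} \<union> Y \<union> Z \<union> E1 \<union> E2" for v
    using that(1) unfolding Un_iff insert_iff empty_iff
    by (elim disjE FalseE; use sq comm[of x v] g(3) Y[of v] Z[of v] E[of v] g'[of v] in \<open>force simp: P\<close>)
  have b: "?ok b v" if "v \<in> {w} \<union> Y \<union> Z \<union> E1 \<union> E2" for v
    using that(1) unfolding Un_iff insert_iff empty_iff
    by (elim disjE FalseE; use sq comm[of b v] g(3) Y[of v] Z[of v] E[of v] g'[of v] in \<open>force simp: P\<close>)
  have w: "?ok w v" if "v \<in> Y \<union> Z \<union> E1 \<union> E2" for v
    using that(1) unfolding Un_iff insert_iff empty_iff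
    by (elim disjE FalseE; use sq comm[of w v] g(3) Y[of v] Z[of v] E[of v] g'[of v] in \<open>force simp: P\<close>)
  have "rep A (Y \<union> Z) P"
    unfolding rep_def
  proof (intro conjI ballI impI)
    show "nondeg (P u)" if "u \<in> Y \<union> Z" for u using that g(3) by (auto simp: P)
    fix u v assume uv: "u \<in> Y \<union> Z" "v \<in> Y \<union> Z" "u \<noteq> v"
    have "?ok u v"
      using uv(1,2) YZ[OF uv(1,2)] unfolding Un_iff
      by (elim disjE; use uv(3) g'[of u] g'[of v] ginj[of u v] in \<open>force simp: P\<close>)
    then show "noncross (P u) (P v)" "A u v \<longleftrightarrow> touch (P u) (P v)" by blast+
  qed
  moreover have "rep A (E1 \<union> E2) P"
  proof (rule rep_Un[OF _ _ comm])
    show "rep A E1 P" "rep A E2 P" by (rule rep_at_most_one; use E1 E2 in \<open>auto simp: P\<close>)+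
    show "?ok u v" if "u \<in> E1" "v \<in> E2" for u v
      using that E12[OF that] by (simp add: P)
  qed
  ultimately have "rep A ((Y \<union> Z) \<union> (E1 \<union> E2)) P"
  proof (rule rep_Un[OF _ _ comm])
    show "?ok u v" if "u \<in> Y \<union> Z" "v \<in> E1 \<union> E2" for u v
      using that EYZ[OF that(2,1)] comm[of u v] unfolding Un_iff
      by (elim disjE; use g'[of u] in \<open>force simp: P\<close>)
  qed
  then have s1: "rep A (Y \<union> Z \<union> E1 \<union> E2) P" by (simp only: Un_ac)
  have s2: "rep A ({w} \<union> Y \<union> Z \<union> E1 \<union> E2) P" using rep_insert[OF s1 _ comm w] g(3) by (simp add: P)
  have s3: "rep A ({b, w} \<union> Y \<union> Z \<union> E1 \<union> E2) P" using rep_insert[OF s2 _ comm b] g(3) by (simp add: P)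
  have s4: "rep A ({x, b, w} \<union> Y \<union> Z \<union> E1 \<union> E2) P" using rep_insert[OF s3 _ comm x] g(3) by (simp add: P)
  have rep: "rep A C P" using rep_insert[OF s4 _ comm a] g(3) s unfolding C_def by (simp add: P)
  have r: "(N + 2, 0) \<notin> path_points (P v)" if "v \<in> C" "v \<noteq> a" for v
    using that g(3) g'[of v] unfolding C_def by (auto simp: P)
  have l: "(- 1, 0) \<notin> path_points (P v)" if "v \<in> C" "v \<noteq> a" "E2 = {}" for v
    using that g(3) g'[of v] unfolding C_def by (auto simp: P)
  have t: "(0, N + 2) \<notin> path_points (P v)" if "v \<in> C" "v \<noteq> x" for v
    using that g(3) g'[of v] unfolding C_def by (auto simp: P)
  have "1 \<le> card (free_ends C P x)"
    by (rule free_ends_ge_1[of "(0, N + 2)"]) (use t in \<open>auto simp: P\<close>)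
  moreover have "1 \<le> card (free_ends C P a)"
    by (rule free_ends_ge_1[of "(N + 2, 0)"]) (use r in \<open>auto simp: P\<close>)
  moreover have "2 \<le> card (free_ends C P a)" if "E2 = {}"
    by (rule free_ends_ge_2[of "(N + 2, 0)" _ _ _ "(- 1, 0)"]) (use r l that g(3) in \<open>auto simp: P s_def\<close>)
  ultimately show ?thesis using rep by blast
qed

text \<open>The square has side one, and its corners at \<open>ax\<close> and \<open>bw\<close>
  carry up to two outward arms each.\<close>

lemma two_corner_rep:
  assumes sym: "\<And>u v. A u v \<Longrightarrow> A v u"
    and sq: "distinct [a, x, b, w]" "A a x" "A x b" "A b w" "A w a" "\<not> A a b" "\<not> A x w"
    and E: "\<And>e. e \<in> E1 \<union> E2 \<Longrightarrow> A e a \<and> A e x \<and> \<not> A e b \<and> \<not> A e w \<and> e \<noteq> a \<and> e \<noteq> b \<and> e \<noteq> x \<and> e \<noteq> w"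
    and F: "\<And>e. e \<in> F1 \<union> F2 \<Longrightarrow> A e b \<and> A e w \<and> \<not> A e a \<and> \<not> A e x \<and> e \<noteq> a \<and> e \<noteq> b \<and> e \<noteq> x \<and> e \<noteq> w \<and> e \<notin> E1 \<and> e \<notin> E2"
    and EF: "\<And>e f. e \<in> E1 \<union> E2 \<Longrightarrow> f \<in> F1 \<union> F2 \<Longrightarrow> \<not> A e f"
    and E12: "\<And>e f. e \<in> E1 \<Longrightarrow> f \<in> E2 \<Longrightarrow> e \<noteq> f \<and> A e f" and F12: "\<And>e f. e \<in> F1 \<Longrightarrow> f \<in> F2 \<Longrightarrow> e \<noteq> f \<and> A e f"
    and E1: "\<And>e f. e \<in> E1 \<Longrightarrow> f \<in> E1 \<Longrightarrow> e = f" and E2: "\<And>e f. e \<in> E2 \<Longrightarrow> f \<in> E2 \<Longrightarrow> e = f"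
    and F1: "\<And>e f. e \<in> F1 \<Longrightarrow> f \<in> F1 \<Longrightarrow> e = f" and F2: "\<And>e f. e \<in> F2 \<Longrightarrow> f \<in> F2 \<Longrightarrow> e = f"
  defines "C \<equiv> {a, x, b, w} \<union> E1 \<union> E2 \<union> F1 \<union> F2"
  shows "\<exists>P. rep A C P"
proof -
  define P where "P v = (if v = a then Horizontal 0 0 1 else if v = x then Vertical 0 0 1
    else if v = b then Horizontal 1 0 1 else if v = w then Vertical 1 0 1
    else if v \<in> E1 then Vertical 0 (- 1) 0 else if v \<in> E2 then Horizontal 0 (- 1) 0
    else if v \<in> F1 then Vertical 1 1 2 else Horizontal 1 1 2)" for v
  have dis: "v \<in> E2 \<Longrightarrow> v \<notin> E1" "v \<in> F2 \<Longrightarrow> v \<notin> F1" for v using E12[of v v] F12[of v v] by blast+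
  have P: "P a = Horizontal 0 0 1" "P x = Vertical 0 0 1" "P b = Horizontal 1 0 1" "P w = Vertical 1 0 1"
    "\<And>v. v \<in> E1 \<Longrightarrow> P v = Vertical 0 (- 1) 0" "\<And>v. v \<in> E2 \<Longrightarrow> P v = Horizontal 0 (- 1) 0"
    "\<And>v. v \<in> F1 \<Longrightarrow> P v = Vertical 1 1 2" "\<And>v. v \<in> F2 \<Longrightarrow> P v = Horizontal 1 1 2"
    using sq(1) E F dis by (auto simp: P_def)
  have comm: "A u v \<longleftrightarrow> A v u" for u v using sym by blast
  let ?ok = "\<lambda>u v. noncross (P u) (P v) \<and> (A u v \<longleftrightarrow> touch (P u) (P v))"
  have a: "?ok a v" if "v \<in> {x, b, w} \<union> E1 \<union> E2 \<union> F1 \<union> F2" for v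
    using that(1) unfolding Un_iff insert_iff empty_iff
    by (elim disjE FalseE; use sq comm[of a v] E[of v] F[of v] in \<open>force simp: P\<close>)
  have x: "?ok x v" if "v \<in> {b, w} \<union> E1 \<union> E2 \<union> F1 \<union> F2" for v
    using that(1) unfolding Un_iff insert_iff empty_iff
    by (elim disjE FalseE; use sq comm[of x v] E[of v] F[of v] in \<open>force simp: P\<close>)
  have b: "?ok b v" if "v \<in> {w} \<union> E1 \<union> E2 \<union> F1 \<union> F2" for v
    using that(1) unfolding Un_iff insert_iff empty_iff
    by (elim disjE FalseE; use sq comm[of b v] E[of v] F[of v] in \<open>force simp: P\<close>)
  have w: "?ok w v" if "v \<in> E1 \<union> E2 \<union> F1 \<union> F2" for v
    using that(1) unfolding Un_iff insert_iff empty_iff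
    by (elim disjE FalseE; use sq comm[of w v] E[of v] F[of v] in \<open>force simp: P\<close>)
  have "rep A (E1 \<union> E2) P"
  proof (rule rep_Un[OF _ _ comm])
    show "rep A E1 P" "rep A E2 P" by (rule rep_at_most_one; use E1 E2 in \<open>auto simp: P\<close>)+
    show "?ok u v" if "u \<in> E1" "v \<in> E2" for u v
      using that E12[OF that] by (simp add: P)
  qed
  moreover have "rep A (F1 \<union> F2) P"
  proof (rule rep_Un[OF _ _ comm])
    show "rep A F1 P" "rep A F2 P" by (rule rep_at_most_one; use F1 F2 in \<open>auto simp: P\<close>)+
    show "?ok u v" if "u \<in> F1" "v \<in> F2" for u v
      using that F12[OF that] by (simp add: P)
  qed
  ultimately have "rep A ((E1 \<union> E2) \<union> (F1 \<union> F2)) P"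
  proof (rule rep_Un[OF _ _ comm])
    show "?ok u v" if "u \<in> E1 \<union> E2" "v \<in> F1 \<union> F2" for u v
      using that EF[OF that] unfolding Un_iff by (elim disjE; simp add: P)
  qed
  then have s6: "rep A (E1 \<union> E2 \<union> F1 \<union> F2) P" by (simp only: Un_ac)
  have s7: "rep A ({w} \<union> E1 \<union> E2 \<union> F1 \<union> F2) P" using rep_insert[OF s6 _ comm w] by (simp add: P)
  have s8: "rep A ({b, w} \<union> E1 \<union> E2 \<union> F1 \<union> F2) P" using rep_insert[OF s7 _ comm b] by (simp add: P)
  have s9: "rep A ({x, b, w} \<union> E1 \<union> E2 \<union> F1 \<union> F2) P" using rep_insert[OF s8 _ comm x] by (simp add: P)
  have s10: "rep A C P" using rep_insert[OF s9 _ comm a] unfolding C_def by (simp add: P)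
  then show ?thesis by blast
qed

text \<open>The two parts become the two arms at a corner of a square; the second one is filled only
  if there are two vertices.\<close>

lemma card_le_2_split:
  assumes "finite S" "card S \<le> 2"
  shows "\<exists>S1 S2. S = S1 \<union> S2 \<and> S1 \<inter> S2 = {} \<and> (\<forall>x\<in>S1. \<forall>y\<in>S1. x = y) \<and> (\<forall>x\<in>S2. \<forall>y\<in>S2. x = y) \<and>
    (card S < 2 \<longrightarrow> S2 = {})"
proof -
  have "card S = 0 \<or> card S = 1 \<or> card S = 2" using assms(2) by linarith
  then consider "S = {}" | x where "S = {x}" | x y where "S = {x, y}" "x \<noteq> y"
    using assms(1) by (auto simp: card_1_singleton_iff card_2_iff)
  then show ?thesis
  proof cases
    case 1
    then show ?thesis by (intro exI[of _ "{}"]) simp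
  next
    case (2 x)
    then show ?thesis by (intro exI[of _ "{x}"] exI[of _ "{}"]) simp
  next
    case (3 x y)
    then show ?thesis by (intro exI[of _ "{x}"] exI[of _ "{y}"]) simp
  qed
qed

section \<open>How vertices attach to a four-cycle\<close>

locale hole5_free_graph = connected_free_graph +
  assumes no_hole5: "\<And>a b c d e. \<not> hole5 a b c d e"
begin

lemma hole4_rot: "hole4 a x b y \<Longrightarrow> hole4 x b y a"
  by (auto simp: hole4_def adj_commute[of G])

lemma hole4_reflect: "hole4 a x b y \<Longrightarrow> hole4 a y b x"
  by (auto simp: hole4_def adj_commute[of G])

text \<open>If the two ends are adjacent there is an excluded five-cycle, otherwise a P5.\<close>

lemma no_P5_closed:
  assumes "A a b" "A b c" "A c d" "A d e" "\<not> A a c" "\<not> A a d" "\<not> A b d" "\<not> A b e" "\<not> A c e"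
  shows False
proof (cases "A a e")
  case True
  have "hole5 a b c d e" unfolding hole5_def using assms True A_sym by blast
  then show False using no_hole5 by blast
next
  case False
  show False by (rule no_P5[OF assms(1-6) False assms(7-9)])
qed

lemmas square_simps = hole4_def adj_commute[of G]

text \<open>A further corner would give a diamond. In the lemma names below, edge stands for a
  vertex seeing both ends of a side, and single for one seeing exactly one corner.\<close>

lemma edge_type:
  assumes h: "hole4 a x b y" and v: "A v a" "A v x"
  shows "\<not> A v b" "\<not> A v y"
proof -
  show "\<not> A v b" using no_diamond[of v x a b] h v unfolding hole4_def by (metis A_sym)
  show "\<not> A v y" using no_diamond[of v a x y] h v unfolding hole4_def by (metis A_sym)
qed

lemma opposite_single:
  assumes h: "hole4 a x b y" and v: "A v a" "\<not> A v x" "\<not> A v b" "\<not> A v y"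
    and w: "A w b" "\<not> A w x" "\<not> A w a" "\<not> A w y"
  shows False
  by (rule no_P5_closed[of v a x b w]; use h v w in \<open>simp add: square_simps\<close>)

lemma consecutive_single:
  assumes h: "hole4 a x b y" and v: "A v a" "\<not> A v x" "\<not> A v b" "\<not> A v y"
    and w: "A w x" "\<not> A w a" "\<not> A w b" "\<not> A w y"
  shows "\<not> A v w"
proof
  assume vw: "A v w"
  show False
    by (rule no_P5[of v w x b y]; use h v w vw in \<open>simp add: square_simps\<close>)
qed

text \<open>Adjacent \<open>v\<close> and \<open>w\<close> would give a diamond at \<open>a\<close>,
  nonadjacent ones the induced path \<open>v\<close>, \<open>x\<close>, \<open>b\<close>,
  \<open>y\<close>, \<open>w\<close>.\<close>

lemma consecutive_edges:
  assumes h: "hole4 a x b y" and v: "A v a" "A v x" and w: "A w a" "A w y"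
  shows False
proof -
  note ev = edge_type[OF h v]
  note ew = edge_type[OF hole4_reflect[OF h] w]
  have vw: "\<not> A v w"
  proof
    assume vw: "A v w"
    have "x \<noteq> w" using w(2) h unfolding hole4_def by blast
    then have "A x w" using no_diamond[of v a x w] vw v w h A_sym unfolding hole4_def by blast
    then show False using ew(2) A_sym by blast
  qed
  show False
    by (rule no_P5[of v x b y w]; use h v w ev ew vw in \<open>simp add: square_simps\<close>)
qed

lemma edge_single:
  assumes h: "hole4 a x b y" and v: "A v a" "A v x"
    and w: "A w b" "\<not> A w x" "\<not> A w a" "\<not> A w y"
  shows False
  by (rule no_P5_closed[of v a y b w]; use h v w edge_type[OF h v] in \<open>simp add: square_simps\<close>)

text \<open>The edge \<open>vw\<close> would complete the two triangles on opposite sides to a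
  prism, the complement of a six-cycle.\<close>

lemma opposite_edges:
  assumes h: "hole4 a x b y" and v: "A v a" "A v x" and w: "A w b" "A w y"
  shows "\<not> A v w"
proof
  assume vw: "A v w"
  have h': "hole4 b y a x" using hole4_rot[OF hole4_rot[OF h]] .
  show False
    by (rule no_co_C6[where a = a and x = w and b = x and y = y and c = v and z = b];
        use h v w vw edge_type[OF h v] edge_type[OF h' w] in \<open>auto simp: square_simps\<close>)
qed

section \<open>The core around a four-cycle\<close>

definition common :: "'a \<Rightarrow> 'a \<Rightarrow> 'a set" where
  "common u v = {x. A x u \<and> A x v}"

lemma common_commute: "common u v = common v u"
  by (auto simp: common_def)

lemma common_V: "common u v \<subseteq> V"
  unfolding common_def using A_V by blast

lemma finite_common: "finite (common u v)"
  using common_V finite_V finite_subset by blast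

lemma common_edge_card:
  assumes "A a x"
  shows "card (common a x) \<le> 2" "e \<in> common a x \<Longrightarrow> f \<in> common a x \<Longrightarrow> e \<noteq> f \<Longrightarrow> A e f"
proof -
  show ef: "A e f" if "e \<in> common a x" "f \<in> common a x" "e \<noteq> f" for e f
    using no_diamond[of a x e f] assms that A_sym unfolding common_def by blast
  have "clique (insert a (insert x (common a x)))"
    unfolding clique_def
  proof (intro conjI ballI impI)
    show "insert a (insert x (common a x)) \<subseteq> V" using A_V[OF assms] common_V[of a x] by simp
    fix p q assume pq: "p \<in> insert a (insert x (common a x))" "q \<in> insert a (insert x (common a x))" "p \<noteq> q"
    have "A e a" "A e x" "A a e" "A x e" if "e \<in> common a x" for e
      using that A_sym unfolding common_def by blast+
    then show "A p q" using pq ef assms A_sym[OF assms] by (elim insertE) simp_all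
  qed
  then have "card (insert a (insert x (common a x))) \<le> 4" by (rule clique_card)
  moreover have "a \<notin> insert x (common a x)" "x \<notin> common a x" using assms unfolding common_def by auto
  ultimately show "card (common a x) \<le> 2" using finite_common by simp
qed

text \<open>For a four-cycle the corners are included, since each opposite pair consists of common
  neighbours of the other. The last set completes the side \<open>ax\<close> to a maximal
  clique.\<close>

definition core :: "'a \<Rightarrow> 'a \<Rightarrow> 'a \<Rightarrow> 'a \<Rightarrow> 'a set" where
  "core a x b y = common a b \<union> common x y \<union> common a x"

definition covered :: "'a \<Rightarrow> 'a \<Rightarrow> 'a \<Rightarrow> 'a \<Rightarrow> bool" where
  "covered a x b y \<longleftrightarrow> (\<forall>w\<in>V - core a x b y. (\<exists>c\<in>core a x b y. A w c) \<and>
     (\<forall>c\<in>core a x b y. A w c \<longrightarrow> c = a \<or> c = x))"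

lemma core_sym: "core x a y b = core a x b y"
  unfolding core_def by (auto simp: common_def)

lemma common_nonadj:
  assumes "\<not> A a b" "a \<noteq> b" "u \<in> common a b" "v \<in> common a b"
  shows "\<not> A u v"
  using no_diamond[of u v a b] assms A_sym unfolding common_def by blast

text \<open>\<open>Y\<close> and \<open>Z\<close> are anticomplete because of K33, so the drawing of
  the square applies. It offers one free end at \<open>x\<close> and up to two at \<open>a\<close>;
  the bound \<open>tx\<close> matches this asymmetry.\<close>

lemma square_core_aux:
  assumes h: "hole4 a x b y" and cov: "covered a x b y"
    and tx: "card (triangles_at A (V - core a x b y) x) \<le> 1"
  shows "contact_B0_VPG G"
proof -
  let ?C = "core a x b y"
  define Y Z E where "Y = common a b - {x, y}" and "Z = common x y - {a, b}" and "E = common a x"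
  have sq: "distinct [a, x, b, y]" "A a x" "A x b" "A b y" "A y a" "\<not> A a b" "\<not> A x y"
    using h by (auto simp: hole4_def)
  have C: "?C = {a, x, b, y} \<union> Y \<union> Z \<union> E"
    unfolding core_def Y_def Z_def E_def using sq A_sym by (auto simp: common_def)
  have CV: "?C \<subseteq> V" unfolding core_def using common_V by blast
  have ne: "a \<noteq> b" "x \<noteq> y" using sq(1) by auto
  have cx: "x \<in> common a b" "y \<in> common a b" "a \<in> common x y" "b \<in> common x y"
    unfolding common_def using sq A_sym by blast+
  have Yn: "\<not> A u x" "\<not> A u y" "u \<noteq> a" "u \<noteq> b" "u \<noteq> x" "u \<noteq> y" "A u a" "A u b" if "u \<in> Y" for u
    using common_nonadj[OF sq(6) ne(1) _ cx(1), of u] common_nonadj[OF sq(6) ne(1) _ cx(2), of u] that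
    unfolding Y_def common_def by auto
  have Zn: "\<not> A u a" "\<not> A u b" "u \<noteq> a" "u \<noteq> b" "u \<noteq> x" "u \<noteq> y" "A u x" "A u y" if "u \<in> Z" for u
    using common_nonadj[OF sq(7) ne(2) _ cx(3), of u] common_nonadj[OF sq(7) ne(2) _ cx(4), of u] that
    unfolding Z_def common_def by auto
  have YZ: "\<not> A u v" if "u \<in> Y" "v \<in> Z" for u v
  proof
    assume uv: "A u v"
    show False
      by (rule no_K33[where a = a and b = b and c = v and x = x and y = y and z = u];
        use sq uv Yn[OF that(1)] Zn[OF that(2)] in \<open>auto simp: adj_commute[of G]\<close>)
  qed
  have fE: "finite E" and cE: "card E \<le> 2"
    unfolding E_def using common_edge_card(1)[OF sq(2)] finite_common by blast+
  obtain E1 E2 where E: "E = E1 \<union> E2" "E1 \<inter> E2 = {}" "\<forall>x\<in>E1. \<forall>y\<in>E1. x = y"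
    "\<forall>x\<in>E2. \<forall>y\<in>E2. x = y" "card E < 2 \<longrightarrow> E2 = {}"
    using card_le_2_split[OF fE cE] by blast
  have Et: "\<not> A e b \<and> \<not> A e y \<and> A e a \<and> A e x" if "e \<in> E" for e
    using edge_type[OF h, of e] that unfolding E_def common_def by auto
  have C': "?C = {a, x, b, y} \<union> Y \<union> Z \<union> E1 \<union> E2" unfolding C E(1) by blast
  have "\<exists>P. rep A ({a, x, b, y} \<union> Y \<union> Z \<union> E1 \<union> E2) P \<and> 1 \<le> card (free_ends ({a, x, b, y} \<union> Y \<union> Z \<union> E1 \<union> E2) P x) \<and>
    1 \<le> card (free_ends ({a, x, b, y} \<union> Y \<union> Z \<union> E1 \<union> E2) P a) \<and>
    (E2 = {} \<longrightarrow> 2 \<le> card (free_ends ({a, x, b, y} \<union> Y \<union> Z \<union> E1 \<union> E2) P a))"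
  proof (rule square_rep[OF _ _ sq])
    show "finite (Y \<union> Z)" unfolding Y_def Z_def using finite_common by blast
    show "A v u" if "A u v" for u v using A_sym[OF that] .
    show "A u a \<and> A u b \<and> \<not> A u x \<and> \<not> A u y \<and> u \<noteq> a \<and> u \<noteq> b \<and> u \<noteq> x \<and> u \<noteq> y" if "u \<in> Y" for u
      using Yn[OF that] by blast
    show "A u x \<and> A u y \<and> \<not> A u a \<and> \<not> A u b \<and> u \<noteq> a \<and> u \<noteq> b \<and> u \<noteq> x \<and> u \<noteq> y \<and> u \<notin> Y" if "u \<in> Z" for u
      using Zn[OF that] unfolding Y_def common_def by blast
    show "\<not> A u v" if "u \<in> Y \<union> Z" "v \<in> Y \<union> Z" for u v
      using that YZ[of u v] YZ[of v u] common_nonadj[OF sq(6) ne(1), of u v] common_nonadj[OF sq(7) ne(2), of u v] A_sym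
      unfolding Y_def Z_def by blast
    show "A e a \<and> A e x \<and> \<not> A e b \<and> \<not> A e y \<and> e \<noteq> a \<and> e \<noteq> b \<and> e \<noteq> x \<and> e \<noteq> y \<and> e \<notin> Y \<and> e \<notin> Z"
      if "e \<in> E1 \<union> E2" for e
    proof -
      have "e \<in> E" using that E(1) by blast
      then show ?thesis using Et[of e] sq A_sym[of b a] A_sym[of y x] unfolding Y_def Z_def common_def by auto
    qed
    show "\<not> A e u" if "e \<in> E1 \<union> E2" "u \<in> Y \<union> Z" for e u
    proof
      assume eu: "A e u"
      have e: "e \<in> E" using that E(1) by blast
      show False
      proof (cases "u \<in> Y")
        case True
        then have "A u a" "x \<noteq> u" "\<not> A u x"
          using Yn[OF True] by auto
        then show False using no_diamond[of e a x u] eu Et[OF e] sq(2) A_sym by blast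
      next
        case False
        then have "u \<in> Z" using that by blast
        then have "A u x" "a \<noteq> u" "\<not> A u a"
          using Zn[of u] by auto
        then show False using no_diamond[of e x a u] eu Et[OF e] sq(2) A_sym by blast
      qed
    qed
    show "e \<noteq> f \<and> A e f" if "e \<in> E1" "f \<in> E2" for e f
      using common_edge_card(2)[OF sq(2), of e f] that E(1,2) unfolding E_def by blast
    show "e = f" if "e \<in> E1" "f \<in> E1" for e f using E(3) that by blast
    show "e = f" if "e \<in> E2" "f \<in> E2" for e f using E(4) that by blast
  qed
  then obtain P where P: "rep A ?C P" "1 \<le> card (free_ends ?C P x)" "1 \<le> card (free_ends ?C P a)"
    "E2 = {} \<Longrightarrow> 2 \<le> card (free_ends ?C P a)"
    unfolding C' by blast
  have only: "c = a \<or> c = x" if "w \<in> V - ?C" "c \<in> ?C" "A w c" for w c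
    using cov that unfolding covered_def by blast
  have ax: "\<not> (A w a \<and> A w x)" if "w \<in> V - ?C" for w
    using that unfolding C E_def common_def by blast
  have mem: "a \<in> ?C" "x \<in> ?C" "b \<in> ?C" "y \<in> ?C" unfolding C by auto
  show ?thesis
  proof (rule pendant_rep[OF CV P(1)])
    show "\<exists>c\<in>?C. A w c" if "w \<in> V - ?C" for w using cov that unfolding covered_def by blast
    show "c = d" if "w \<in> V - ?C" "c \<in> ?C" "d \<in> ?C" "A w c" "A w d" for w c d
      using only[OF that(1,2,4)] only[OF that(1,3,5)] ax[OF that(1)] that(4,5) by blast
    have cross: "\<not> A w w'" if "w \<in> V - ?C" "w' \<in> V - ?C" "A w a" "A w' x" for w w'
    proof (rule consecutive_single[OF h that(3) _ _ _ that(4)])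
      show "\<not> A w x" "\<not> A w' a" using ax that by blast+
      show "\<not> A w b" "\<not> A w y" "\<not> A w' b" "\<not> A w' y"
        using only[OF that(1) mem(3)] only[OF that(1) mem(4)] only[OF that(2) mem(3)] only[OF that(2) mem(4)] sq(1) by auto
    qed
    show "c = d" if "w \<in> V - ?C" "w' \<in> V - ?C" "A w w'" "c \<in> ?C" "d \<in> ?C" "A w c" "A w' d" for w w' c d
      using only[OF that(1,4,6)] only[OF that(2,5,7)] cross[OF that(1,2)] cross[OF that(2,1)] that(3,6,7) A_sym by blast
    show "card (triangles_at A (V - ?C) c) \<le> card (free_ends ?C P c)" if c: "c \<in> ?C" for c
    proof -
      consider "c = x" | "c = a" | "c \<noteq> x" "c \<noteq> a" by blast
      then show ?thesis
      proof cases
        case 1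
        then show ?thesis using tx P(2) by simp
      next
        case 2
        have sub: "triangles_at A (V - ?C) a \<subseteq> triangles_at A V a" by (rule triangles_at_mono) blast
        show ?thesis
        proof (cases "card E < 2")
          case True
          then show ?thesis
            using 2 P(4) E(5) card_mono[OF finite_triangles_at sub] card_triangles_at[of a] by simp
        next
          \<comment> \<open>Two vertices in \<open>E\<close> cost \<open>a\<close> an end, but
            together with \<open>x\<close> they already form one of the at most two triangles at
            \<open>a\<close>, and that one is not pendant.\<close>
          case False
          then have "card E = 2" using common_edge_card(1)[OF sq(2)] unfolding E_def by simp
          moreover have "x \<notin> E" unfolding E_def common_def by simp
          ultimately have "card (insert x E) = 3" using finite_common unfolding E_def by simp
          moreover have "insert x E \<subseteq> V" using CV unfolding C by blast
          moreover have "\<forall>q\<in>insert x E. \<forall>q'\<in>insert x E. q \<noteq> q' \<longrightarrow> A q q'" "\<forall>q\<in>insert x E. A q a"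
            using common_edge_card(2)[OF sq(2)] Et sq(2) A_sym unfolding E_def by blast+
          ultimately have "insert x E \<in> triangles_at A V a" unfolding triangles_at_def by blast
          moreover have "insert x E \<notin> triangles_at A (V - ?C) a"
            using mem(2) unfolding triangles_at_def by blast
          ultimately have "triangles_at A (V - ?C) a \<subset> triangles_at A V a" using sub by blast
          then have "card (triangles_at A (V - ?C) a) < card (triangles_at A V a)"
            by (rule psubset_card_mono[OF finite_triangles_at])
          then show ?thesis using 2 P(3) card_triangles_at[of a] by simp
        qed
      next
        case 3
        have "\<not> A q c" if "q \<in> V - ?C" for q using only[OF that c] 3 by blast
        moreover have "Q \<noteq> {}" if "card Q = 3" for Q :: "'a set" using that by auto
        ultimately have "triangles_at A (V - ?C) c = {}" unfolding triangles_at_def by blast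
        then show ?thesis by simp
      qed
    qed
  qed
qed

text \<open>By \<open>G_P2\<close> the corners \<open>a\<close> and \<open>x\<close> cannot both
  carry two pendant triangles, and exchanging \<open>a\<close> with \<open>x\<close> and
  \<open>b\<close> with \<open>y\<close> preserves the core.\<close>

lemma square_core_contact:
  assumes h: "hole4 a x b y" and cov: "covered a x b y"
  shows "contact_B0_VPG G"
proof -
  let ?C = "core a x b y"
  let ?t = "\<lambda>c. card (triangles_at A (V - ?C) c)"
  have h': "hole4 x a y b" using hole4_reflect[OF hole4_rot[OF h]] .
  have cov': "covered x a y b" using cov unfolding covered_def core_sym[of x a y b] by blast
  have sq: "A a x" "A x a" "A x b" "A b x" "A b y" "A y b" "A y a" "A a y"
    using h A_sym unfolding hole4_def by blast+
  have mem: "a \<in> ?C" "x \<in> ?C" "b \<in> ?C" "y \<in> ?C"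
    by (simp_all add: core_def common_def sq)
  have ax: "\<not> (A w a \<and> A w x)" if "w \<in> V - ?C" for w
    using that unfolding core_def common_def by blast
  have only: "c = a \<or> c = x" if "w \<in> V - ?C" "c \<in> ?C" "A w c" for w c
    using cov that unfolding covered_def by blast
  have "\<not> (2 \<le> ?t a \<and> 2 \<le> ?t x)"
  proof
    assume t: "2 \<le> ?t a \<and> 2 \<le> ?t x"
    show False
    proof (rule triangles_at_two_large[of a x "V - ?C"])
      show "A a x" using h unfolding hole4_def by blast
      show "\<not> (A w a \<and> A w x)" if "w \<in> V - ?C" for w using ax[OF that] .
      show "\<not> A w w'" if "w \<in> V - ?C" "w' \<in> V - ?C" "A w a" "A w' x" for w w'
      proof (rule consecutive_single[OF h that(3) _ _ _ that(4)])
        show "\<not> A w x" "\<not> A w' a" using ax that by blast+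
        show "\<not> A w b" "\<not> A w y" "\<not> A w' b" "\<not> A w' y"
          using only[OF that(1) mem(3)] only[OF that(1) mem(4)] only[OF that(2) mem(3)] only[OF that(2) mem(4)] h
          unfolding hole4_def by auto
      qed
    qed (use mem t in auto)
  qed
  then have "?t x \<le> 1 \<or> ?t a \<le> 1" by linarith
  then show ?thesis
    using square_core_aux[OF h cov] square_core_aux[OF h' cov'] unfolding core_sym[of x a y b] by blast
qed

lemma two_edges_contact:
  assumes h: "hole4 a x b y" and V: "V = {a, x, b, y} \<union> common a x \<union> common b y"
  shows "contact_B0_VPG G"
proof -
  have sq: "distinct [a, x, b, y]" "A a x" "A x b" "A b y" "A y a" "\<not> A a b" "\<not> A x y"
    using h by (auto simp: hole4_def)
  have h': "hole4 b y a x" using hole4_rot[OF hole4_rot[OF h]] .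
  obtain E1 E2 where E: "common a x = E1 \<union> E2" "E1 \<inter> E2 = {}" "\<forall>x\<in>E1. \<forall>y\<in>E1. x = y"
    "\<forall>x\<in>E2. \<forall>y\<in>E2. x = y" "card (common a x) < 2 \<longrightarrow> E2 = {}"
    using card_le_2_split[OF finite_common common_edge_card(1)[OF sq(2)]] by blast
  obtain F1 F2 where F: "common b y = F1 \<union> F2" "F1 \<inter> F2 = {}" "\<forall>x\<in>F1. \<forall>y\<in>F1. x = y"
    "\<forall>x\<in>F2. \<forall>y\<in>F2. x = y" "card (common b y) < 2 \<longrightarrow> F2 = {}"
    using card_le_2_split[OF finite_common common_edge_card(1)[OF sq(4)]] by blast
  have Et: "A e a \<and> A e x \<and> \<not> A e b \<and> \<not> A e y" if "e \<in> common a x" for e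
    using edge_type[OF h, of e] that unfolding common_def by auto
  have Ft: "A e b \<and> A e y \<and> \<not> A e a \<and> \<not> A e x" if "e \<in> common b y" for e
    using edge_type[OF h', of e] that unfolding common_def by auto
  have "\<exists>P. rep A ({a, x, b, y} \<union> E1 \<union> E2 \<union> F1 \<union> F2) P"
  proof (rule two_corner_rep[OF _ sq])
    show "A v u" if "A u v" for u v using A_sym[OF that] .
    show "A e a \<and> A e x \<and> \<not> A e b \<and> \<not> A e y \<and> e \<noteq> a \<and> e \<noteq> b \<and> e \<noteq> x \<and> e \<noteq> y" if "e \<in> E1 \<union> E2" for e
      using Et[of e] that sq A_sym[of b a] A_sym[of y x] unfolding E(1) by auto
    show "A e b \<and> A e y \<and> \<not> A e a \<and> \<not> A e x \<and> e \<noteq> a \<and> e \<noteq> b \<and> e \<noteq> x \<and> e \<noteq> y \<and> e \<notin> E1 \<and> e \<notin> E2"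
      if "e \<in> F1 \<union> F2" for e
      using Ft[of e] Et[of e] that sq A_sym[of b a] A_sym[of y x] unfolding E(1) F(1) by auto
    show "\<not> A e f" if "e \<in> E1 \<union> E2" "f \<in> F1 \<union> F2" for e f
      using opposite_edges[OF h, of e f] Et[of e] Ft[of f] that unfolding E(1) F(1) by blast
    show "e \<noteq> f \<and> A e f" if "e \<in> E1" "f \<in> E2" for e f
      using common_edge_card(2)[OF sq(2), of e f] that E(1,2) by blast
    show "e \<noteq> f \<and> A e f" if "e \<in> F1" "f \<in> F2" for e f
      using common_edge_card(2)[OF sq(4), of e f] that F(1,2) by blast
    show "e = f" if "e \<in> E1" "f \<in> E1" for e f using E(3) that by blast
    show "e = f" if "e \<in> E2" "f \<in> E2" for e f using E(4) that by blast
    show "e = f" if "e \<in> F1" "f \<in> F1" for e f using F(3) that by blast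
    show "e = f" if "e \<in> F2" "f \<in> F2" for e f using F(4) that by blast
  qed
  moreover have "{a, x, b, y} \<union> E1 \<union> E2 \<union> F1 \<union> F2 = V" unfolding V E(1) F(1) by blast
  ultimately show ?thesis unfolding contact_B0_VPG_def contact_rep_iff by metis
qed

section \<open>Pairs with the most common neighbours\<close>

definition max_pair :: "'a \<Rightarrow> 'a \<Rightarrow> bool" where
  "max_pair a b \<longleftrightarrow> a \<noteq> b \<and> \<not> A a b \<and> 2 \<le> card (common a b) \<and>
     (\<forall>u v. u \<noteq> v \<longrightarrow> \<not> A u v \<longrightarrow> card (common u v) \<le> card (common a b))"

lemma max_pair_sym: "max_pair a b \<Longrightarrow> max_pair b a"
  unfolding max_pair_def common_commute[of b a] using A_sym by blast

lemma max_pair_hole4: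
  assumes m: "max_pair a b" and xy: "x \<in> common a b" "y \<in> common a b" "x \<noteq> y"
  shows "hole4 a x b y"
  using m xy common_nonadj[of a b x y] A_sym unfolding max_pair_def hole4_def common_def by blast

lemma max_pair_other:
  assumes m: "max_pair a b"
  shows "\<exists>y\<in>common a b. y \<noteq> x"
proof (rule ccontr)
  assume "\<not> (\<exists>y\<in>common a b. y \<noteq> x)"
  then have "common a b \<subseteq> {x}" by blast
  then have "card (common a b) \<le> 1" using card_mono[of "{x}"] by fastforce
  then show False using m unfolding max_pair_def by simp
qed

text \<open>Together with \<open>a\<close> and \<open>b\<close>, the vertex \<open>z\<close> would
  be one side of a K33.\<close>

lemma max_pair_two:
  assumes m: "max_pair a b" and z: "z \<noteq> a" "z \<noteq> b" "\<not> A z a" "\<not> A z b"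
    and p: "p \<in> common a b" "A z p" and q: "q \<in> common a b" "A z q" and r: "r \<in> common a b" "A z r"
    and n: "p \<noteq> q" "r \<noteq> p" "r \<noteq> q"
  shows False
proof -
  have ab: "a \<noteq> b" "\<not> A a b" using m unfolding max_pair_def by auto
  have "\<not> A p q" "\<not> A r p" "\<not> A r q"
    using common_nonadj[OF ab(2,1)] p q r by blast+
  then show False
    by (intro no_K33[where a = a and b = b and c = z and x = p and y = q and z = r];
      use ab z p q r n in \<open>auto simp: common_def adj_commute[of G]\<close>)
qed

text \<open>Here maximality enters: \<open>p\<close> and \<open>q\<close> have the three common
  neighbours \<open>a\<close>, \<open>b\<close>, \<open>z\<close>, so \<open>a\<close> and
  \<open>b\<close> have at least three as well, and by K33 the vertex \<open>z\<close> misses the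
  third.\<close>

lemma max_pair_third:
  assumes m: "max_pair a b" and z: "z \<noteq> a" "z \<noteq> b" "\<not> A z a" "\<not> A z b"
    and p: "p \<in> common a b" "A z p" and q: "q \<in> common a b" "A z q" and n: "p \<noteq> q"
  shows "\<exists>r\<in>common a b. r \<noteq> p \<and> r \<noteq> q \<and> \<not> A z r"
proof -
  have ab: "a \<noteq> b" "\<not> A a b" using m unfolding max_pair_def by auto
  have "\<not> A p q" using common_nonadj[OF ab(2,1)] p q by blast
  then have "card (common p q) \<le> card (common a b)" using m n unfolding max_pair_def by blast
  moreover have "{a, b, z} \<subseteq> common p q" using p q A_sym unfolding common_def by blast
  then have "card {a, b, z} \<le> card (common p q)" by (rule card_mono[OF finite_common])
  then have "3 \<le> card (common p q)" using ab z by simp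
  ultimately have c: "3 \<le> card (common a b)" by linarith
  have "\<not> common a b \<subseteq> {p, q}"
  proof
    assume "common a b \<subseteq> {p, q}"
    then have "card (common a b) \<le> card {p, q}" by (rule card_mono[rotated]) simp
    then show False using c n by simp
  qed
  then obtain r where r: "r \<in> common a b" "r \<noteq> p" "r \<noteq> q" by blast
  then have "\<not> A z r" using max_pair_two[OF m z p q r(1) _ n r(2,3)] by blast
  then show ?thesis using r by blast
qed

text \<open>The traces of \<open>z\<close> and \<open>w\<close> on \<open>common a b\<close> are
  nested, for otherwise \<open>z\<close>, \<open>p\<close>, \<open>a\<close>, \<open>q\<close>,
  \<open>w\<close> would induce a P5 or a five-cycle.\<close>

lemma max_pair_cross:
  assumes m: "max_pair a b" and z: "\<not> A z a" "\<not> A w a"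
    and p: "p \<in> common a b" "A z p" "\<not> A w p" and q: "q \<in> common a b" "A w q" "\<not> A z q"
  shows False
proof -
  have ab: "a \<noteq> b" "\<not> A a b" using m unfolding max_pair_def by auto
  have pq: "\<not> A p q" using common_nonadj[OF ab(2,1)] p q by blast
  show False
    by (rule no_P5_closed[of z p a q w]; use p q z pq in \<open>simp add: common_def adj_commute[of G]\<close>)
qed

text \<open>Suppose an edge \<open>us\<close> leaves the neighbourhood of the pair and its common
  neighbours. If \<open>u\<close> sees \<open>a\<close> or \<open>b\<close>, there is a P5 from
  \<open>s\<close> over \<open>u\<close> to the other one. If not, \<open>u\<close> misses some
  common neighbour \<open>q\<close>, and \<open>s\<close>, \<open>u\<close>, \<open>p\<close>,
  \<open>a\<close>, \<open>q\<close> is induced.\<close>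

lemma max_pair_nbr:
  assumes m: "max_pair a b" and v: "v \<in> V"
  shows "v \<in> {a, b} \<union> common a b \<or> (\<exists>c\<in>{a, b} \<union> common a b. A v c)"
proof -
  let ?X = "common a b" and ?D = "{v \<in> V. v \<in> {a, b} \<union> common a b \<or> (\<exists>c\<in>{a, b} \<union> common a b. A v c)}"
  have ab: "a \<noteq> b" "\<not> A a b" using m unfolding max_pair_def by auto
  obtain x where x: "x \<in> ?X" using max_pair_other[OF m] by blast
  have XX: "\<not> A p q" if "p \<in> ?X" "q \<in> ?X" for p q
    using common_nonadj[OF ab(2,1)] that by blast
  have Xab: "A p a" "A p b" "A a p" "A b p" if "p \<in> ?X" for p
    using that A_sym unfolding common_def by blast+
  have one_side: False if ab': "max_pair a b" "\<And>p. p \<in> common a b \<Longrightarrow> A p a \<and> A p b \<and> A a p \<and> A b p"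
    and us: "A u s" "A u a" "\<not> A u b" "\<not> A s a" "\<not> A s b" "\<And>c. c \<in> common a b \<Longrightarrow> \<not> A s c" for a b u s
  proof (cases "\<exists>x\<in>common a b. A u x")
    case True
    then obtain x where x: "x \<in> common a b" "A u x" by blast
    obtain y where y: "y \<in> common a b" "y \<noteq> x" using max_pair_other[OF ab'(1)] by blast
    have h: "hole4 a x b y" using max_pair_hole4[OF ab'(1) x(1) y(1)] y(2) by blast
    show False
      by (rule no_P5[of s u a y b]; use us(1-5) us(6)[OF y(1)] x y h edge_type[OF h us(2) x(2)] in \<open>simp add: square_simps\<close>)
  next
    case False
    obtain x where x: "x \<in> common a b" using max_pair_other[OF ab'(1)] by blast
    have "A a x" "A x b" "\<not> A u x" "\<not> A s x" "\<not> A a b"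
      using ab' x False us(6) unfolding max_pair_def by blast+
    then show False
      by (intro no_P5[of s u a x b]) (use us(1-5) in \<open>simp_all add: adj_commute[of G]\<close>)
  qed
  have "?D = V"
  proof (rule reach_all)
    show "?D \<subseteq> V" by blast
    show "?D \<noteq> {}" using x common_V by blast
    fix u s assume u: "u \<in> ?D" and s: "s \<in> V - ?D"
    have sn: "\<not> A s a" "\<not> A s b" "\<And>c. c \<in> ?X \<Longrightarrow> \<not> A s c" using s by blast+
    show "\<not> A u s"
    proof
      assume us: "A u s"
      then have uX: "u \<noteq> a" "u \<noteq> b" "u \<notin> ?X" using sn A_sym by blast+
      show False
      proof (cases "A u a \<or> A u b")
        case True
        then show False
          using one_side[OF m _ us _ _ sn] one_side[OF max_pair_sym[OF m] _ us _ _ sn(2,1)] sn(3) Xab uX(3)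
          unfolding common_commute[of b a] common_def by blast
      next
        case False
        then obtain p where p: "p \<in> ?X" "A u p" using u uX by blast
        have "\<exists>q\<in>?X. \<not> A u q"
        proof (rule ccontr)
          assume all: "\<not> (\<exists>q\<in>?X. \<not> A u q)"
          obtain q where "q \<in> ?X" "q \<noteq> p" using max_pair_other[OF m] by blast
          then show False using max_pair_third[OF m uX(1,2), of p q] False p all by blast
        qed
        then obtain q where q: "q \<in> ?X" "\<not> A u q" by blast
        show False
          by (rule no_P5[of s u p a q];
            use us p q sn(1) sn(3)[OF p(1)] sn(3)[OF q(1)] False XX[OF p(1) q(1)] Xab[OF p(1)] Xab[OF q(1)] in \<open>simp add: adj_commute[of G]\<close>)
      qed
    qed
  qed
  then show ?thesis using v by blast
qed

end

section \<open>Choosing the four-cycle around a pair with the most common neighbours\<close>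

context hole5_free_graph
begin

definition outer :: "'a \<Rightarrow> 'a \<Rightarrow> 'a set" where
  "outer a b = V - ({a, b} \<union> common a b)"

lemma outer_sym: "outer b a = outer a b"
  unfolding outer_def common_commute[of b a] by blast

lemma outer_not_both: "v \<in> outer a b \<Longrightarrow> \<not> (A v a \<and> A v b)"
  unfolding outer_def common_def by blast

text \<open>The hypotheses control what an outer vertex sees among \<open>a\<close>,
  \<open>b\<close> and their common neighbours. It remains to keep it away from the other core
  vertices, those in \<open>common x y\<close> and \<open>common a x\<close>.\<close>

lemma max_pair_covered:
  assumes m: "max_pair a b" and x: "x \<in> common a b" and y: "y \<in> common a b" and xy: "x \<noteq> y"
    and b: "\<And>v. v \<in> outer a b \<Longrightarrow> \<not> A v b"
    and ax: "\<And>v w. v \<in> outer a b \<Longrightarrow> w \<in> common a b \<Longrightarrow> A v a \<Longrightarrow> A v w \<Longrightarrow> w = x"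
    and nx: "\<And>v w. v \<in> outer a b \<Longrightarrow> w \<in> common a b \<Longrightarrow> \<not> A v a \<Longrightarrow> A v w \<Longrightarrow> w = x \<or> A v x \<and> A v y"
  shows "covered a x b y"
  unfolding covered_def
proof (intro ballI conjI impI)
  fix w assume w: "w \<in> V - core a x b y"
  have h: "hole4 a x b y" by (rule max_pair_hole4[OF m x y xy])
  have ab: "a \<noteq> b" "\<not> A a b" using m unfolding max_pair_def by auto
  have Xab: "A p a" "A p b" "A a p" "A b p" if "p \<in> common a b" for p
    using that A_sym unfolding common_def by blast+
  have XX: "\<not> A p q" if "p \<in> common a b" "q \<in> common a b" for p q
    using common_nonadj[OF ab(2,1)] that by blast
  have sub: "{a, b} \<union> common a b \<subseteq> core a x b y"
    using Xab[OF x] Xab[OF y] unfolding core_def common_def by blast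
  have wo: "w \<in> outer a b" using w sub unfolding outer_def by blast
  have notE: "\<not> (A w a \<and> A w x)" and notZ: "\<not> (A w x \<and> A w y)"
    using w unfolding core_def common_def by blast+
  have nb: "\<not> A w b" using b[OF wo] .
  have nX: "\<not> A w p" if "A w a" "p \<in> common a b" for p
    using ax[OF wo that(2,1)] notE that by blast
  show nbr: "\<exists>c\<in>core a x b y. A w c"
    using max_pair_nbr[OF m, of w] w sub by blast
  have onlyx: "p = x" if "\<not> A w a" "p \<in> common a b" "A w p" for p
    using nx[OF wo that(2,1,3)] notZ by blast
  have wx: "A w x" if "\<not> A w a"
    using max_pair_nbr[OF m, of w] wo nb that onlyx unfolding outer_def by blast
  fix c assume c: "c \<in> core a x b y" "A w c"
  consider "c \<in> common a b" | "c \<in> common x y" "c \<noteq> a" "c \<noteq> b" | "c \<in> common a x" | "c = a" | "c = b"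
    using c(1) unfolding core_def by blast
  then show "c = a \<or> c = x"
  proof cases
    case 1
    then show ?thesis using nX[of c] onlyx[of c] c(2) by blast
  next
    case 2
    have z: "A c x" "A c y" "\<not> A c a" "\<not> A c b"
      using 2(1) common_nonadj[of x y c a] common_nonadj[of x y c b] h Xab[OF x] Xab[OF y]
      unfolding hole4_def common_def by blast+
    \<comment> \<open>By maximality \<open>c\<close> misses a common neighbour \<open>r\<close>,
      which starts a P5 ending in \<open>c\<close>, \<open>w\<close>.\<close>
    obtain r where r: "r \<in> common a b" "r \<noteq> x" "r \<noteq> y" "\<not> A c r"
      using max_pair_third[OF m 2(2,3) z(3,4) x z(1) y z(2) xy] by blast
    show ?thesis
    proof (cases "A w a")
      case True
      have False
        by (rule no_P5[of r b x c w];
          use True nX[OF True x] nX[OF True r(1)] nb z r(4) c(2) Xab[OF r(1)] Xab[OF x] XX[OF r(1) x] in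
            \<open>simp add: adj_commute[of G]\<close>)
      then show ?thesis ..
    next
      case False
      have "\<not> A w r" "\<not> A w y" using onlyx[OF False r(1)] onlyx[OF False y] r(2) xy by blast+
      then have False
        by (intro no_P5[of r a y c w];
          use False wx[OF False] nb z r(4) c(2) Xab[OF r(1)] Xab[OF y] XX[OF r(1) y] in
            \<open>simp add: adj_commute[of G]\<close>)
      then show ?thesis ..
    qed
  next
    case 3
    \<comment> \<open>As \<open>a\<close>, \<open>x\<close>, \<open>c\<close> form a triangle, a
      vertex adjacent to \<open>c\<close> and to one end of \<open>ax\<close> is adjacent to the
      other end too, and would belong to the core.\<close>
    then have c3: "A a c" "A c x" "A x c" "A c a" "A a x" "A x a"
      using A_sym Xab[OF x] unfolding common_def by blast+
    have wn: "w \<noteq> x" "w \<noteq> a" using wo x unfolding outer_def by blast+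
    have "A w x" if "A w a"
      using no_diamond[of a c w x] c3 c(2) A_sym[OF c(2)] A_sym[OF that] wn by blast
    moreover have "A w a" if "A w x"
      using no_diamond[of x c w a] c3 c(2) A_sym[OF c(2)] A_sym[OF that] wn by blast
    ultimately show ?thesis using notE wx by blast
  next
    case 5
    then show ?thesis using nb c(2) by blast
  qed simp
qed

text \<open>If some \<open>f\<close> sees \<open>b\<close> and a common neighbour, only the square
  and the cliques on two opposite sides can exist. If not, no outer vertex sees \<open>b\<close>,
  and \<open>y\<close> is chosen so that \<open>common x y\<close> absorbs every vertex away from
  \<open>a\<close> and \<open>b\<close> that sees \<open>x\<close> and another common
  neighbour.\<close>

lemma max_pair_edge_contact:
  assumes m: "max_pair a b" and x: "x \<in> common a b" and e: "A e a" "A e x"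
  shows "contact_B0_VPG G"
proof -
  have ab: "a \<noteq> b" "\<not> A a b" using m unfolding max_pair_def by auto
  have m': "max_pair b a" by (rule max_pair_sym[OF m])
  have Xab: "A p a" "A p b" "A a p" "A b p" if "p \<in> common a b" for p
    using that A_sym unfolding common_def by blast+
  have XX: "\<not> A p q" if "p \<in> common a b" "q \<in> common a b" for p q
    using common_nonadj[OF ab(2,1)] that by blast
  have hole: "hole4 a p b q" if "p \<in> common a b" "q \<in> common a b" "p \<noteq> q" for p q
    using max_pair_hole4[OF m that] .
  obtain x' where x': "x' \<in> common a b" "x' \<noteq> x" using max_pair_other[OF m] by blast
  have eb: "\<not> A e b" and eX: "\<And>p. p \<in> common a b \<Longrightarrow> p \<noteq> x \<Longrightarrow> \<not> A e p"
    using edge_type[OF hole[OF x] e] x' by blast+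
  show ?thesis
  proof (cases "\<exists>f y. y \<in> common a b \<and> A f b \<and> A f y")
    case True
    then obtain f y where f: "y \<in> common a b" "A f b" "A f y" by blast
    have yx: "y \<noteq> x"
    proof
      assume "y = x"
      then show False
        using consecutive_edges[OF hole4_rot[OF hole[OF x x'(1)]], of f e] f e x'(2) by blast
    qed
    have h: "hole4 a x b y" using hole[OF x f(1)] yx by blast
    have h': "hole4 b y a x" using hole4_rot[OF hole4_rot[OF h]] .
    have fa: "\<not> A f a" and fX: "\<And>p. p \<in> common a b \<Longrightarrow> p \<noteq> y \<Longrightarrow> \<not> A f p"
    proof -
      show "\<not> A f a" using edge_type(1)[OF h' f(2,3)] .
      show "\<not> A f p" if "p \<in> common a b" "p \<noteq> y" for p
        using edge_type(2)[OF hole4_rot[OF hole4_rot[OF hole[OF that(1) f(1) that(2)]]] f(2,3)] .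
    qed
    \<comment> \<open>A third common neighbour \<open>w\<close> would be the middle of an induced
      path \<open>e\<close>, \<open>a\<close>, \<open>w\<close>, \<open>b\<close>,
      \<open>f\<close>.\<close>
    have X: "common a b = {x, y}"
    proof -
      have "w = x \<or> w = y" if w: "w \<in> common a b" for w
      proof (rule ccontr)
        assume n: "\<not> (w = x \<or> w = y)"
        have "\<not> A e w" "\<not> A f w" "\<not> A e f"
          using eX[OF w] fX[OF w] opposite_edges[OF h e f(2,3)] n by blast+
        then show False
          by (intro no_P5[of e a w b f]; use e f eb fa Xab[OF w] ab in \<open>simp add: adj_commute[of G]\<close>)
      qed
      then show ?thesis using x f(1) by blast
    qed
    have "V \<subseteq> {a, x, b, y} \<union> common a x \<union> common b y"
    proof (rule subsetI, rule ccontr)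
      fix v assume v: "v \<in> V" "v \<notin> {a, x, b, y} \<union> common a x \<union> common b y"
      have nbr: "A v a \<or> A v b \<or> A v x \<or> A v y"
        using max_pair_nbr[OF m v(1)] v(2) unfolding X by blast
      have n1: "\<not> (A v a \<and> A v x)" "\<not> (A v b \<and> A v y)" using v(2) unfolding common_def by blast+
      have n2: "\<not> (A v a \<and> A v b)" using v(2) X unfolding common_def by blast
      have n3: "\<not> (A v a \<and> A v y)" using consecutive_edges[OF h e] by blast
      have n4: "\<not> (A v b \<and> A v x)" using consecutive_edges[OF h' f(2,3)] by blast
      have n5: "\<not> (A v x \<and> A v y \<and> \<not> A v a \<and> \<not> A v b)"
      proof
        assume vv: "A v x \<and> A v y \<and> \<not> A v a \<and> \<not> A v b"
        have "v \<noteq> a" "v \<noteq> b" using v(2) by blast+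
        then show False using max_pair_third[OF m, of v x y] vv x f(1) yx unfolding X by blast
      qed
      have o1: "\<not> (A v a \<and> \<not> A v b \<and> \<not> A v x \<and> \<not> A v y)"
        using edge_single[OF h' f(2,3), of v] by blast
      have o2: "\<not> (A v b \<and> \<not> A v a \<and> \<not> A v x \<and> \<not> A v y)"
        using edge_single[OF h e, of v] by blast
      have o3: "\<not> (A v x \<and> \<not> A v a \<and> \<not> A v b \<and> \<not> A v y)"
        using edge_single[OF hole4_reflect[OF hole4_rot[OF h']] f(3,2), of v] by blast
      have o4: "\<not> (A v y \<and> \<not> A v a \<and> \<not> A v b \<and> \<not> A v x)"
        using edge_single[OF hole4_reflect[OF hole4_rot[OF h]] e(2,1), of v] by blast
      show False using nbr n1 n2 n3 n4 n5 o1 o2 o3 o4 by blast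
    qed
    moreover have "{a, x, b, y} \<union> common a x \<union> common b y \<subseteq> V"
      using common_V h A_V unfolding hole4_def by blast
    ultimately show ?thesis by (intro two_edges_contact[OF h]) blast
  next
    case False
    \<comment> \<open>All such vertices \<open>z\<close> have the same second common neighbour,
      since they see at most two and their traces are nested.\<close>
    have "\<exists>y\<in>common a b. y \<noteq> x \<and> (\<forall>z p. z \<noteq> a \<and> z \<noteq> b \<and> \<not> A z a \<and> \<not> A z b \<and> p \<in> common a b \<and> p \<noteq> x \<and> A z x \<and> A z p
      \<longrightarrow> p = y)"
    proof (cases "\<exists>z p. z \<noteq> a \<and> z \<noteq> b \<and> \<not> A z a \<and> \<not> A z b \<and> p \<in> common a b \<and> p \<noteq> x \<and> A z x \<and> A z p")
      case True
      then obtain z p where z: "z \<noteq> a" "z \<noteq> b" "\<not> A z a" "\<not> A z b" "p \<in> common a b" "p \<noteq> x" "A z x" "A z p" by blast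
      have "q = p" if w: "w \<noteq> a" "w \<noteq> b" "\<not> A w a" "\<not> A w b" "q \<in> common a b" "q \<noteq> x" "A w x" "A w q" for w q
      proof (rule ccontr)
        assume n: "q \<noteq> p"
        have "\<not> A w p" using max_pair_two[OF m w(1-4) x w(7) w(5) w(8) z(5)] z(6) w(6) n by metis
        moreover have "\<not> A z q" using max_pair_two[OF m z(1-4) x z(7) z(5) z(8) w(5)] z(6) w(6) n by metis
        ultimately show False using max_pair_cross[OF m z(3) w(3) z(5,8) _ w(5,8)] by blast
      qed
      then show ?thesis using z(5,6) by blast
    next
      case False
      then show ?thesis using x' by blast
    qed
    then obtain y where y: "y \<in> common a b" "y \<noteq> x"
      and Zp: "\<And>z p. z \<noteq> a \<Longrightarrow> z \<noteq> b \<Longrightarrow> \<not> A z a \<Longrightarrow> \<not> A z b \<Longrightarrow> p \<in> common a b \<Longrightarrow> p \<noteq> x \<Longrightarrow> A z x \<Longrightarrow> A z p \<Longrightarrow> p = y"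
      by blast
    have h: "hole4 a x b y" using hole[OF x y(1)] y(2) by blast
    have nb: "\<not> A v b" if v: "v \<in> outer a b" for v
    proof
      assume vb: "A v b"
      have "\<not> A v a" using outer_not_both[OF v] vb by blast
      then show False using edge_single[OF h e vb] False vb x y(1) by blast
    qed
    have "covered a x b y"
    proof (rule max_pair_covered[OF m x y(1) y(2)[symmetric] nb])
      show "w = x" if "v \<in> outer a b" "w \<in> common a b" "A v a" "A v w" for v w
        using consecutive_edges[OF hole[OF x that(2)] e that(3,4)] by blast
      show "w = x \<or> A v x \<and> A v y" if v: "v \<in> outer a b" "w \<in> common a b" "\<not> A v a" "A v w" for v w
      proof (cases "w = x")
        case False
        have vx: "A v x"
        proof (rule ccontr)
          assume "\<not> A v x"
          then show False
            by (intro no_P5_closed[of e x b w v];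
              use e eb eX[OF v(2) False] nb[OF v(1)] v(4) Xab[OF x] Xab[OF v(2)] XX[OF x v(2)] in \<open>simp add: adj_commute[of G]\<close>)
        qed
        have "v \<noteq> a" "v \<noteq> b" using v(1) unfolding outer_def by blast+
        then have "w = y" using Zp[of v w] v nb[OF v(1)] vx False by blast
        then show ?thesis using vx v(4) by blast
      qed simp
    qed simp_all
    then show ?thesis by (rule square_core_contact[OF h])
  qed
qed

text \<open>Among outer vertices away from \<open>a\<close>, a \<open>single\<close> one sees one
  common neighbour and a \<open>multi\<close> one sees two. Nested traces make all
  \<open>multi\<close> vertices see the same pair and put the neighbour of any \<open>single\<close>
  vertex into it; all \<open>single\<close> vertices share their neighbour by
  \<open>opposite_single\<close>. That neighbour serves as \<open>x\<close>, and \<open>y\<close>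
  completes the pair.\<close>

lemma max_pair_no_edge_contact:
  assumes m: "max_pair a b"
    and no: "\<And>v x. v \<in> outer a b \<Longrightarrow> x \<in> common a b \<Longrightarrow> \<not> (A v a \<and> A v x)"
    and nb: "\<And>v. v \<in> outer a b \<Longrightarrow> \<not> A v b"
  shows "contact_B0_VPG G"
proof -
  have ab: "a \<noteq> b" "\<not> A a b" using m unfolding max_pair_def by auto
  have hole: "hole4 a p b q" if "p \<in> common a b" "q \<in> common a b" "p \<noteq> q" for p q
    using max_pair_hole4[OF m that] .
  define single where "single s w \<longleftrightarrow> s \<in> outer a b \<and> \<not> A s a \<and> w \<in> common a b \<and> A s w \<and> (\<forall>p\<in>common a b. A s p \<longrightarrow> p = w)" for s w
  define multi where "multi z p q \<longleftrightarrow> z \<in> outer a b \<and> \<not> A z a \<and> p \<in> common a b \<and> q \<in> common a b \<and> p \<noteq> q \<and> A z p \<and> A z q" for z p q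
  have dich: "single v w \<or> (\<exists>p. multi v w p)" if "v \<in> outer a b" "\<not> A v a" "w \<in> common a b" "A v w" for v w
    using that unfolding single_def multi_def by blast
  have multi_two: "r = p \<or> r = q" if z: "multi z p q" and r: "r \<in> common a b" "A z r" for z p q r
  proof -
    have "z \<noteq> a" "z \<noteq> b" "\<not> A z b" using z nb unfolding multi_def outer_def by blast+
    then show ?thesis using max_pair_two[OF m, of z p q r] z r unfolding multi_def by blast
  qed
  have multi_uniq: "A w r" if z: "multi z p q" and w: "multi w p' q'" and r: "r \<in> common a b" "A z r" for z w p q p' q' r
  proof (rule ccontr)
    assume n: "\<not> A w r"
    have "\<exists>t\<in>common a b. A w t \<and> \<not> A z t"
    proof (rule ccontr)
      assume "\<not> (\<exists>t\<in>common a b. A w t \<and> \<not> A z t)"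
      then have "A z p'" "A z q'" using w unfolding multi_def by blast+
      then have "p' \<in> {p, q}" "q' \<in> {p, q}" "r \<in> {p, q}"
        using multi_two[OF z] w r unfolding multi_def by blast+
      then have "r = p' \<or> r = q'" using w unfolding multi_def by blast
      then show False using n w unfolding multi_def by blast
    qed
    then obtain t where "t \<in> common a b" "A w t" "\<not> A z t" by blast
    then show False
      using max_pair_cross[OF m, of z w r t] z w r n unfolding multi_def by blast
  qed
  have single_uniq: "w = w'" if s: "single s w" and s': "single s' w'" for s s' w w'
  proof (rule ccontr)
    assume n: "w \<noteq> w'"
    have h: "hole4 w b w' a"
      using hole4_rot[OF hole] s s' n unfolding single_def by blast
    show False
      by (rule opposite_single[OF h, of s s']) (use s s' n nb in \<open>auto simp: single_def\<close>)
  qed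
  have single_multi: "A z w" if s: "single s w" and z: "multi z p q" for s w z p q
  proof (rule ccontr)
    assume n: "\<not> A z w"
    have "\<exists>t\<in>common a b. A z t \<and> \<not> A s t" using s z unfolding single_def multi_def by blast
    then show False using max_pair_cross[OF m, of s z w] s z n unfolding single_def multi_def by blast
  qed
  have "\<exists>x y. x \<in> common a b \<and> y \<in> common a b \<and> x \<noteq> y \<and> (\<forall>s w. single s w \<longrightarrow> w = x) \<and>
    (\<forall>z p q. multi z p q \<longrightarrow> A z x \<and> A z y)"
  proof (cases "\<exists>z p q. multi z p q")
    case True
    then obtain z p q where z: "multi z p q" by blast
    have pq: "p \<in> common a b" "q \<in> common a b" "p \<noteq> q" "A z p" "A z q" using z unfolding multi_def by auto
    have M: "A u p \<and> A u q" if "multi u p' q'" for u p' q'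
      using multi_uniq[OF z that pq(1,4)] multi_uniq[OF z that pq(2,5)] by blast
    show ?thesis
    proof (cases "\<exists>s w. single s w")
      case True
      then obtain s w where s: "single s w" by blast
      have "w = p \<or> w = q"
        using multi_two[OF z _ single_multi[OF s z]] s unfolding single_def by blast
      then show ?thesis using pq M single_uniq[OF _ s] by metis
    next
      case False
      then show ?thesis using pq M by blast
    qed
  next
    case nomulti: False
    obtain x0 where x0: "x0 \<in> common a b" using max_pair_other[OF m] by blast
    have "\<exists>x\<in>common a b. \<forall>s w. single s w \<longrightarrow> w = x"
    proof (cases "\<exists>s w. single s w")
      case True
      then obtain s w where s: "single s w" by blast
      then have "w \<in> common a b" unfolding single_def by blast
      then show ?thesis using single_uniq[OF _ s] by blast
    next
      case False
      then show ?thesis using x0 by blast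
    qed
    then obtain x where x: "x \<in> common a b" "\<And>s w. single s w \<Longrightarrow> w = x" by blast
    obtain y where "y \<in> common a b" "y \<noteq> x" using max_pair_other[OF m] by blast
    moreover have "\<forall>z p q. multi z p q \<longrightarrow> A z x \<and> A z y" using nomulti by blast
    ultimately show ?thesis using x by blast
  qed
  then obtain x y where xy: "x \<in> common a b" "y \<in> common a b" "x \<noteq> y"
    and S: "\<And>s w. single s w \<Longrightarrow> w = x" and M: "\<And>z p q. multi z p q \<Longrightarrow> A z x \<and> A z y" by blast
  have "covered a x b y"
  proof (rule max_pair_covered[OF m xy nb])
    show "w = x" if "v \<in> outer a b" "w \<in> common a b" "A v a" "A v w" for v w
      using no[OF that(1,2)] that(3,4) by blast
    show "w = x \<or> A v x \<and> A v y" if "v \<in> outer a b" "w \<in> common a b" "\<not> A v a" "A v w" for v w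
      using dich[OF that(1,3,2,4)] S M by blast
  qed simp_all
  then show ?thesis using square_core_contact[OF hole[OF xy]] by blast
qed

text \<open>The roles of \<open>a\<close> and \<open>b\<close> can be exchanged. When no vertex sees
  both an end of the pair and a common neighbour, \<open>opposite_single\<close> shows that one of
  \<open>a\<close> and \<open>b\<close> has no outer neighbours.\<close>

lemma hole4_contact:
  assumes h: "hole4 p q r s"
  shows "contact_B0_VPG G"
proof -
  let ?P = "\<lambda>(u, v). u \<noteq> v \<and> \<not> A u v" and ?f = "\<lambda>(u, v). card (common u v)"
  have pr: "?P (p, r)" using h unfolding hole4_def by simp
  have bound: "\<forall>y. ?P y \<longrightarrow> ?f y < card V + 1"
    using card_mono[OF finite_V common_V] by (auto simp: less_Suc_eq_le)
  obtain t where t: "?P t" "\<And>y. ?P y \<Longrightarrow> ?f y \<le> ?f t"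
    using ex_has_greatest_nat[of ?P "(p, r)" ?f, OF pr bound] by blast
  obtain a b where ab: "t = (a, b)" by fastforce
  have "{q, s} \<subseteq> common p r" using h A_sym unfolding hole4_def common_def by blast
  then have "card {q, s} \<le> card (common p r)" by (rule card_mono[OF finite_common])
  then have "2 \<le> card (common p r)" using h unfolding hole4_def by simp
  then have m: "max_pair a b"
    using t(1) t(2)[OF pr] t(2)[of "(u, v)" for u v] unfolding max_pair_def ab by auto
  have m': "max_pair b a" by (rule max_pair_sym[OF m])
  have cb: "common b a = common a b" by (rule common_commute)
  show ?thesis
  proof (cases "\<exists>v x. x \<in> common a b \<and> A v x \<and> (A v a \<or> A v b)")
    case True
    then show ?thesis
      using max_pair_edge_contact[OF m] max_pair_edge_contact[OF m'] unfolding cb by blast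
  next
    case False
    obtain x where x: "x \<in> common a b" using max_pair_other[OF m] by blast
    obtain y where y: "y \<in> common a b" "y \<noteq> x" using max_pair_other[OF m] by blast
    have hxy: "hole4 a x b y" using max_pair_hole4[OF m x y(1)] y(2) by blast
    have "(\<forall>v\<in>outer a b. \<not> A v b) \<or> (\<forall>v\<in>outer a b. \<not> A v a)"
    proof (rule ccontr)
      assume "\<not> ?thesis"
      then obtain v w where v: "v \<in> outer a b" "A v a" and w: "w \<in> outer a b" "A w b" by blast
      show False
        using opposite_single[OF hxy v(2) _ _ _ w(2)] outer_not_both[OF v(1)] outer_not_both[OF w(1)] False v w x y(1)
        by blast
    qed
    then show ?thesis
      using max_pair_no_edge_contact[OF m] max_pair_no_edge_contact[OF m'] False
      unfolding outer_sym[of b a] cb by blast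
  qed
qed

end

context connected_free_graph
begin

lemma connected_contact:
  assumes "V \<noteq> {}"
  shows "contact_B0_VPG G"
proof (cases "\<exists>a b c d e. hole5 a b c d e")
  case True
  then show ?thesis using hole5_contact by blast
next
  case False
  then interpret hole5_free_graph G by unfold_locales blast
  show ?thesis
    using hole4_contact no_hole_contact[OF _ no_hole5 assms] by blast
qed

end

section \<open>Disconnected graphs\<close>

lemma simple_induced: "simple_graph G \<Longrightarrow> S \<subseteq> verts G \<Longrightarrow> simple_graph (induced_subgraph G S)"
  unfolding simple_graph_def induced_subgraph_def all_edges_def using finite_subset by fastforce

lemma graph_free_induced:
  assumes "graph_free \<H> G" "S \<subseteq> verts G"
  shows "graph_free \<H> (induced_subgraph G S)"
proof -
  have "induced_subgraph (induced_subgraph G S) T = induced_subgraph G T" if "T \<subseteq> S" for T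
    using that unfolding induced_subgraph_def by auto
  then show ?thesis
    using assms unfolding graph_free_def by (auto simp: induced_subgraph_def)
qed

lemma adj_induced: "adj (induced_subgraph G S) u v \<longleftrightarrow> adj G u v \<and> u \<in> S \<and> v \<in> S"
  by (auto simp: adj_def induced_subgraph_def)

text \<open>A cut without edges splits the graph into two smaller induced subgraphs, whose drawings
  are placed side by side; if there is none, the connected case applies.\<close>

lemma free_graph_contact:
  assumes "simple_graph G" "graph_free {path_graph 5} G" "graph_free forbidden_graphs G"
  shows "contact_B0_VPG G"
  using assms
proof (induction "card (verts G)" arbitrary: G rule: less_induct)
  case less
  interpret free_graph G by unfold_locales (use less.prems in auto)
  consider "verts G = {}" | D where "D \<subseteq> verts G" "D \<noteq> {}" "D \<noteq> verts G" "\<forall>u\<in>D. \<forall>v\<in>verts G - D. \<not> adj G u v"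
    | "verts G \<noteq> {}" "\<And>D. D \<subseteq> verts G \<Longrightarrow> D \<noteq> {} \<Longrightarrow> D \<noteq> verts G \<Longrightarrow> \<exists>u\<in>D. \<exists>v\<in>verts G - D. adj G u v"
    by blast
  then show ?case
  proof cases
    case 1
    then show ?thesis unfolding contact_B0_VPG_def contact_rep_iff rep_def by blast
  next
    case (2 D)
    have sub: "\<exists>P. rep (adj G) S P" if S: "S \<subset> verts G" for S
    proof -
      have SV: "S \<subseteq> verts G" using S by blast
      have vS: "verts (induced_subgraph G S) = S" by (simp add: induced_subgraph_def)
      have "contact_B0_VPG (induced_subgraph G S)"
      proof (rule less.hyps)
        show "card (verts (induced_subgraph G S)) < card (verts G)"
          unfolding vS by (rule psubset_card_mono[OF finite_V S])
      qed (use simple_induced graph_free_induced less.prems SV in blast)+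
      then obtain P where "rep (adj (induced_subgraph G S)) S P"
        unfolding contact_B0_VPG_def contact_rep_iff vS by blast
      then have "rep (adj G) S P" by (rule rep_cong) (auto simp: adj_induced)
      then show ?thesis by blast
    qed
    have ps: "D \<subset> verts G" "verts G - D \<subset> verts G" using 2 by blast+
    obtain P where P: "rep (adj G) D P" using sub[OF ps(1)] by (elim exE)
    obtain R where R: "rep (adj G) (verts G - D) R" using sub[OF ps(2)] by (elim exE)
    have "\<exists>P. rep (adj G) (D \<union> (verts G - D)) P"
    proof (rule rep_disjoint_union[OF P R])
      show "finite D" using 2(1) finite_V finite_subset by blast
      show "finite (verts G - D)" using finite_V by blast
      show "D \<inter> (verts G - D) = {}" by blast
      show "\<not> adj G u v \<and> \<not> adj G v u" if "u \<in> D" "v \<in> verts G - D" for u v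
        using 2(4) that A_sym by blast
    qed
    moreover have "D \<union> (verts G - D) = verts G" using 2(1) by blast
    ultimately show ?thesis unfolding contact_B0_VPG_def contact_rep_iff by auto
  next
    case 3
    interpret connected_free_graph G by unfold_locales (rule 3(2))
    show ?thesis by (rule connected_contact[OF 3(1)])
  qed
qed

theorem theorem32:
  fixes G :: "'a graph"
  assumes "simple_graph G"
    and "graph_free {path_graph 5} G"
  shows "contact_B0_VPG G \<longleftrightarrow> graph_free forbidden_graphs G"
  using contact_forbidden_free free_graph_contact assms by blast

end
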